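(* Let $N>1$ be an integer, $\alpha_N^\perp=\alpha^\perp\!\left(e^{-\pi\sqrt{2N}}\right)$. Then $$\sqrt{\frac{2}{N}}\frac{1}{2\pi}=\sum_{k=0}^\infty\frac{\left(\frac12\right)_k\left(\frac14\right)_k\left(\frac34\right)_k}{(k!)^3}\left(b_N^\perp k+a_N^\perp\right)\left(X_N^\perp\right)^k,$$ where $b_N^\perp=1-2\alpha_N^\perp$, $a_N^\perp=-\frac{1}{2\sqrt N}D_N^\perp(q)\big|_{q=e^{-2\pi/\sqrt{2N}}}$, and $X_N^\perp=4\alpha_N^\perp(1-\alpha_N^\perp)$.
   Context: $\eta(\tau)=e^{\pi i\tau/12}\prod_{k\ge1}(1-e^{2\pi ik\tau})$ is the Dedekind eta function. With $q=e^{\pi i\tau}$, define $A$ by $A(q^2)=\frac{\eta^8(\tau)+32\eta^8(4\tau)}{\eta^4(2\tau)}$ (so $A^2(q^2)=\frac{\eta^{16}(\tau)}{\eta^8(2\tau)}\bigl(1+64\frac{\eta^{24}(2\tau)}{\eta^{24}(\tau)}\bigr)$), and $\alpha^\perp$ by $\frac{1}{\alpha^\perp(q^2)}=1+\frac{1}{64}\frac{\eta^{24}(\tau)}{\eta^{24}(2\tau)}$. For a positive integer $N$, $$D_N^\perp(q)=\frac{1}{\sqrt{A^3(q)A^3(q^N)}}\det\begin{pmatrix}A(q)&A(q^N)\\ q\frac{dA(q)}{dq}&q\frac{dA(q^N)}{dq}\end{pmatrix}.$$ $(a)_k$ is the Pochhammer symbol. *)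

theory Defs
  imports "HOL-Analysis.Analysis"
begin

definition dedekind_eta :: "complex \<Rightarrow> complex" where
  "dedekind_eta \<tau> =
     exp (of_real pi * \<i> * \<tau> / 12) * (\<Prod>k. 1 - exp (2 * of_real pi * \<i> * of_nat (Suc k) * \<tau>))"

text \<open>
  The functions \<open>A\<close> and \<open>\<alpha>\<^sup>\<bottom>\<close> are given at the point \<open>exp (2 \<pi> \<i> \<tau>)\<close> by eta quotients in \<open>\<tau>\<close>.
  As functions of the nome \<open>z\<close> they are evaluated at the principal preimage
  \<open>\<tau> = Ln z / (2 \<pi> \<i>)\<close>; the lemmas \<open>A_fun_exp\<close> and \<open>alpha_perp_exp\<close> below show that the choice
  of preimage does not matter.
\<close>

definition nome_tau :: "complex \<Rightarrow> complex" where
  "nome_tau z = Ln z / (2 * of_real pi * \<i>)"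

definition A_fun :: "complex \<Rightarrow> complex" where
  "A_fun z = (let \<tau> = nome_tau z in
     (dedekind_eta \<tau> ^ 8 + 32 * dedekind_eta (4 * \<tau>) ^ 8) / dedekind_eta (2 * \<tau>) ^ 4)"

definition alpha_perp :: "complex \<Rightarrow> complex" where
  "alpha_perp z = (let \<tau> = nome_tau z in
     1 / (1 + 1 / 64 * (dedekind_eta \<tau> ^ 24 / dedekind_eta (2 * \<tau>) ^ 24)))"

definition D_perp :: "nat \<Rightarrow> complex \<Rightarrow> complex" where
  "D_perp N q =
     1 / csqrt (A_fun q ^ 3 * A_fun (q ^ N) ^ 3) *
     det (vector [vector [A_fun q, A_fun (q ^ N)],
                  vector [q * deriv A_fun q, q * deriv (\<lambda>z. A_fun (z ^ N)) q]] :: complex^2^2)"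

lemma dedekind_eta_plus_int:
  "dedekind_eta (\<tau> + of_int n) = exp (of_real pi * \<i> * of_int n / 12) * dedekind_eta \<tau>"
proof -
  have per: "exp (2 * of_real pi * \<i> * of_nat (Suc k) * (\<tau> + of_int n)) =
             exp (2 * of_real pi * \<i> * of_nat (Suc k) * \<tau>)" for k
  proof -
    have "2 * of_real pi * \<i> * of_nat (Suc k) * (\<tau> + of_int n) =
          2 * of_real pi * \<i> * of_nat (Suc k) * \<tau> + of_real (of_int (2 * (int (Suc k) * n)) * pi) * \<i>"
      by (simp add: algebra_simps)
    then show ?thesis
      unfolding exp_eq by blast
  qed
  have lin: "of_real pi * \<i> * (\<tau> + of_int n) / 12 =
        of_real pi * \<i> * of_int n / 12 + of_real pi * \<i> * \<tau> / 12"
    by (simp add: field_simps)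
  show ?thesis
    unfolding dedekind_eta_def per lin exp_add by (simp only: mult.assoc)
qed

lemma nome_tau_exp: "\<exists>n. nome_tau (exp (2 * of_real pi * \<i> * \<tau>)) = \<tau> + of_int n"
proof -
  have "exp (Ln (exp (2 * of_real pi * \<i> * \<tau>))) = exp (2 * of_real pi * \<i> * \<tau>)"
    by simp
  then obtain n :: int where
    "Ln (exp (2 * of_real pi * \<i> * \<tau>)) = 2 * of_real pi * \<i> * \<tau> + of_int (2 * n) * of_real pi * \<i>"
    unfolding exp_eq by (auto simp: mult.assoc)
  then have "nome_tau (exp (2 * of_real pi * \<i> * \<tau>)) = \<tau> + of_int n"
    by (simp add: nome_tau_def field_simps)
  then show ?thesis by blast
qed

lemma dedekind_eta_shift_power:
  "dedekind_eta (of_nat m * (\<tau> + of_int n)) ^ j =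
     exp (of_real pi * \<i> * of_int n * of_nat (m * j) / 12) * dedekind_eta (of_nat m * \<tau>) ^ j"
proof -
  have "of_nat m * (\<tau> + of_int n) = of_nat m * \<tau> + of_int (int m * n)"
    by (simp add: algebra_simps)
  then have "dedekind_eta (of_nat m * (\<tau> + of_int n)) =
      exp (of_real pi * \<i> * of_int (int m * n) / 12) * dedekind_eta (of_nat m * \<tau>)"
    by (simp only: dedekind_eta_plus_int)
  then show ?thesis
    by (simp add: power_mult_distrib exp_of_nat_mult [symmetric] mult_ac)
qed

lemma exp_pi_int: "exp (of_real pi * \<i> * of_int n * 2) = 1"
  unfolding exp_eq_1 by (auto intro!: exI [of _ n])

lemma A_fun_exp:
  "A_fun (exp (2 * of_real pi * \<i> * \<tau>)) =
     (dedekind_eta \<tau> ^ 8 + 32 * dedekind_eta (4 * \<tau>) ^ 8) / dedekind_eta (2 * \<tau>) ^ 4"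
proof -
  obtain n where n: "nome_tau (exp (2 * of_real pi * \<i> * \<tau>)) = \<tau> + of_int n"
    using nome_tau_exp by blast
  define c :: complex where "c = exp (of_real pi * \<i> * of_int n * 8 / 12)"
  have e1: "dedekind_eta (\<tau> + of_int n) ^ 8 = c * dedekind_eta \<tau> ^ 8"
    using dedekind_eta_shift_power [of 1 \<tau> n 8] by (simp add: c_def)
  have e2: "dedekind_eta (2 * (\<tau> + of_int n)) ^ 4 = c * dedekind_eta (2 * \<tau>) ^ 4"
    using dedekind_eta_shift_power [of 2 \<tau> n 4] by (simp add: c_def)
  have "of_real pi * \<i> * of_int n * 32 / 12 =
        of_real pi * \<i> * of_int n * 8 / 12 + of_real pi * \<i> * of_int n * 2"
    by simp
  then have "exp (of_real pi * \<i> * of_int n * 32 / 12) = c"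
    by (simp only: exp_add exp_pi_int c_def mult_1_right)
  then have e4: "dedekind_eta (4 * (\<tau> + of_int n)) ^ 8 = c * dedekind_eta (4 * \<tau>) ^ 8"
    using dedekind_eta_shift_power [of 4 \<tau> n 8] by simp
  have c0: "c \<noteq> 0"
    by (simp add: c_def)
  have "A_fun (exp (2 * of_real pi * \<i> * \<tau>)) =
     (c * (dedekind_eta \<tau> ^ 8 + 32 * dedekind_eta (4 * \<tau>) ^ 8)) / (c * dedekind_eta (2 * \<tau>) ^ 4)"
    unfolding A_fun_def Let_def n e1 e2 e4 by (simp add: algebra_simps)
  then show ?thesis
    using c0 by simp
qed

lemma alpha_perp_exp:
  "alpha_perp (exp (2 * of_real pi * \<i> * \<tau>)) =
     1 / (1 + 1 / 64 * (dedekind_eta \<tau> ^ 24 / dedekind_eta (2 * \<tau>) ^ 24))"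
proof -
  obtain n where n: "nome_tau (exp (2 * of_real pi * \<i> * \<tau>)) = \<tau> + of_int n"
    using nome_tau_exp by blast
  have e1: "dedekind_eta (\<tau> + of_int n) ^ 24 = dedekind_eta \<tau> ^ 24"
    using dedekind_eta_shift_power [of 1 \<tau> n 24] exp_pi_int [of n] by (simp add: mult_ac)
  have "of_real pi * \<i> * of_int n * 48 / 12 = of_real pi * \<i> * of_int (2 * n) * (2 :: complex)"
    by simp
  then have "exp (of_real pi * \<i> * of_int n * 48 / 12) = (1 :: complex)"
    by (simp only: exp_pi_int)
  then have e2: "dedekind_eta (2 * (\<tau> + of_int n)) ^ 24 = dedekind_eta (2 * \<tau>) ^ 24"
    using dedekind_eta_shift_power [of 2 \<tau> n 24] by simp
  show ?thesis
    unfolding alpha_perp_def Let_def n e1 e2 by (rule refl)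
qed

end

theory Submission
  imports Defs "HOL-Real_Asymp.Real_Asymp"
begin

text \<open>
  By the Jacobi triple product, \<open>A = \<theta>\<^sub>3\<^sup>4 + \<theta>\<^sub>2\<^sup>4\<close> and \<open>\<alpha>\<^sup>\<bottom> = 4\<lambda> / (1 + \<lambda>)\<^sup>2\<close> with \<open>\<lambda> = \<theta>\<^sub>2\<^sup>4 / \<theta>\<^sub>3\<^sup>4\<close>.
  The duplication formulas for theta functions are the Landen transformation for \<open>\<lambda>\<close>. With
  \<open>\<Theta> = q d/dq\<close>, they show that \<open>\<Theta>\<lambda> / (\<lambda> (1 - \<lambda>) \<theta>\<^sub>3\<^sup>4)\<close> is invariant under \<open>q \<mapsto> q\<^sup>2\<close>, and that the residual of
  \<open>\<Theta>\<^sup>2 v = - \<lambda> (1 - \<lambda>) v^(-3) / 4\<close> for \<open>v = \<theta>\<^sub>3^(-2)\<close> is invariant up to a factor 4; letting \<open>q\<close> tend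
  to 0 determines both. The hypergeometric equations then say that \<open>F(\<lambda>) v\<close> and \<open>F(1 - \<lambda>) v\<close>, where
  \<open>F = \<^sub>2F\<^sub>1(1/2, 1/2; 1)\<close>, are affine functions of \<open>log q\<close>, and that \<open>\<^sub>3F\<^sub>2(1/2, 1/4, 3/4; 1, 1; X) / A\<close> is
  a quadratic polynomial in \<open>log q\<close>. Their behaviour as \<open>q\<close> tends to 0 or 1 gives the inversion formula
  \<open>A(e^(-\<pi>/t)) = 2 t\<^sup>2 A(e^(-2\<pi>t))\<close> and the identity \<open>A = \<^sub>3F\<^sub>2(X)\<close> for \<open>q < e^(-\<pi>\<surd>2)\<close>. Differentiating the
  inversion formula at \<open>t = \<surd>(N/2)\<close> turns the series into the stated constant.
\<close>

section \<open>Power series and linear differential equations\<close>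

text \<open>Apart from the product formulas everything takes place on the real ray q = e^x, x < 0;
  complex nomes serve the definitions and one square root of -p. No Poisson summation and no modular
  transformation law is used: in the variable x the logarithmic solutions of the differential
  equations are nonconstant polynomials, so a finite limit at -infinity singles out a solution, and
  pi enters the inversion formula through the growth of the coefficients of F. The bound q < e^(-pi
  sqrt 2) comes from the fixed point x = -pi sqrt 2 of the inversion x -> 2 pi^2 / x, where alpha =
  1/2 and X = 1. Since X is symmetric under alpha -> 1 - alpha, beyond that point the series in X
  returns the value of A at the mirrored point. N > 1 puts the evaluation point x = -pi sqrt(2N)
  strictly on the right side. At q = e^(-2 pi / sqrt(2N)) the inversion exchanges q and q^N, so the
  determinant defining a_N reduces to A and its derivative at one point. That derivative cancels
  against the contribution of b_N, which leaves a number free of A.\<close>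

text \<open>The exponent \<open>j\<close> records how often \<open>x d/dx\<close> has been applied to \<open>\<Sum>m. c m x^m\<close>.\<close>

definition psum :: "(nat \<Rightarrow> real) \<Rightarrow> nat \<Rightarrow> 'a::{real_normed_field,banach} \<Rightarrow> 'a" where
  "psum c j x = (\<Sum>m. of_real (real m ^ j * c m) * x ^ m)"

lemma summable_psum:
  fixes x :: "'a::{real_normed_field,banach}"
  assumes c: "Bseq c" and x: "norm x < 1"
  shows "summable (\<lambda>m. of_real (real m ^ j * c m) * x ^ m)"
  using x
proof (induction j arbitrary: x)
  case 0
  obtain C where C: "\<And>m. \<bar>c m\<bar> \<le> C"
    using c by (auto simp: Bseq_def)
  show ?case
  proof (rule summable_comparison_test')
    show "summable (\<lambda>m. C * norm x ^ m)"
      using 0 by (intro summable_mult summable_geometric) auto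
    show "norm (of_real (real m ^ 0 * c m) * x ^ m) \<le> C * norm x ^ m" for m
      using C[of m] by (simp add: norm_mult norm_power mult_right_mono)
  qed
next
  case (Suc j)
  have "summable (\<lambda>m. diffs (\<lambda>m. of_real (real m ^ j * c m)) m * x ^ m)"
    using termdiff_converges[OF Suc.prems Suc.IH] by simp
  from diffs_equiv[OF this] have
    "summable (\<lambda>m. of_nat m * of_real (real m ^ j * c m) * x ^ (m - Suc 0))"
    by (rule sums_summable)
  from summable_mult[OF this, of x] show ?case
    by (rule back_subst[of summable]) (auto simp: fun_eq_iff power_eq_if mult_ac)
qed

lemma psum_sums:
  fixes x :: "'a::{real_normed_field,banach}"
  assumes "Bseq c" "norm x < 1"
  shows "(\<lambda>m. of_real (real m ^ j * c m) * x ^ m) sums psum c j x"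
  unfolding psum_def by (rule summable_sums[OF summable_psum[OF assms]])

lemma of_real_psum:
  assumes "Bseq c" "\<bar>x\<bar> < 1"
  shows "psum c j (of_real x :: 'a::{real_normed_field,banach}) = of_real (psum c j x)"
proof -
  have "(\<lambda>m. of_real (real m ^ j * c m * x ^ m)) sums (of_real (psum c j x) :: 'a)"
    unfolding psum_def using summable_psum[OF assms(1), of x j] assms(2)
    by (intro sums_of_real) (simp add: summable_sums_iff)
  then show ?thesis
    unfolding psum_def by (simp add: sums_iff)
qed

text \<open>The derivative is given as a \<open>diffs\<close> series instead of
  \<open>psum c (Suc j) x / x\<close> because it is also needed at x = 0; multiplication by x
  recovers the shift of j.\<close>

lemma
  fixes x :: "'a::{real_normed_field,banach}"
  assumes c: "Bseq c" and x: "norm x < 1"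
  shows DERIV_psum_0: "(psum c j has_field_derivative
           (\<Sum>m. diffs (\<lambda>m. of_real (real m ^ j * c m)) m * x ^ m)) (at x)"
    and mult_diffs_psum: "x * (\<Sum>m. diffs (\<lambda>m. of_real (real m ^ j * c m)) m * x ^ m) = psum c (Suc j) x"
proof -
  let ?a = "\<lambda>m. of_real (real m ^ j * c m) :: 'a"
  show "(psum c j has_field_derivative (\<Sum>m. diffs ?a m * x ^ m)) (at x)"
    unfolding psum_def using summable_psum[OF c] x
    by (intro termdiffs_strong'[of 1]) auto
  have "summable (\<lambda>m. diffs ?a m * x ^ m)"
    using termdiff_converges[OF x summable_psum[OF c]] by simp
  from sums_mult[OF diffs_equiv[OF this], of x]
  have "(\<lambda>m. of_real (real m ^ Suc j * c m) * x ^ m) sums (x * (\<Sum>m. diffs ?a m * x ^ m))"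
    by (rule back_subst[of "\<lambda>f. f sums _"]) (auto simp: fun_eq_iff power_eq_if mult_ac)
  then show "x * (\<Sum>m. diffs ?a m * x ^ m) = psum c (Suc j) x"
    unfolding psum_def by (simp add: sums_iff)
qed

lemma psum_0 [simp]:
  "psum c 0 (0::'a::{real_normed_field,banach}) = of_real (c 0)"
  "psum c (Suc j) (0::'a) = 0"
proof -
  have *: "psum c j (0::'a) = of_real (0 ^ j * c 0)" for j
  proof -
    have "(\<lambda>m. of_real (real m ^ j * c m) * (0::'a) ^ m) sums (\<Sum>m\<in>{0}. of_real (real m ^ j * c m) * 0 ^ m)"
      by (rule sums_finite) auto
    then show ?thesis by (simp add: psum_def sums_iff)
  qed
  show "psum c 0 (0::'a) = of_real (c 0)" "psum c (Suc j) (0::'a) = 0"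
    by (simp_all add: *)
qed

lemma DERIV_psum:
  fixes x :: "'a::{real_normed_field,banach}"
  assumes "Bseq c" "norm x < 1" "x \<noteq> 0"
  shows "(psum c j has_field_derivative psum c (Suc j) x / x) (at x)"
  using DERIV_psum_0[OF assms(1,2), of j] assms(3)
  by (simp flip: mult_diffs_psum[OF assms(1,2)])

lemma isCont_psum:
  fixes x :: "'a::{real_normed_field,banach}"
  assumes "Bseq c" "norm x < 1"
  shows "isCont (psum c j) x"
  using DERIV_psum_0[OF assms] by (rule DERIV_isCont)

lemma DERIV_psum_exp:
  fixes x :: real
  assumes "Bseq c" "x < 0"
  shows "((\<lambda>x. psum c j (exp x)) has_field_derivative psum c (Suc j) (exp x)) (at x)"
  using DERIV_chain2[OF DERIV_psum[OF assms(1), of "exp x" j] DERIV_exp] assms(2) by simp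

lemma tendsto_psum_exp:
  assumes "Bseq c"
  shows "((\<lambda>x::real. psum c 0 (exp x)) \<longlongrightarrow> c 0) at_bot"
  using isCont_tendsto_compose[OF isCont_psum[OF assms, of 0 0] exp_at_bot] by simp

text \<open>\<open>psum c (Suc j)\<close> vanishes at 0, so dividing by \<open>exp x\<close> gives a
  difference quotient at 0, which \<open>CARAT_DERIV\<close> makes continuous there. The limit will
  be multiplied by factors tending to 0, so its existence suffices.\<close>

lemma tendsto_psum_exp_divide:
  assumes "Bseq c"
  shows "\<exists>L. ((\<lambda>x::real. psum c (Suc j) (exp x) / exp x) \<longlongrightarrow> L) at_bot"
proof -
  obtain g where g: "\<And>z::real. psum c (Suc j) z - psum c (Suc j) 0 = g z * (z - 0)" "isCont g 0"
    using DERIV_psum_0[OF assms, of 0 "Suc j"] by (auto simp: CARAT_DERIV)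
  have *: "psum c (Suc j) z = g z * z" for z
    using g(1)[of z] by simp
  show ?thesis
    using isCont_tendsto_compose[OF g(2) exp_at_bot] by (auto simp: *)
qed

text \<open>The weight x^2 matches the factor 4 that the residual of the second-order equation picks
  up under x -> 2x; the exponential decay absorbs it.\<close>

lemma tendsto_square_psum_exp:
  assumes "Bseq c"
  shows "((\<lambda>x::real. x\<^sup>2 * psum c (Suc j) (exp x)) \<longlongrightarrow> 0) at_bot"
proof -
  obtain L where L: "((\<lambda>x::real. psum c (Suc j) (exp x) / exp x) \<longlongrightarrow> L) at_bot"
    using tendsto_psum_exp_divide[OF assms] by blast
  have "((\<lambda>x::real. psum c (Suc j) (exp x) / exp x * (x\<^sup>2 * exp x)) \<longlongrightarrow> L * 0) at_bot"
    by (intro tendsto_mult L) real_asymp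
  then show ?thesis by (simp add: mult_ac)
qed

lemma tendsto_at_bot_of_square:
  assumes "((\<lambda>x::real. x\<^sup>2 * f x) \<longlongrightarrow> 0) at_bot"
  shows "(f \<longlongrightarrow> 0) at_bot"
proof -
  have "((\<lambda>x::real. inverse (x\<^sup>2) * (x\<^sup>2 * f x)) \<longlongrightarrow> 0 * 0) at_bot"
    by (intro tendsto_mult assms) real_asymp
  moreover have "\<forall>\<^sub>F x in at_bot. inverse (x\<^sup>2) * (x\<^sup>2 * f x) = f x"
    using eventually_gt_at_bot[of 0] by eventually_elim auto
  ultimately show ?thesis by (simp add: tendsto_cong)
qed

text \<open>The factor 1 - z turns the weights z^n into an average that forgets any finite head of
  the sequence. Applied to \<open>real n * hyp_coeff n\<close> and to \<open>hyp_coeff\<close>, this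
  gives the behaviour of \<open>Hyp\<close> and its derivative near 1.\<close>

lemma Abel_averaging:
  fixes a :: "nat \<Rightarrow> real"
  assumes "a \<longlonglongrightarrow> L"
  shows "((\<lambda>z. (1 - z) * psum a 0 z) \<longlongrightarrow> L) (at_left 1)"
proof -
  have C: "Bseq a"
    using convergent_imp_Bseq[OF convergentI[OF assms]] .
  show ?thesis
  proof (rule tendstoI)
    fix e :: real assume e: "e > 0"
    obtain N where N: "\<And>n. n \<ge> N \<Longrightarrow> \<bar>a n - L\<bar> < e / 2"
      using LIMSEQ_D[OF assms, of "e / 2"] e by auto
    define B where "B = (\<Sum>n<N. \<bar>a n - L\<bar>)"
    have "((\<lambda>z. (1 - z) * B) \<longlongrightarrow> (1 - 1) * B) (at_left 1)"
      by (intro tendsto_intros)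
    then have "\<forall>\<^sub>F z in at_left 1. dist ((1 - z) * B) 0 < e / 2"
      using e by (intro tendstoD) auto
    moreover have "\<forall>\<^sub>F z in at_left (1::real). z > 0"
      by (rule order_tendstoD[OF tendsto_ident_at]) auto
    moreover have "\<forall>\<^sub>F z in at_left (1::real). z < 1"
      by (simp add: eventually_at_filter)
    ultimately show "\<forall>\<^sub>F z in at_left 1. dist ((1 - z) * psum a 0 z) L < e"
    proof eventually_elim
      case (elim z)
      have s1: "(\<lambda>n. a n * z ^ n) sums psum a 0 z"
        using summable_psum[OF C, of z 0] elim by (simp add: psum_def summable_sums_iff)
      have s2: "(\<lambda>n. L * z ^ n) sums (L * (1 / (1 - z)))"
        using elim by (intro sums_mult geometric_sums) auto
      have s3: "(\<lambda>n. (a n - L) * z ^ n) sums (psum a 0 z - L / (1 - z))"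
        using sums_diff[OF s1 s2] by (simp add: algebra_simps)
      \<comment> \<open>Majorant for the error series: the head n < N adds up to the constant B,
        which the factor 1 - z suppresses, and the rest is e/2 times a geometric series.\<close>
      have s4: "(\<lambda>n. (if n < N then \<bar>a n - L\<bar> else 0) + e / 2 * z ^ n) sums (B + e / 2 * (1 / (1 - z)))"
        using elim sums_If_finite_set[of "{..<N}" "\<lambda>n. \<bar>a n - L\<bar>"]
        by (intro sums_add sums_mult geometric_sums) (auto simp: B_def)
      have b: "\<bar>(a n - L) * z ^ n\<bar> \<le> (if n < N then \<bar>a n - L\<bar> else 0) + e / 2 * z ^ n" for n
      proof (cases "n < N")
        case True
        have "\<bar>a n - L\<bar> * z ^ n \<le> \<bar>a n - L\<bar> * 1"
          using elim by (intro mult_left_mono power_le_one) auto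
        then show ?thesis using True e elim by (auto simp: abs_mult add_increasing2)
      next
        case False
        have "\<bar>a n - L\<bar> * z ^ n \<le> e / 2 * z ^ n"
          using elim N[of n] False by (intro mult_right_mono) auto
        then show ?thesis using False elim by (simp add: abs_mult)
      qed
      have "\<bar>psum a 0 z - L / (1 - z)\<bar> \<le> B + e / 2 * (1 / (1 - z))"
        using norm_suminf_le[OF _ sums_summable[OF s4], of "\<lambda>n. (a n - L) * z ^ n"] b
        unfolding sums_unique[OF s3, symmetric] sums_unique[OF s4, symmetric] by simp
      then have "(1 - z) * \<bar>psum a 0 z - L / (1 - z)\<bar> \<le> (1 - z) * (B + e / 2 * (1 / (1 - z)))"
        using elim by (intro mult_left_mono) auto
      also have "(1 - z) * \<bar>psum a 0 z - L / (1 - z)\<bar> = \<bar>(1 - z) * (psum a 0 z - L / (1 - z))\<bar>"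
        using elim by (simp add: abs_mult)
      also have "(1 - z) * (psum a 0 z - L / (1 - z)) = (1 - z) * psum a 0 z - L"
        using elim by (simp add: field_simps)
      also have "(1 - z) * (B + e / 2 * (1 / (1 - z))) = (1 - z) * B + e / 2"
        using elim by (simp add: field_simps)
      also have "\<dots> < e"
        using elim by (auto simp: dist_real_def)
      finally show ?case by (simp add: dist_real_def)
    qed
  qed
qed

lemma affine_of_second_deriv_zero:
  fixes f :: "real \<Rightarrow> real"
  assumes f: "\<And>x. x < c \<Longrightarrow> (f has_field_derivative f' x) (at x)"
    and f': "\<And>x. x < c \<Longrightarrow> (f' has_field_derivative 0) (at x)"
  obtains a b where "\<And>x. x < c \<Longrightarrow> f x = a * x + b" "\<And>x. x < c \<Longrightarrow> f' x = a"
proof -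
  have const: "\<exists>k. \<forall>x\<in>{..<c}. g x = k"
    if "\<And>x. x < c \<Longrightarrow> (g has_field_derivative 0) (at x)" for g :: "real \<Rightarrow> real"
    by (rule has_field_derivative_zero_constant)
      (use that in \<open>auto intro: has_field_derivative_at_within\<close>)
  obtain a where a: "\<And>x. x < c \<Longrightarrow> f' x = a"
    using const[OF f'] by auto
  have "((\<lambda>x. f x - a * x) has_field_derivative 0) (at x)" if "x < c" for x
    using f[OF that] by (auto intro!: derivative_eq_intros simp: a that)
  from const[OF this] obtain b where "\<And>x. x < c \<Longrightarrow> f x - a * x = b"
    by auto
  then show ?thesis
    using a that[of a b] by (simp add: algebra_simps)
qed

lemma tendsto_affine_at_bot_imp_slope_zero:
  fixes a b L :: real
  assumes "((\<lambda>x. a * x + b) \<longlongrightarrow> L) at_bot"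
  shows "a = 0"
proof -
  have "((\<lambda>x. (a * x + b) * inverse x) \<longlongrightarrow> L * 0) at_bot"
    by (intro tendsto_mult assms) real_asymp
  moreover have "((\<lambda>x. (a * x + b) * inverse x) \<longlongrightarrow> a) at_bot"
    by real_asymp
  ultimately have "L * 0 = a"
    by (rule tendsto_unique[OF trivial_limit_at_bot_linorder])
  then show ?thesis by simp
qed

text \<open>Takes the place of a Frobenius analysis at the singular point q = 0: with x = log q the
  logarithmic solution is the affine function of nonzero slope, and a finite limit excludes
  it.\<close>

lemma eq_limit_of_second_deriv_zero:
  fixes f :: "real \<Rightarrow> real"
  assumes f: "\<And>x. x < c \<Longrightarrow> (f has_field_derivative f' x) (at x)"
    and f': "\<And>x. x < c \<Longrightarrow> (f' has_field_derivative 0) (at x)"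
    and lim: "(f \<longlongrightarrow> L) at_bot" and x: "x < c"
  shows "f x = L"
proof -
  obtain a b where ab: "\<And>x. x < c \<Longrightarrow> f x = a * x + b"
    using affine_of_second_deriv_zero[OF f f'] by metis
  have "\<forall>\<^sub>F x in at_bot. f x = a * x + b"
    using eventually_gt_at_bot[of c] by eventually_elim (rule ab)
  with lim have lim': "((\<lambda>x. a * x + b) \<longlongrightarrow> L) at_bot"
    by (simp add: tendsto_cong)
  then have "a = 0"
    by (rule tendsto_affine_at_bot_imp_slope_zero)
  with lim' have "((\<lambda>x::real. b) \<longlongrightarrow> L) at_bot" by simp
  then have "b = L"
    by (intro tendsto_unique[OF trivial_limit_at_bot_linorder tendsto_const])
  with \<open>a = 0\<close> ab[OF x] show ?thesis by simp
qed

lemma eq_limit_of_third_deriv_zero: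
  fixes f :: "real \<Rightarrow> real"
  assumes f: "\<And>x. x < c \<Longrightarrow> (f has_field_derivative f' x) (at x)"
    and f': "\<And>x. x < c \<Longrightarrow> (f' has_field_derivative f'' x) (at x)"
    and f'': "\<And>x. x < c \<Longrightarrow> (f'' has_field_derivative 0) (at x)"
    and lim: "(f \<longlongrightarrow> L) at_bot" and x: "x < c"
  shows "f x = L"
proof -
  obtain a b where ab: "\<And>x. x < c \<Longrightarrow> f' x = a * x + b" "\<And>x. x < c \<Longrightarrow> f'' x = a"
    using affine_of_second_deriv_zero[OF f' f''] by metis
  \<comment> \<open>Without its quadratic part the function has the constant derivative b, which is
    the situation of the second-order case.\<close>
  define g where "g = (\<lambda>x. f x - a * x\<^sup>2 / 2)"
  have g: "(g has_field_derivative b) (at x)" if "x < c" for x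
    unfolding g_def using f[OF that] by (auto intro!: derivative_eq_intros simp: ab that)
  obtain b' d where g': "\<And>x. x < c \<Longrightarrow> g x = b' * x + d"
    using affine_of_second_deriv_zero[of c g "\<lambda>_. b"] g by (metis DERIV_const)
  have ev: "\<forall>\<^sub>F x in at_bot. f x = a / 2 * x\<^sup>2 + b' * x + d"
    using eventually_gt_at_bot[of c] by eventually_elim (use g' in \<open>simp add: g_def algebra_simps\<close>)
  with lim have lim': "((\<lambda>x. a / 2 * x\<^sup>2 + b' * x + d) \<longlongrightarrow> L) at_bot"
    by (simp add: tendsto_cong)
  have "((\<lambda>x. (a / 2 * x\<^sup>2 + b' * x + d) * inverse (x\<^sup>2)) \<longlongrightarrow> L * 0) at_bot"
    by (intro tendsto_mult lim') real_asymp
  moreover have "((\<lambda>x. (a / 2 * x\<^sup>2 + b' * x + d) * inverse (x\<^sup>2)) \<longlongrightarrow> a / 2) at_bot"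
    by real_asymp
  ultimately have "L * 0 = a / 2"
    by (rule tendsto_unique[OF trivial_limit_at_bot_linorder])
  then have "a = 0" by simp
  with lim' have "((\<lambda>x. b' * x + d) \<longlongrightarrow> L) at_bot" by simp
  moreover from this have "b' = 0"
    by (rule tendsto_affine_at_bot_imp_slope_zero)
  ultimately have "((\<lambda>x::real. d) \<longlongrightarrow> L) at_bot" by simp
  then have "d = L"
    by (intro tendsto_unique[OF trivial_limit_at_bot_linorder tendsto_const])
  with \<open>a = 0\<close> \<open>b' = 0\<close> g'[OF x] show ?thesis
    by (simp add: g_def)
qed

section \<open>The Jacobi triple product and theta functions\<close>

definition eprod :: "complex \<Rightarrow> complex" where
  "eprod q = (\<Prod>k. 1 - q ^ Suc k)"

definition oprod :: "complex \<Rightarrow> complex" where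
  "oprod q = (\<Prod>k. 1 - q ^ (2 * k + 1))"

lemma norm_power_less_one:
  assumes "norm (q :: complex) < 1" "n > 0"
  shows "norm (q ^ n) < 1"
  using assms power_less_one_iff[of "norm q" n] by (simp add: norm_power)

lemma one_minus_power_nonzero:
  assumes "norm (q :: complex) < 1" "n > 0"
  shows "1 - q ^ n \<noteq> 0"
  using norm_power_less_one[OF assms] by auto

lemma
  assumes q: "norm q < 1"
  shows eprod_nonzero: "eprod q \<noteq> 0"
    and eprod_LIMSEQ: "(\<lambda>n. \<Prod>k<n. 1 - q ^ Suc k) \<longlonglongrightarrow> eprod q"
    and oprod_LIMSEQ: "(\<lambda>n. \<Prod>k<n. 1 - q ^ (2 * k + 1)) \<longlonglongrightarrow> oprod q"
proof -
  have s: "summable (\<lambda>k. norm q ^ k)"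
    using q by (intro summable_geometric) auto
  have "summable (\<lambda>k. norm (- (q ^ Suc k)))"
    using s by (subst norm_minus_cancel) (simp add: norm_power summable_Suc_iff del: power_Suc)
  then have c: "convergent_prod (\<lambda>k. 1 + - (q ^ Suc k))"
    by (intro summable_imp_convergent_prod_complex)
       (use one_minus_power_nonzero[OF q] in \<open>auto simp del: power_Suc\<close>)
  show "eprod q \<noteq> 0"
    unfolding eprod_def by (rule prodinf_nonzero) (use c one_minus_power_nonzero[OF q] in \<open>auto simp del: power_Suc\<close>)
  show "(\<lambda>n. \<Prod>k<n. 1 - q ^ Suc k) \<longlonglongrightarrow> eprod q"
    unfolding eprod_def lessThan_Suc_atMost[symmetric]
    using has_prod_imp_tendsto'[OF convergent_prod_has_prod[OF c]] by simp
  have "summable (\<lambda>k. norm (- (q ^ (2 * k + 1))))"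
  proof (rule summable_comparison_test'[OF s])
    show "norm (norm (- (q ^ (2 * k + 1)))) \<le> norm q ^ k" for k
      using q by (simp add: norm_power norm_mult power_mult power2_eq_square del: power_Suc) 
         (simp add: power_decreasing flip: power_Suc power_mult power_add)
  qed
  then have c': "convergent_prod (\<lambda>k. 1 + - (q ^ (2 * k + 1)))"
    by (intro summable_imp_convergent_prod_complex)
       (use one_minus_power_nonzero[OF q] in \<open>auto simp del: power_Suc\<close>)
  show "(\<lambda>n. \<Prod>k<n. 1 - q ^ (2 * k + 1)) \<longlonglongrightarrow> oprod q"
    unfolding oprod_def using has_prod_imp_tendsto'[OF convergent_prod_has_prod[OF c']] by simp
qed

lemma eprod_eq_oprod:
  assumes q: "norm q < 1"
  shows "eprod q = oprod q * eprod (q\<^sup>2)"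
proof -
  have fin: "(\<Prod>k<2*n. 1 - q ^ Suc k) = (\<Prod>k<n. 1 - q ^ (2 * k + 1)) * (\<Prod>k<n. 1 - (q\<^sup>2) ^ Suc k)" for n
    by (induction n) (simp_all add: algebra_simps power_mult[symmetric] power_add[symmetric] del: power_Suc)
  have "(\<lambda>n. \<Prod>k<2*n. 1 - q ^ Suc k) \<longlonglongrightarrow> eprod q"
    using LIMSEQ_subseq_LIMSEQ[OF eprod_LIMSEQ[OF q], of "\<lambda>n. 2 * n"]
    by (simp add: o_def strict_mono_def)
  moreover have "(\<lambda>n. \<Prod>k<2*n. 1 - q ^ Suc k) \<longlonglongrightarrow> oprod q * eprod (q\<^sup>2)"
    unfolding fin using norm_power_less_one[OF q, of 2]
    by (intro tendsto_mult oprod_LIMSEQ eprod_LIMSEQ q) auto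
  ultimately show ?thesis by (rule LIMSEQ_unique)
qed

lemma oprod_minus:
  assumes q: "norm q < 1"
  shows "oprod q * oprod (- q) = oprod (q\<^sup>2)"
proof -
  have fin: "(\<Prod>k<n. 1 - q ^ (2 * k + 1)) * (\<Prod>k<n. 1 - (- q) ^ (2 * k + 1)) =
      (\<Prod>k<n. 1 - (q\<^sup>2) ^ (2 * k + 1))" for n
  proof -
    have "(1 - q ^ (2 * k + 1)) * (1 - (- q) ^ (2 * k + 1)) = 1 - (q\<^sup>2) ^ (2 * k + 1)" for k
      by (simp add: algebra_simps power2_eq_square power_mult_distrib flip: power_mult)
    then show ?thesis by (simp flip: prod.distrib)
  qed
  have "(\<lambda>n. (\<Prod>k<n. 1 - q ^ (2 * k + 1)) * (\<Prod>k<n. 1 - (- q) ^ (2 * k + 1))) \<longlonglongrightarrow> oprod q * oprod (- q)"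
    using q by (intro tendsto_mult oprod_LIMSEQ) auto
  moreover have "(\<lambda>n. (\<Prod>k<n. 1 - q ^ (2 * k + 1)) * (\<Prod>k<n. 1 - (- q) ^ (2 * k + 1))) \<longlonglongrightarrow> oprod (q\<^sup>2)"
    unfolding fin using norm_power_less_one[OF q, of 2] by (intro oprod_LIMSEQ) auto
  ultimately show ?thesis by (rule LIMSEQ_unique)
qed

text \<open>Trades products at -q for products at q, q^2 and q^4. This is the relation between Euler
  products behind \<open>phi_phi_minus\<close>, \<open>psi_square\<close> and
  \<open>eprod_ratio\<close>.\<close>

lemma eprod_minus:
  assumes q: "norm q < 1"
  shows "eprod q * eprod (- q) * eprod (q ^ 4) = eprod (q\<^sup>2) ^ 3"
proof -
  have n2: "norm (q\<^sup>2) < 1" using norm_power_less_one[OF q] by simp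
  have "eprod q * eprod (- q) * eprod (q ^ 4) = oprod q * oprod (- q) * eprod (q ^ 4) * eprod (q\<^sup>2) ^ 2"
    using eprod_eq_oprod[OF q] eprod_eq_oprod[of "- q"] q by (simp add: power2_eq_square)
  also have "\<dots> = oprod (q\<^sup>2) * eprod ((q\<^sup>2)\<^sup>2) * eprod (q\<^sup>2) ^ 2"
    using oprod_minus[OF q] by simp
  also have "oprod (q\<^sup>2) * eprod ((q\<^sup>2)\<^sup>2) = eprod (q\<^sup>2)"
    using eprod_eq_oprod[OF n2] by simp
  finally show ?thesis by (simp add: power2_eq_square power3_eq_cube)
qed


section \<open>Gaussian binomials and the finite triple product\<close>

definition qfac :: "complex \<Rightarrow> nat \<Rightarrow> complex" where
  "qfac q n = (\<Prod>k<n. 1 - q ^ Suc k)"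

lemma qfac_0 [simp]: "qfac q 0 = 1"
  and qfac_Suc: "qfac q (Suc n) = (1 - q ^ Suc n) * qfac q n"
  by (simp_all add: qfac_def)

lemma qfac_nonzero: "norm q < 1 \<Longrightarrow> qfac q n \<noteq> 0"
  using one_minus_power_nonzero[of q] by (auto simp: qfac_def simp del: power_Suc)

text \<open>A q-Pascal rule instead of a quotient of \<open>qfac\<close>: the product expansion then
  holds for every base, and division enters only for |q| < 1.\<close>

fun qbinom :: "complex \<Rightarrow> nat \<Rightarrow> nat \<Rightarrow> complex" where
  "qbinom q n 0 = 1"
| "qbinom q 0 (Suc k) = 0"
| "qbinom q (Suc n) (Suc k) = qbinom q n (Suc k) + q ^ (n - k) * qbinom q n k"

lemma qbinom_eq_0: "k > n \<Longrightarrow> qbinom q n k = 0"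
  by (induction q n k rule: qbinom.induct) auto

text \<open>The two terms of the Pascal rule combine by (1 - q^(n-k)) + q^(n-k) (1 - q^(k+1)) = 1 -
  q^(n+1). The case k = n is separate because \<open>n - Suc k\<close> would truncate.\<close>

lemma qbinom_qfac: "k \<le> n \<Longrightarrow> qbinom q n k * qfac q k * qfac q (n - k) = qfac q n"
proof (induction q n k rule: qbinom.induct)
  case (3 q n k)
  have B: "qbinom q n k * qfac q k * qfac q (n - k) = qfac q n"
    using 3 by simp
  show ?case
  proof (cases "k = n")
    case True
    then show ?thesis using B by (auto simp: qbinom_eq_0 qfac_Suc)
  next
    case False
    then have k: "Suc k \<le> n" using 3 by simp
    then have A: "qbinom q n (Suc k) * qfac q (Suc k) * qfac q (n - Suc k) = qfac q n"
      using 3 by simp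
    define d where "d = n - Suc k"
    have d: "n - k = Suc d" "n = d + Suc k" using k by (auto simp: d_def)
    have A': "qbinom q n (Suc k) * qfac q (Suc k) * qfac q (n - k) = qfac q n * (1 - q ^ (n - k))"
      unfolding A[symmetric] d(1) qfac_Suc[of q d] d_def[symmetric] by (simp only: mult_ac)
    have B': "qbinom q n k * qfac q (Suc k) * qfac q (n - k) = qfac q n * (1 - q ^ Suc k)"
      unfolding B[symmetric] qfac_Suc by (simp add: mult_ac)
    have "qbinom q (Suc n) (Suc k) * qfac q (Suc k) * qfac q (Suc n - Suc k) =
       qfac q n * (1 - q ^ (n - k)) + q ^ (n - k) * (qfac q n * (1 - q ^ Suc k))"
      unfolding A'[symmetric] B'[symmetric] by (simp add: algebra_simps)
    also have "\<dots> = qfac q n * (1 - q ^ (n - k + Suc k))"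
      by (simp add: algebra_simps power_add)
    also have "n - k + Suc k = Suc n" using 3 by simp
    finally show ?thesis by (simp add: qfac_Suc mult_ac)
  qed
qed auto

text \<open>The base p^2 avoids halving the exponent k (k - 1). The homogeneous pair a, b allows a =
  p^(2n), which does the work of negative powers of p in the triple product.\<close>

lemma qbinomial_theorem:
  fixes a b p :: complex
  shows "(\<Prod>j<m. a + b * p ^ (2 * j)) =
         (\<Sum>k\<le>m. qbinom (p\<^sup>2) m k * p ^ (k * (k - 1)) * a ^ (m - k) * b ^ k)"
proof (induction m)
  case (Suc m)
  let ?t = "\<lambda>k. qbinom (p\<^sup>2) m k * p ^ (k * (k - 1)) * b ^ k"
  have "(\<Sum>k\<le>Suc m. qbinom (p\<^sup>2) (Suc m) k * p ^ (k * (k - 1)) * a ^ (Suc m - k) * b ^ k) =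
    a ^ Suc m + (\<Sum>k\<le>m. qbinom (p\<^sup>2) (Suc m) (Suc k) * p ^ (Suc k * k) * a ^ (m - k) * b ^ Suc k)"
    by (subst sum.atMost_Suc_shift) simp
  also have "(\<Sum>k\<le>m. qbinom (p\<^sup>2) (Suc m) (Suc k) * p ^ (Suc k * k) * a ^ (m - k) * b ^ Suc k) =
    (\<Sum>k\<le>m. ?t (Suc k) * a ^ (m - k)) + (\<Sum>k\<le>m. b * p ^ (2 * m) * (?t k * a ^ (m - k)))"
  proof (subst sum.distrib[symmetric], rule sum.cong)
    fix k assume "k \<in> {..m}"
    then have "p ^ (2 * (m - k)) * p ^ (Suc k * k) = p ^ (2 * m) * p ^ (k * (k - 1))"
      unfolding power_add[symmetric] by (intro arg_cong[of _ _ "\<lambda>n. p ^ n"]) (cases k, auto simp: algebra_simps)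
    then have "(p\<^sup>2) ^ (m - k) * p ^ (Suc k * k) = p ^ (2 * m) * p ^ (k * (k - 1))"
      by (simp add: power_mult)
    then show "qbinom (p\<^sup>2) (Suc m) (Suc k) * p ^ (Suc k * k) * a ^ (m - k) * b ^ Suc k =
       ?t (Suc k) * a ^ (m - k) + b * p ^ (2 * m) * (?t k * a ^ (m - k))"
      by (simp del: mult_Suc power_Suc) (simp add: algebra_simps)
  qed simp
  also have "a ^ Suc m + ((\<Sum>k\<le>m. ?t (Suc k) * a ^ (m - k)) + (\<Sum>k\<le>m. b * p ^ (2 * m) * (?t k * a ^ (m - k)))) =
     (\<Sum>k\<le>Suc m. ?t k * a ^ (Suc m - k)) + b * p ^ (2 * m) * (\<Sum>k\<le>m. ?t k * a ^ (m - k))"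
    by (subst sum.atMost_Suc_shift) (simp add: sum_distrib_left)
  also have "(\<Sum>k\<le>Suc m. ?t k * a ^ (Suc m - k)) = (\<Sum>k\<le>m. a * (?t k * a ^ (m - k)))"
    by (simp add: qbinom_eq_0 Suc_diff_le mult_ac)
  also have "\<dots> = a * (\<Sum>k\<le>m. ?t k * a ^ (m - k))"
    by (simp add: sum_distrib_left)
  finally show ?case
    using Suc.IH by (simp add: algebra_simps)
qed simp

lemma qbinom_eq:
  assumes "norm q < 1" "k \<le> n"
  shows "qbinom q n k = qfac q n / (qfac q k * qfac q (n - k))"
  using qbinom_qfac[OF assms(2), of q] qfac_nonzero[OF assms(1)] by (simp add: field_simps)

lemma sum_lessThan_add:
  fixes f :: "nat \<Rightarrow> 'a::comm_monoid_add"
  shows "(\<Sum>k<m + n. f k) = (\<Sum>k<m. f k) + (\<Sum>k<n. f (m + k))"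
  by (induction n) (simp_all add: add.assoc)

lemma prod_lessThan_add:
  fixes f :: "nat \<Rightarrow> 'a::comm_monoid_mult"
  shows "(\<Prod>k<m + n. f k) = (\<Prod>k<m. f k) * (\<Prod>k<n. f (m + k))"
  by (induction n) (simp_all add: mult.assoc)

text \<open>Among 2n + 1 terms the middle one is counted once, hence the weights 1, 2, 2, ... of the
  theta_3 series. The even companion below has no middle term.\<close>

lemma sum_symmetric_odd:
  fixes f :: "nat \<Rightarrow> 'a::comm_ring_1"
  assumes "\<And>r. r \<le> n \<Longrightarrow> f (n + r) = g r" "\<And>r. r \<le> n \<Longrightarrow> f (n - r) = g r"
  shows "(\<Sum>k\<le>2*n. f k) = (\<Sum>r\<le>n. (if r = 0 then 1 else 2) * g r)"
proof -
  have "(\<Sum>k\<le>2*n. f k) = (\<Sum>k<n + Suc n. f k)"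
    by (simp add: lessThan_Suc_atMost flip: mult_2)
  also have "\<dots> = (\<Sum>k<n. f k) + (\<Sum>k<Suc n. f (n + k))"
    by (rule sum_lessThan_add)
  also have "(\<Sum>k<n. f k) = (\<Sum>k<n. g (Suc k))"
    by (subst sum.nat_diff_reindex[symmetric]) (use assms(2) in auto)
  also have "(\<Sum>k<Suc n. f (n + k)) = g 0 + (\<Sum>k<n. g (Suc k))"
  proof -
    have "(\<Sum>k<Suc n. f (n + k)) = (\<Sum>k<Suc n. g k)"
      by (rule sum.cong) (use assms(1) in auto)
    then show ?thesis by (subst (asm) (2) sum.lessThan_Suc_shift)
  qed
  also have "(\<Sum>k<n. g (Suc k)) + (g 0 + (\<Sum>k<n. g (Suc k))) = (\<Sum>r<Suc n. (if r = 0 then 1 else 2) * g r)"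
    by (subst sum.lessThan_Suc_shift) (simp add: sum_distrib_left[symmetric])
  finally show ?thesis by (simp add: lessThan_Suc_atMost)
qed

lemma sum_symmetric_even:
  fixes f :: "nat \<Rightarrow> 'a::comm_ring_1"
  assumes "\<And>r. r \<le> n \<Longrightarrow> f (n + 1 + r) = g r" "\<And>r. r \<le> n \<Longrightarrow> f (n - r) = g r"
  shows "(\<Sum>k\<le>2*n+1. f k) = 2 * (\<Sum>r\<le>n. g r)"
proof -
  have "(\<Sum>k\<le>2*n+1. f k) = (\<Sum>k<Suc n + Suc n. f k)"
    by (simp add: lessThan_Suc_atMost flip: mult_2)
  also have "\<dots> = (\<Sum>k<Suc n. f k) + (\<Sum>k<Suc n. f (Suc n + k))"
    by (rule sum_lessThan_add)
  also have "(\<Sum>k<Suc n. f k) = (\<Sum>k<Suc n. g k)"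
    by (subst sum.nat_diff_reindex[symmetric]) (use assms(2) in \<open>auto intro!: sum.cong\<close>)
  also have "(\<Sum>k<Suc n. f (Suc n + k)) = (\<Sum>k<Suc n. g k)"
    by (rule sum.cong) (use assms(1) in auto)
  finally show ?thesis by (simp add: lessThan_Suc_atMost)
qed

text \<open>The q-binomial theorem with 2n factors, a = p^(2n) and b = p. The factors with j >= n,
  and those with j < n in reverse order, both yield the product of 1 + p^(2i+1) up to a power of p;
  hence the square. The total power p^(3n^2) cancels.\<close>

lemma finite_phi_product:
  assumes p: "norm p < 1" "p \<noteq> 0"
  shows "(\<Prod>i<n. 1 + p ^ (2 * i + 1)) ^ 2 =
    (\<Sum>r\<le>n. (if r = 0 then 1 else 2) * (p ^ (r\<^sup>2) * (qfac (p\<^sup>2) (2 * n) / (qfac (p\<^sup>2) (n - r) * qfac (p\<^sup>2) (n + r)))))"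
proof -
  have q: "norm (p\<^sup>2) < 1" using norm_power_less_one[OF p(1)] by simp
  let ?f = "\<lambda>k. qbinom (p\<^sup>2) (2 * n) k * p ^ (k * (k - 1)) * (p ^ (2 * n)) ^ (2 * n - k) * p ^ k"
  let ?g = "\<lambda>r. p ^ (3 * n\<^sup>2) * (p ^ (r\<^sup>2) * (qfac (p\<^sup>2) (2 * n) / (qfac (p\<^sup>2) (n - r) * qfac (p\<^sup>2) (n + r))))"
  have "(\<Prod>j<2 * n. p ^ (2 * n) + p * p ^ (2 * j)) =
      (\<Prod>j<n. p ^ (2 * n) + p * p ^ (2 * j)) * (\<Prod>j<n. p ^ (2 * n) + p * p ^ (2 * (n + j)))"
    by (simp only: mult_2 prod_lessThan_add)
  also have "(\<Prod>j<n. p ^ (2 * n) + p * p ^ (2 * (n + j))) = (\<Prod>j<n. p ^ (2 * n) * (1 + p ^ (2 * j + 1)))"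
    by (rule prod.cong) (simp_all add: algebra_simps power_add)
  also have "\<dots> = p ^ (2 * n * n) * (\<Prod>j<n. 1 + p ^ (2 * j + 1))"
    by (simp add: prod.distrib power_mult)
  also have "(\<Prod>j<n. p ^ (2 * n) + p * p ^ (2 * j)) = (\<Prod>j<n. p ^ (2 * n) + p * p ^ (2 * (n - Suc j)))"
    by (rule prod.nat_diff_reindex[symmetric])
  also have "\<dots> = (\<Prod>j<n. p ^ (2 * (n - Suc j) + 1) * (1 + p ^ (2 * j + 1)))"
  proof (rule prod.cong)
    fix j assume "j \<in> {..<n}"
    then have "2 * n = (2 * (n - Suc j) + 1) + (2 * j + 1)" by auto
    then have "p ^ (2 * n) = p ^ (2 * (n - Suc j) + 1) * p ^ (2 * j + 1)"
      by (metis power_add)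
    then show "p ^ (2 * n) + p * p ^ (2 * (n - Suc j)) = p ^ (2 * (n - Suc j) + 1) * (1 + p ^ (2 * j + 1))"
      by (simp add: algebra_simps)
  qed simp
  also have "\<dots> = (\<Prod>j<n. p ^ (2 * (n - Suc j) + 1)) * (\<Prod>j<n. 1 + p ^ (2 * j + 1))"
    by (rule prod.distrib)
  also have "(\<Prod>j<n. p ^ (2 * (n - Suc j) + 1)) = (\<Prod>j<n. p ^ (2 * j + 1))"
    by (rule prod.nat_diff_reindex)
  also have "\<dots> = p ^ (n * n)"
  proof (induction n)
    case (Suc n)
    have "n * n + (2 * n + 1) = Suc n * Suc n" by simp
    then show ?case using Suc by (simp only: prod.lessThan_Suc flip: power_add)
  qed simp
  finally have L: "(\<Prod>j<2 * n. p ^ (2 * n) + p * p ^ (2 * j)) = p ^ (3 * n\<^sup>2) * (\<Prod>j<n. 1 + p ^ (2 * j + 1)) ^ 2"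
    by (simp add: power2_eq_square algebra_simps flip: power_add)
  have "(\<Prod>j<2 * n. p ^ (2 * n) + p * p ^ (2 * j)) = (\<Sum>k\<le>2 * n. ?f k)"
    by (rule qbinomial_theorem)
  also have "\<dots> = (\<Sum>r\<le>n. (if r = 0 then 1 else 2) * ?g r)"
  proof (rule sum_symmetric_odd)
    fix r assume r: "r \<le> n"
    define d where "d = n - r"
    have d: "n = d + r" using r by (simp add: d_def)
    have s1: "2 * n - (n + r) = n - r" "2 * n - (n - r) = n + r" "n - r \<le> 2 * n" "n + r \<le> 2 * n"
      using r by auto
    \<comment> \<open>With k = n + r the exponent is k^2 + 2n (2n - k), in which the terms linear in
      r cancel; \<open>e2\<close> is the same with -r.\<close>
    have e1: "(n + r) * (n + r - 1) + 2 * n * (2 * n - (n + r)) + (n + r) = 3 * n\<^sup>2 + r\<^sup>2"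
    proof (cases "n + r")
      case (Suc s)
      have "(n + r) * (n + r - 1) + (n + r) = (n + r)\<^sup>2" using Suc by (simp add: power2_eq_square)
      moreover have "2 * n - (n + r) = d" using d by simp
      ultimately show ?thesis unfolding d by (simp add: power2_eq_square algebra_simps)
    qed simp
    have e2: "(n - r) * (n - r - 1) + 2 * n * (2 * n - (n - r)) + (n - r) = 3 * n\<^sup>2 + r\<^sup>2"
    proof -
      have "(n - r) * (n - r - 1) + (n - r) = (n - r)\<^sup>2" by (cases "n - r") (simp_all add: power2_eq_square)
      moreover have "2 * n - (n - r) = n + r" "n - r = d" using d by auto
      ultimately have "(n - r) * (n - r - 1) + 2 * n * (2 * n - (n - r)) + (n - r) = d\<^sup>2 + 2 * n * (n + r)"
        by simp
      then show ?thesis unfolding d by (simp add: power2_eq_square algebra_simps)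
    qed
    have "?f (n + r) = qbinom (p\<^sup>2) (2 * n) (n + r) * p ^ ((n + r) * (n + r - 1) + 2 * n * (2 * n - (n + r)) + (n + r))"
      by (simp only: power_add power_mult mult.assoc)
    also have "\<dots> = ?g r"
    proof -
      have "qbinom (p\<^sup>2) (2 * n) (n + r) = qfac (p\<^sup>2) (2 * n) / (qfac (p\<^sup>2) (n - r) * qfac (p\<^sup>2) (n + r))"
        using qbinom_eq[OF q s1(4)] unfolding s1 by (simp only: mult.commute)
      then show ?thesis unfolding e1 by (simp only: power_add mult_ac)
    qed
    finally show "?f (n + r) = ?g r" .
    have "?f (n - r) = qbinom (p\<^sup>2) (2 * n) (n - r) * p ^ ((n - r) * (n - r - 1) + 2 * n * (2 * n - (n - r)) + (n - r))"
      by (simp only: power_add power_mult mult.assoc)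
    also have "\<dots> = ?g r"
    proof -
      have "qbinom (p\<^sup>2) (2 * n) (n - r) = qfac (p\<^sup>2) (2 * n) / (qfac (p\<^sup>2) (n - r) * qfac (p\<^sup>2) (n + r))"
        using qbinom_eq[OF q s1(3)] unfolding s1 by (simp only: mult.commute)
      then show ?thesis unfolding e2 by (simp only: power_add mult_ac)
    qed
    finally show "?f (n - r) = ?g r" .
  qed
  also have "\<dots> = p ^ (3 * n\<^sup>2) * (\<Sum>r\<le>n. (if r = 0 then 1 else 2) * (p ^ (r\<^sup>2) * (qfac (p\<^sup>2) (2 * n) / (qfac (p\<^sup>2) (n - r) * qfac (p\<^sup>2) (n + r)))))"
    by (simp add: sum_distrib_left mult_ac)
  finally show ?thesis unfolding L using p by simp
qed

text \<open>The companion with 2n + 1 factors and b = 1. The factor j = n equals 2 p^(2n), and this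
  2 cancels the one produced by folding an even number of terms.\<close>

lemma finite_psi_product:
  assumes p: "norm p < 1" "p \<noteq> 0"
  shows "(\<Prod>i<n. 1 + p ^ (2 * i + 2)) ^ 2 =
    (\<Sum>r\<le>n. p ^ (r\<^sup>2 + r) * (qfac (p\<^sup>2) (2 * n + 1) / (qfac (p\<^sup>2) (n - r) * qfac (p\<^sup>2) (n + 1 + r))))"
proof -
  have q: "norm (p\<^sup>2) < 1" using norm_power_less_one[OF p(1)] by simp
  let ?f = "\<lambda>k. qbinom (p\<^sup>2) (2 * n + 1) k * p ^ (k * (k - 1)) * (p ^ (2 * n)) ^ (2 * n + 1 - k) * 1 ^ k"
  let ?g = "\<lambda>r. p ^ (3 * n\<^sup>2 + n) * (p ^ (r\<^sup>2 + r) * (qfac (p\<^sup>2) (2 * n + 1) / (qfac (p\<^sup>2) (n - r) * qfac (p\<^sup>2) (n + 1 + r))))"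
  have "(\<Prod>j<2 * n + 1. p ^ (2 * n) + 1 * p ^ (2 * j)) = (\<Prod>j<n + Suc n. p ^ (2 * n) + p ^ (2 * j))"
    by (simp add: mult_2)
  also have "\<dots> = (\<Prod>j<n. p ^ (2 * n) + p ^ (2 * j)) * (\<Prod>j<Suc n. p ^ (2 * n) + p ^ (2 * (n + j)))"
    by (rule prod_lessThan_add)
  also have "(\<Prod>j<Suc n. p ^ (2 * n) + p ^ (2 * (n + j))) = (\<Prod>j<Suc n. p ^ (2 * n) * (1 + p ^ (2 * j)))"
    by (rule prod.cong) (simp_all add: algebra_simps power_add)
  also have "\<dots> = p ^ (2 * n * Suc n) * (2 * (\<Prod>j<n. 1 + p ^ (2 * j + 2)))"
    unfolding prod.distrib prod.lessThan_Suc_shift[of "\<lambda>j. 1 + p ^ (2 * j)"] prod_constant card_lessThan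
    by (simp only: power_mult[symmetric]) simp
  also have "(\<Prod>j<n. p ^ (2 * n) + p ^ (2 * j)) = (\<Prod>j<n. p ^ (2 * n) + p ^ (2 * (n - Suc j)))"
    by (rule prod.nat_diff_reindex[symmetric])
  also have "\<dots> = (\<Prod>j<n. p ^ (2 * (n - Suc j)) * (1 + p ^ (2 * j + 2)))"
  proof (rule prod.cong)
    fix j assume "j \<in> {..<n}"
    then have "2 * n = (2 * (n - Suc j)) + (2 * j + 2)" by auto
    then have "p ^ (2 * n) = p ^ (2 * (n - Suc j)) * p ^ (2 * j + 2)"
      by (metis power_add)
    then show "p ^ (2 * n) + p ^ (2 * (n - Suc j)) = p ^ (2 * (n - Suc j)) * (1 + p ^ (2 * j + 2))"
      by (simp add: algebra_simps)
  qed simp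
  also have "\<dots> = (\<Prod>j<n. p ^ (2 * (n - Suc j))) * (\<Prod>j<n. 1 + p ^ (2 * j + 2))"
    by (rule prod.distrib)
  also have "(\<Prod>j<n. p ^ (2 * (n - Suc j))) = (\<Prod>j<n. p ^ (2 * j))"
    by (rule prod.nat_diff_reindex)
  also have "\<dots> = p ^ (n * (n - 1))"
  proof (induction n)
    case (Suc n)
    have "n * (n - 1) + 2 * n = Suc n * (Suc n - 1)" by (cases n) simp_all
    then show ?case using Suc by (simp only: prod.lessThan_Suc flip: power_add)
  qed simp
  finally have "(\<Prod>j<2 * n + 1. p ^ (2 * n) + 1 * p ^ (2 * j)) =
      p ^ (n * (n - 1) + 2 * n * Suc n) * (2 * (\<Prod>j<n. 1 + p ^ (2 * j + 2)) ^ 2)"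
    by (simp only: power_add power2_eq_square mult_ac)
  also have "n * (n - 1) + 2 * n * Suc n = 3 * n\<^sup>2 + n"
    by (cases n) (simp_all add: power2_eq_square)
  finally have L: "(\<Prod>j<2 * n + 1. p ^ (2 * n) + 1 * p ^ (2 * j)) =
      p ^ (3 * n\<^sup>2 + n) * (2 * (\<Prod>j<n. 1 + p ^ (2 * j + 2)) ^ 2)" .
  have "(\<Prod>j<2 * n + 1. p ^ (2 * n) + 1 * p ^ (2 * j)) = (\<Sum>k\<le>2 * n + 1. ?f k)"
    by (rule qbinomial_theorem)
  also have "\<dots> = 2 * (\<Sum>r\<le>n. ?g r)"
  proof (rule sum_symmetric_even)
    fix r assume r: "r \<le> n"
    define d where "d = n - r"
    have d: "n = d + r" using r by (simp add: d_def)
    have s1: "2 * n + 1 - (n + 1 + r) = n - r" "2 * n + 1 - (n - r) = n + 1 + r"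
      "n - r \<le> 2 * n + 1" "n + 1 + r \<le> 2 * n + 1" using r by auto
    have e1: "(n + 1 + r) * (n + 1 + r - 1) + 2 * n * (2 * n + 1 - (n + 1 + r)) = 3 * n\<^sup>2 + n + (r\<^sup>2 + r)"
      unfolding s1 d by (simp add: power2_eq_square algebra_simps)
    have e2: "(n - r) * (n - r - 1) + 2 * n * (2 * n + 1 - (n - r)) = 3 * n\<^sup>2 + n + (r\<^sup>2 + r)"
      unfolding s1 d by (cases d) (simp_all add: power2_eq_square algebra_simps)
    have "?f (n + 1 + r) = qbinom (p\<^sup>2) (2 * n + 1) (n + 1 + r) * p ^ ((n + 1 + r) * (n + 1 + r - 1) + 2 * n * (2 * n + 1 - (n + 1 + r)))"
      by (simp only: power_add power_mult mult.assoc power_one mult_1_right)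
    also have "\<dots> = ?g r"
    proof -
      have "qbinom (p\<^sup>2) (2 * n + 1) (n + 1 + r) = qfac (p\<^sup>2) (2 * n + 1) / (qfac (p\<^sup>2) (n - r) * qfac (p\<^sup>2) (n + 1 + r))"
        using qbinom_eq[OF q s1(4)] unfolding s1 by (simp only: mult.commute)
      then show ?thesis unfolding e1 by (simp only: power_add mult_ac)
    qed
    finally show "?f (n + 1 + r) = ?g r" .
    have "?f (n - r) = qbinom (p\<^sup>2) (2 * n + 1) (n - r) * p ^ ((n - r) * (n - r - 1) + 2 * n * (2 * n + 1 - (n - r)))"
      by (simp only: power_add power_mult mult.assoc power_one mult_1_right)
    also have "\<dots> = ?g r"
    proof -
      have "qbinom (p\<^sup>2) (2 * n + 1) (n - r) = qfac (p\<^sup>2) (2 * n + 1) / (qfac (p\<^sup>2) (n - r) * qfac (p\<^sup>2) (n + 1 + r))"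
        using qbinom_eq[OF q s1(3)] unfolding s1 by (simp only: mult.commute)
      then show ?thesis unfolding e2 by (simp only: power_add mult_ac)
    qed
    finally show "?f (n - r) = ?g r" .
  qed
  also have "\<dots> = p ^ (3 * n\<^sup>2 + n) * (2 * (\<Sum>r\<le>n. p ^ (r\<^sup>2 + r) * (qfac (p\<^sup>2) (2 * n + 1) / (qfac (p\<^sup>2) (n - r) * qfac (p\<^sup>2) (n + 1 + r)))))"
    by (simp only: sum_distrib_left mult_ac)
  finally show ?thesis unfolding L using p by simp
qed


text \<open>The quotient of \<open>qfac\<close> values tends to 1 / eprod q, and it is bounded
  because \<open>qfac q\<close> converges to a nonzero limit; so dominated convergence for series
  applies, with majorant a multiple of |p|^r. The offset d is 0 for phi and 1 for psi.\<close>

lemma Tannery_qfac: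
  fixes p q :: complex
  assumes p: "norm p < 1" and q: "norm q < 1" and e: "\<And>r. norm (e r) \<le> 2" and h: "\<And>r. h r \<ge> r"
    and lim: "(\<lambda>n. \<Sum>r\<le>n. e r * p ^ h r * (qfac q (2 * n + d) / (qfac q (n - r) * qfac q (n + d + r)))) \<longlonglongrightarrow> L"
  shows "(\<lambda>r. e r * p ^ h r) sums (L * eprod q)"
proof -
  have lq: "qfac q \<longlonglongrightarrow> eprod q"
    using eprod_LIMSEQ[OF q] by (simp add: qfac_def[abs_def])
  obtain B where B: "B > 0" "\<And>n. norm (qfac q n) \<le> B"
    using convergent_imp_Bseq[OF convergentI[OF lq]] by (auto simp: Bseq_def)
  obtain b where b: "b > 0" "\<And>n. norm (inverse (qfac q n)) \<le> b"
    using convergent_imp_Bseq[OF convergentI[OF tendsto_inverse[OF lq eprod_nonzero[OF q]]]]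
    by (auto simp: Bseq_def)
  define a where "a = (\<lambda>r n. if r \<le> n then e r * p ^ h r * (qfac q (2 * n + d) / (qfac q (n - r) * qfac q (n + d + r))) else 0)"
  have lima: "(\<lambda>n. a r n) \<longlonglongrightarrow> e r * p ^ h r * (eprod q / (eprod q * eprod q))" for r
  proof (rule Lim_transform_eventually)
    have "filterlim (\<lambda>n. 2 * n + d) at_top sequentially" "filterlim (\<lambda>n. n - r) at_top sequentially"
      "filterlim (\<lambda>n. n + d + r) at_top sequentially"
      by (rule filterlim_at_top_mono[OF filterlim_ident], simp, rule filterlim_minus_const_nat_at_top,
          rule filterlim_at_top_mono[OF filterlim_ident], simp)
    note lims = this[THEN filterlim_compose[OF lq]]
    show "(\<lambda>n. e r * p ^ h r * (qfac q (2 * n + d) / (qfac q (n - r) * qfac q (n + d + r))))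
        \<longlonglongrightarrow> e r * p ^ h r * (eprod q / (eprod q * eprod q))"
      by (intro tendsto_intros lims) (use eprod_nonzero[OF q] in auto)
    show "\<forall>\<^sub>F n in sequentially. e r * p ^ h r * (qfac q (2 * n + d) / (qfac q (n - r) * qfac q (n + d + r))) = a r n"
      using eventually_ge_at_top[of r] by eventually_elim (simp add: a_def)
  qed
  have bound: "norm (a r n) \<le> 2 * (B * (b * b)) * norm p ^ r" for r n
  proof (cases "r \<le> n")
    case True
    have "norm (a r n) = norm (e r) * norm p ^ h r *
        (norm (qfac q (2 * n + d)) * (norm (inverse (qfac q (n - r))) * norm (inverse (qfac q (n + d + r)))))"
      using True by (simp add: a_def norm_mult norm_power norm_divide divide_inverse norm_inverse)
    also have "\<dots> \<le> 2 * norm p ^ r * (B * (b * b))"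
      using B b e h p by (intro mult_mono power_decreasing mult_nonneg_nonneg) auto
    finally show ?thesis by (simp add: mult_ac)
  qed (use B b in \<open>simp add: a_def\<close>)
  have T: "summable (\<lambda>r. norm (e r * p ^ h r * (eprod q / (eprod q * eprod q)))) \<and>
    (\<lambda>n. \<Sum>r. a r n) \<longlonglongrightarrow> (\<Sum>r. e r * p ^ h r * (eprod q / (eprod q * eprod q)))"
  proof -
    have "\<forall>\<^sub>F (r, n) in at_top \<times>\<^sub>F sequentially. norm (a r n) \<le> 2 * (B * (b * b)) * norm p ^ r"
      using bound by (intro always_eventually) auto
    moreover have "summable (\<lambda>r. 2 * (B * (b * b)) * norm p ^ r)"
      using p by (intro summable_mult summable_geometric) auto
    ultimately show ?thesis
      using tannerys_theorem[where a = a and F = sequentially, OF lima] by simp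
  qed
  have "(\<Sum>r. a r n) = (\<Sum>r\<le>n. e r * p ^ h r * (qfac q (2 * n + d) / (qfac q (n - r) * qfac q (n + d + r))))" for n
    by (subst suminf_finite[of "{..n}"]) (auto simp: a_def)
  with T lim have "(\<Sum>r. e r * p ^ h r * (eprod q / (eprod q * eprod q))) = L"
    by (auto intro: LIMSEQ_unique)
  moreover have "summable (\<lambda>r. e r * p ^ h r * (eprod q / (eprod q * eprod q)))"
    by (rule summable_norm_cancel[OF conjunct1[OF T]])
  ultimately have "(\<lambda>r. e r * p ^ h r * (eprod q / (eprod q * eprod q))) sums L"
    by (simp add: sums_iff)
  from sums_mult2[OF this, of "eprod q"] show ?thesis
    using eprod_nonzero[OF q] by simp
qed

lemma phi_sums_product:
  assumes p: "norm p < 1" "p \<noteq> 0"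
  shows "(\<lambda>r. (if r = 0 then 1 else 2) * p ^ (r\<^sup>2)) sums (eprod (- p) ^ 2 / eprod (p\<^sup>2))"
proof -
  have q: "norm (p\<^sup>2) < 1" using norm_power_less_one[OF p(1)] by simp
  have "(\<lambda>n. (\<Prod>i<n. 1 - (- p) ^ (2 * i + 1)) ^ 2) \<longlonglongrightarrow> oprod (- p) ^ 2"
    using p by (intro tendsto_intros oprod_LIMSEQ) auto
  moreover have "(\<Prod>i<n. 1 - (- p) ^ (2 * i + 1)) ^ 2 = (\<Sum>r\<le>n. (if r = 0 then 1 else 2) * p ^ (r\<^sup>2) *
      (qfac (p\<^sup>2) (2 * n + 0) / (qfac (p\<^sup>2) (n - r) * qfac (p\<^sup>2) (n + 0 + r))))" for n
    using finite_phi_product[OF p, of n] by (simp add: mult.assoc)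
  ultimately have "(\<lambda>r. (if r = 0 then 1 else 2) * p ^ (r\<^sup>2)) sums (oprod (- p) ^ 2 * eprod (p\<^sup>2))"
    by (intro Tannery_qfac[where d = 0] p q) (auto simp: power2_eq_square)
  moreover have "oprod (- p) = eprod (- p) / eprod (p\<^sup>2)"
    using eprod_eq_oprod[of "- p"] p eprod_nonzero[OF q] by simp
  ultimately show ?thesis
    using eprod_nonzero[OF q] by (simp add: power2_eq_square)
qed

lemma psi_sums_product:
  assumes p: "norm p < 1" "p \<noteq> 0"
  shows "(\<lambda>r. p ^ (r\<^sup>2 + r)) sums (eprod (p ^ 4) ^ 2 / eprod (p\<^sup>2))"
proof -
  have q: "norm (p\<^sup>2) < 1" "norm (p ^ 4) < 1" using norm_power_less_one[OF p(1)] by auto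
  \<comment> \<open>1 - p^(4i+4) = (1 + p^(2i+2)) (1 - p^(2i+2)) expresses the plus-product through
    Euler products alone.\<close>
  have fin: "(\<Prod>i<n. 1 + p ^ (2 * i + 2)) = qfac (p ^ 4) n / qfac (p\<^sup>2) n" for n
  proof -
    have "1 - (p ^ 4) ^ Suc i = (1 + p ^ (2 * i + 2)) * (1 - (p\<^sup>2) ^ Suc i)" for i
      by (simp add: algebra_simps flip: power_mult power_add power_Suc)
         (simp add: numeral_eq_Suc mult_ac)
    then have "qfac (p ^ 4) n = (\<Prod>i<n. 1 + p ^ (2 * i + 2)) * qfac (p\<^sup>2) n"
      by (simp only: qfac_def prod.distrib)
    then show ?thesis using qfac_nonzero[OF q(1)] by simp
  qed
  have "(\<lambda>n. (qfac (p ^ 4) n / qfac (p\<^sup>2) n) ^ 2) \<longlonglongrightarrow> (eprod (p ^ 4) / eprod (p\<^sup>2)) ^ 2"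
    unfolding qfac_def by (intro tendsto_intros eprod_LIMSEQ eprod_nonzero q)
  moreover have "(qfac (p ^ 4) n / qfac (p\<^sup>2) n) ^ 2 = (\<Sum>r\<le>n. 1 * p ^ (r\<^sup>2 + r) *
      (qfac (p\<^sup>2) (2 * n + 1) / (qfac (p\<^sup>2) (n - r) * qfac (p\<^sup>2) (n + 1 + r))))" for n
    using finite_psi_product[OF p, of n] unfolding fin by simp
  ultimately have "(\<lambda>r. 1 * p ^ (r\<^sup>2 + r)) sums ((eprod (p ^ 4) / eprod (p\<^sup>2)) ^ 2 * eprod (p\<^sup>2))"
    by (intro Tannery_qfac[where d = 1] p q) auto
  then show ?thesis
    using eprod_nonzero[OF q(1)] by (simp add: power2_eq_square)
qed

section \<open>Theta series and their duplication formulas\<close>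

definition phi_coeff :: "nat \<Rightarrow> real" where
  "phi_coeff m = (if m = 0 then 1 else if m \<in> range (\<lambda>r. r\<^sup>2) then 2 else 0)"

text \<open>\<open>psi q\<close> is Ramanujan's psi at q^2, so theta_2(q) = 2 q^(1/4) psi(q).
  Splitting off the fractional power leaves a power series.\<close>

definition psi_coeff :: "nat \<Rightarrow> real" where
  "psi_coeff m = (if m \<in> range (\<lambda>r. r\<^sup>2 + r) then 1 else 0)"

abbreviation phi :: "'a::{real_normed_field,banach} \<Rightarrow> 'a" where "phi \<equiv> psum phi_coeff 0"
abbreviation psi :: "'a::{real_normed_field,banach} \<Rightarrow> 'a" where "psi \<equiv> psum psi_coeff 0"

lemma Bseq_phi_coeff: "Bseq phi_coeff"
  and Bseq_psi_coeff: "Bseq psi_coeff"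
  by (rule BseqI'[of _ 2], simp add: phi_coeff_def, rule BseqI'[of _ 1], simp add: psi_coeff_def)

text \<open>The coefficients are indicator-like sequences over all exponents, so that
  \<open>psum\<close> and its differentiation rules apply; reindexing along the strictly increasing
  exponents returns the classical sparse series.\<close>

lemma
  fixes p :: "'a::{real_normed_field,banach}"
  assumes "norm p < 1"
  shows phi_sums: "(\<lambda>r. (if r = 0 then 1 else 2) * p ^ (r\<^sup>2)) sums phi p"
    and psi_sums: "(\<lambda>r. p ^ (r\<^sup>2 + r)) sums psi p"
proof -
  have s: "(\<lambda>m. of_real (phi_coeff m) * p ^ m) sums phi p" "(\<lambda>m. of_real (psi_coeff m) * p ^ m) sums psi p"
    using summable_psum[OF Bseq_phi_coeff assms, of 0] summable_psum[OF Bseq_psi_coeff assms, of 0]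
    by (simp_all add: psum_def summable_sums)
  have m: "strict_mono (\<lambda>r::nat. r\<^sup>2)" "strict_mono (\<lambda>r::nat. r\<^sup>2 + r)"
    by (auto simp: strict_mono_def intro!: add_strict_mono power_strict_mono)
  have "(\<lambda>r. of_real (phi_coeff (r\<^sup>2)) * p ^ (r\<^sup>2)) sums phi p"
    by (subst sums_mono_reindex[OF m(1), of "\<lambda>m. of_real (phi_coeff m) * p ^ m"])
       (use s in \<open>auto simp: phi_coeff_def image_iff dest: spec[of _ 0]\<close>)
  also have "(\<lambda>r. of_real (phi_coeff (r\<^sup>2)) * p ^ (r\<^sup>2)) = (\<lambda>r. (if r = 0 then 1 else 2) * p ^ (r\<^sup>2))"
    by (auto simp: fun_eq_iff phi_coeff_def)
  finally show "(\<lambda>r. (if r = 0 then 1 else 2) * p ^ (r\<^sup>2)) sums phi p" .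
  have "(\<lambda>r. of_real (psi_coeff (r\<^sup>2 + r)) * p ^ (r\<^sup>2 + r)) sums psi p"
    by (subst sums_mono_reindex[OF m(2), of "\<lambda>m. of_real (psi_coeff m) * p ^ m"])
       (use s in \<open>auto simp: psi_coeff_def\<close>)
  also have "(\<lambda>r. of_real (psi_coeff (r\<^sup>2 + r)) * p ^ (r\<^sup>2 + r)) = (\<lambda>r. p ^ (r\<^sup>2 + r))"
    by (auto simp: fun_eq_iff psi_coeff_def)
  finally show "(\<lambda>r. p ^ (r\<^sup>2 + r)) sums psi p" .
qed

lemma
  fixes p :: complex
  assumes p: "norm p < 1" "p \<noteq> 0"
  shows phi_eprod: "phi p = eprod (- p) ^ 2 / eprod (p\<^sup>2)"
    and psi_eprod: "psi p = eprod (p ^ 4) ^ 2 / eprod (p\<^sup>2)"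
  using sums_unique2[OF phi_sums phi_sums_product] sums_unique2[OF psi_sums psi_sums_product] p by auto

lemma phi_dissection:
  fixes p :: complex
  assumes p: "norm p < 1"
  shows "phi p = phi (p ^ 4) + 2 * p * psi (p ^ 4)"
proof -
  let ?f = "\<lambda>r::nat. (if r = 0 then 1 else 2) * p ^ (r\<^sup>2)"
  have p4: "norm (p ^ 4) < 1" using norm_power_less_one[OF p] by simp
  have s: "(\<lambda>r. \<Sum>i\<in>{r * 2..<r * 2 + 2}. ?f i) sums phi p"
    by (rule sums_group[OF phi_sums[OF p]]) simp
  have "{r * 2..<r * 2 + 2} = {2 * r, 2 * r + 1}" for r :: nat by auto
  then have "(\<Sum>i\<in>{r * 2..<r * 2 + 2}. ?f i) =
      (if r = 0 then 1 else 2) * (p ^ 4) ^ (r\<^sup>2) + 2 * p * (p ^ 4) ^ (r\<^sup>2 + r)" for r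
    by (simp add: power2_eq_square algebra_simps power_add power_mult[symmetric])
  with s have "(\<lambda>r. (if r = 0 then 1 else 2) * (p ^ 4) ^ (r\<^sup>2) + 2 * p * (p ^ 4) ^ (r\<^sup>2 + r)) sums phi p"
    by simp
  moreover have "(\<lambda>r. (if r = 0 then 1 else 2) * (p ^ 4) ^ (r\<^sup>2) + 2 * p * (p ^ 4) ^ (r\<^sup>2 + r))
      sums (phi (p ^ 4) + 2 * p * psi (p ^ 4))"
    by (intro sums_add sums_mult phi_sums psi_sums p4)
  ultimately show ?thesis by (rule sums_unique2)
qed

lemma
  fixes p :: complex
  assumes p: "norm p < 1" "p \<noteq> 0"
  shows phi_phi_minus: "phi p * phi (- p) = phi (- (p\<^sup>2)) ^ 2"
    and psi_square: "psi p ^ 2 = psi (p\<^sup>2) * phi (p\<^sup>2)"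
proof -
  have n: "norm (p\<^sup>2) < 1" "norm (p ^ 4) < 1" "norm (p ^ 8) < 1"
    using norm_power_less_one[OF p(1)] by auto
  have nz: "eprod p \<noteq> 0" "eprod (- p) \<noteq> 0" "eprod (p\<^sup>2) \<noteq> 0" "eprod (- (p\<^sup>2)) \<noteq> 0"
      "eprod (p ^ 4) \<noteq> 0" "eprod (p ^ 8) \<noteq> 0"
    using eprod_nonzero n p by auto
  have m1: "eprod p * eprod (- p) * eprod (p ^ 4) = eprod (p\<^sup>2) ^ 3"
    by (rule eprod_minus[OF p(1)])
  have m2: "eprod (p\<^sup>2) * eprod (- (p\<^sup>2)) * eprod (p ^ 8) = eprod (p ^ 4) ^ 3"
    using eprod_minus[OF n(1)] by (simp flip: power_mult)
  have "phi p * phi (- p) = (eprod p * eprod (- p)) ^ 2 / eprod (p\<^sup>2) ^ 2"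
    using phi_eprod[of p] phi_eprod[of "- p"] p by (simp add: power_mult_distrib power2_eq_square)
  also have "eprod p * eprod (- p) = eprod (p\<^sup>2) ^ 3 / eprod (p ^ 4)"
    using m1 nz by (simp add: field_simps)
  also have "(eprod (p\<^sup>2) ^ 3 / eprod (p ^ 4)) ^ 2 / eprod (p\<^sup>2) ^ 2 = (eprod (p\<^sup>2) ^ 2 / eprod (p ^ 4)) ^ 2"
    using nz by (simp add: field_simps flip: power_mult power_add)
  also have "\<dots> = phi (- (p\<^sup>2)) ^ 2"
    using phi_eprod[of "- (p\<^sup>2)"] p n by simp
  finally show "phi p * phi (- p) = phi (- (p\<^sup>2)) ^ 2" .
  have "psi (p\<^sup>2) * phi (p\<^sup>2) = (eprod (p ^ 8) * eprod (- (p\<^sup>2))) ^ 2 / eprod (p ^ 4) ^ 2"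
    using psi_eprod[of "p\<^sup>2"] phi_eprod[of "p\<^sup>2"] p n
    by (simp add: power_mult_distrib flip: power_mult) (simp add: power2_eq_square)
  also have "eprod (p ^ 8) * eprod (- (p\<^sup>2)) = eprod (p ^ 4) ^ 3 / eprod (p\<^sup>2)"
    using m2 nz by (simp add: field_simps)
  also have "(eprod (p ^ 4) ^ 3 / eprod (p\<^sup>2)) ^ 2 / eprod (p ^ 4) ^ 2 = (eprod (p ^ 4) ^ 2 / eprod (p\<^sup>2)) ^ 2"
    using nz by (simp add: field_simps flip: power_mult power_add)
  also have "\<dots> = psi p ^ 2"
    using psi_eprod[of p] p by simp
  finally show "psi p ^ 2 = psi (p\<^sup>2) * phi (p\<^sup>2)" by simp
qed

text \<open>Take s with s^2 = -p. Then \<open>phi_phi_minus\<close> turns phi(p)^2 into phi(s)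
  phi(-s), and the dissections at s and -s make this a difference of squares. For positive p the
  root s is imaginary, which is why phi and psi are treated over the complex numbers.\<close>

lemma phi_square:
  fixes p :: complex
  assumes p: "norm p < 1" "p \<noteq> 0"
  shows "phi p ^ 2 = phi (p\<^sup>2) ^ 2 + 4 * p * psi (p\<^sup>2) ^ 2"
proof -
  define s where "s = csqrt (- p)"
  have s: "s\<^sup>2 = - p"
    by (simp add: s_def)
  have s4: "s ^ 4 = p\<^sup>2"
    using power_mult[of s 2 2] s by simp
  have ns: "norm s < 1" "s \<noteq> 0"
    using p by (auto simp: s_def norm_csqrt)
  have "phi p ^ 2 = phi s * phi (- s)"
    using phi_phi_minus[OF ns] s by simp
  also have "\<dots> = (phi (p\<^sup>2) + 2 * s * psi (p\<^sup>2)) * (phi (p\<^sup>2) - 2 * s * psi (p\<^sup>2))"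
    using phi_dissection[of s] phi_dissection[of "- s"] ns s4 by simp
  also have "\<dots> = phi (p\<^sup>2) ^ 2 - 4 * s\<^sup>2 * psi (p\<^sup>2) ^ 2"
    by (simp add: algebra_simps power2_eq_square)
  finally show ?thesis by (simp add: s)
qed

text \<open>Jacobi's theta_3^4 = theta_4^4 + theta_2^4. \<open>phi_square\<close> at p and at -p
  gives a sum and a difference of the same two terms, so the difference of their squares is a
  product, which \<open>psi_square\<close> collapses.\<close>

lemma jacobi_quartic:
  fixes p :: complex
  assumes p: "norm p < 1" "p \<noteq> 0"
  shows "phi p ^ 4 = phi (- p) ^ 4 + 16 * p * psi p ^ 4"
proof -
  have 1: "phi p ^ 2 = phi (p\<^sup>2) ^ 2 + 4 * p * psi (p\<^sup>2) ^ 2"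
    and 2: "phi (- p) ^ 2 = phi (p\<^sup>2) ^ 2 - 4 * p * psi (p\<^sup>2) ^ 2"
    using phi_square[of p] phi_square[of "- p"] p by auto
  have "phi p ^ 4 - phi (- p) ^ 4 = (phi p ^ 2) ^ 2 - (phi (- p) ^ 2) ^ 2"
    by simp
  also have "\<dots> = 16 * p * (psi (p\<^sup>2) * phi (p\<^sup>2)) ^ 2"
    unfolding 1 2 by (simp add: algebra_simps power2_eq_square)
  also have "\<dots> = 16 * p * psi p ^ 4"
    by (simp flip: psi_square[OF p] power_mult)
  finally show ?thesis by (simp add: algebra_simps)
qed

section \<open>Differential equations from the duplication formulas\<close>

lemma
  fixes p :: real
  assumes p: "0 < p" "p < 1"
  shows phi_square_real: "phi p ^ 2 = phi (p\<^sup>2) ^ 2 + 4 * p * psi (p\<^sup>2) ^ 2"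
    and psi_square_real: "psi p ^ 2 = psi (p\<^sup>2) * phi (p\<^sup>2)"
proof -
  have q: "\<bar>p\<bar> < 1" "\<bar>p\<^sup>2\<bar> < 1" using p by (auto simp: power_less_one_iff)
  note R = of_real_psum[OF Bseq_phi_coeff q(1), of 0, where 'a = complex] of_real_psum[OF Bseq_psi_coeff q(1), of 0, where 'a = complex]
     of_real_psum[OF Bseq_phi_coeff q(2), of 0, where 'a = complex] of_real_psum[OF Bseq_psi_coeff q(2), of 0, where 'a = complex]
  have "complex_of_real (phi p ^ 2) = complex_of_real (phi (p\<^sup>2) ^ 2 + 4 * p * psi (p\<^sup>2) ^ 2)"
    using phi_square[of "of_real p"] p R by simp
  then show "phi p ^ 2 = phi (p\<^sup>2) ^ 2 + 4 * p * psi (p\<^sup>2) ^ 2"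
    by (simp only: of_real_eq_iff)
  have "complex_of_real (psi p ^ 2) = complex_of_real (psi (p\<^sup>2) * phi (p\<^sup>2))"
    using psi_square[of "of_real p"] p R by simp
  then show "psi p ^ 2 = psi (p\<^sup>2) * phi (p\<^sup>2)"
    by (simp only: of_real_eq_iff)
qed

text \<open>The length n is free because the partial sums will show that phi is unbounded as p tends
  to 1.\<close>

lemma sum_le_phi:
  fixes p :: real
  assumes "0 < p" "p < 1"
  shows "(\<Sum>r<n. (if r = 0 then 1 else 2) * p ^ (r\<^sup>2)) \<le> phi p"
  using phi_sums[of p] assms sum_le_suminf[of "\<lambda>r. (if r = 0 then 1 else 2) * p ^ (r\<^sup>2)" "{..<n}"]
  by (auto simp: sums_iff)

lemma phi_pos: "0 < p \<Longrightarrow> p < 1 \<Longrightarrow> phi (p::real) > 0"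
  using sum_le_phi[of p 1] by simp

lemma psi_pos: 
  assumes "0 < p" "p < 1"
  shows "psi (p::real) > 0"
  using psi_sums[of p] assms sum_le_suminf[of "\<lambda>r. p ^ (r\<^sup>2 + r)" "{..<1}"]
  by (auto simp: sums_iff)

text \<open>
  The nome is written \<open>q = e^x\<close> with \<open>x < 0\<close>, so that \<open>q d/dq\<close> is \<open>d/dx\<close> and \<open>q \<mapsto> q\<^sup>2\<close> is \<open>x \<mapsto> 2x\<close>.
  Then \<open>theta 0\<close> is Jacobi's \<open>\<theta>\<^sub>3\<close>, and \<open>kmod\<close> is the modulus \<open>\<theta>\<^sub>2\<^sup>2 / \<theta>\<^sub>3\<^sup>2\<close>.
\<close>

definition theta :: "nat \<Rightarrow> real \<Rightarrow> real" where "theta j x = psum phi_coeff j (exp x)"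

definition kmod :: "real \<Rightarrow> real" where "kmod x = 4 * exp (x / 2) * psi (exp x) ^ 2 / theta 0 x ^ 2"

definition kmod_log_deriv :: "real \<Rightarrow> real" where
  "kmod_log_deriv x = 1 / 2 + 2 * psum psi_coeff 1 (exp x) / psi (exp x) - 2 * theta 1 x / theta 0 x"

lemma theta_pos: "x < 0 \<Longrightarrow> theta 0 x > 0"
  by (simp add: theta_def phi_pos)

lemma kmod_pos: "x < 0 \<Longrightarrow> kmod x > 0"
  using theta_pos[of x] psi_pos[of "exp x"] by (simp add: kmod_def)

lemma DERIV_theta: "x < 0 \<Longrightarrow> (theta j has_field_derivative theta (Suc j) x) (at x)"
  unfolding theta_def[abs_def] by (rule DERIV_psum_exp[OF Bseq_phi_coeff])

lemma DERIV_kmod_log: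
  assumes x: "x < 0"
  shows "(kmod has_field_derivative kmod x * kmod_log_deriv x) (at x)"
proof -
  have [simp]: "theta 0 x \<noteq> 0" "psi (exp x) \<noteq> 0"
    using theta_pos[OF x] psi_pos[of "exp x"] x by auto
  show ?thesis
    unfolding kmod_def[abs_def]
    by (rule derivative_eq_intros refl DERIV_theta[OF x] DERIV_psum_exp[OF Bseq_psi_coeff x] | simp)+
       (simp add: kmod_log_deriv_def divide_simps, algebra)
qed

lemma theta_double:
  assumes x: "x < 0"
  shows "theta 0 x ^ 2 = theta 0 (2 * x) ^ 2 * (1 + kmod (2 * x))"
proof -
  have e: "exp (2 * x) = (exp x)\<^sup>2" by (simp add: exp_double)
  have "theta 0 (2 * x) \<noteq> 0" using theta_pos[of "2 * x"] x by auto
  then show ?thesis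
    using phi_square_real[of "exp x"] x
    by (simp add: kmod_def theta_def e distrib_left)
qed

text \<open>Landen's transformation, stated for the square so that it is rational in
  \<open>kmod (2 * x)\<close>.\<close>

lemma kmod_double:
  assumes x: "x < 0"
  shows "kmod x ^ 2 = 4 * kmod (2 * x) / (1 + kmod (2 * x)) ^ 2"
proof -
  have e: "exp (2 * x) = (exp x)\<^sup>2" by (simp add: exp_double)
  have nz: "theta 0 (2 * x) \<noteq> 0" "1 + kmod (2 * x) \<noteq> 0" 
    using theta_pos[of "2 * x"] kmod_pos[of "2 * x"] x by auto
  have "kmod x ^ 2 = 16 * exp (x / 2) ^ 2 * (psi (exp x) ^ 2) ^ 2 / (theta 0 x ^ 2) ^ 2"
    by (simp add: kmod_def power_mult_distrib power_divide)
  also have "exp (x / 2) ^ 2 = exp x"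
    by (simp flip: exp_double)
  also have "psi (exp x) ^ 2 = psi (exp (2 * x)) * theta 0 (2 * x)"
    using psi_square_real[of "exp x"] x by (simp add: e theta_def)
  also note theta_double[OF x]
  also have "16 * exp x * (psi (exp (2 * x)) * theta 0 (2 * x))\<^sup>2 / ((theta 0 (2 * x))\<^sup>2 * (1 + kmod (2 * x)))\<^sup>2 =
     4 * (4 * exp x * psi (exp (2 * x)) ^ 2 / theta 0 (2 * x) ^ 2) / (1 + kmod (2 * x)) ^ 2"
    using nz by (simp add: power_mult_distrib) (simp add: divide_simps eval_nat_numeral)
  also have "4 * exp x * psi (exp (2 * x)) ^ 2 / theta 0 (2 * x) ^ 2 = kmod (2 * x)"
    by (simp add: kmod_def)
  finally show ?thesis .
qed

lemma tendsto_theta_0: "(theta 0 \<longlongrightarrow> 1) at_bot"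
  using tendsto_psum_exp[OF Bseq_phi_coeff] by (simp add: theta_def[abs_def] phi_coeff_def)

lemma tendsto_psi_exp: "((\<lambda>x::real. psi (exp x)) \<longlongrightarrow> 1) at_bot"
proof -
  have "psi_coeff 0 = 1" by (simp add: psi_coeff_def image_iff)
  then show ?thesis using tendsto_psum_exp[OF Bseq_psi_coeff] by simp
qed

lemma tendsto_theta_Suc: "((\<lambda>x. x\<^sup>2 * theta (Suc j) x) \<longlongrightarrow> 0) at_bot" "(theta (Suc j) \<longlongrightarrow> 0) at_bot"
  using tendsto_square_psum_exp[OF Bseq_phi_coeff, of j] tendsto_at_bot_of_square
  by (auto simp: theta_def[abs_def])

lemma tendsto_kmod: "(kmod \<longlongrightarrow> 0) at_bot"
proof -
  have "((\<lambda>x. 4 * exp (x / 2) * psi (exp x) ^ 2 / theta 0 x ^ 2) \<longlongrightarrow> 4 * 0 * 1 ^ 2 / 1 ^ 2) at_bot"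
    by (intro tendsto_intros tendsto_theta_0 tendsto_psi_exp) (real_asymp, simp)
  then show ?thesis by (simp add: kmod_def[abs_def])
qed

lemma tendsto_square_kmod: "((\<lambda>x. x\<^sup>2 * kmod x) \<longlongrightarrow> 0) at_bot"
proof -
  have "((\<lambda>x. 4 * (x\<^sup>2 * exp (x / 2)) * psi (exp x) ^ 2 / theta 0 x ^ 2) \<longlongrightarrow> 4 * 0 * 1 ^ 2 / 1 ^ 2) at_bot"
    by (intro tendsto_intros tendsto_theta_0 tendsto_psi_exp) (real_asymp, simp)
  then show ?thesis by (simp add: kmod_def[abs_def] mult_ac)
qed

lemma filterlim_power2_mult_at_bot:
  assumes "x < (0::real)"
  shows "filterlim (\<lambda>n. 2 ^ n * x) at_bot sequentially"
  using assms by real_asymp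

lemma eq_limit_of_doubling_invariant:
  fixes f :: "real \<Rightarrow> real"
  assumes inv: "\<And>x. x < 0 \<Longrightarrow> f (2 * x) = f x" and lim: "(f \<longlongrightarrow> L) at_bot" and x: "x < 0"
  shows "f x = L"
proof -
  have eq: "f (2 ^ n * x) = f x" for n
  proof (induction n)
    case (Suc n)
    then show ?case using inv[of "2 ^ n * x"] x by (simp add: mult.assoc mult_pos_neg)
  qed simp
  have "(\<lambda>n. f (2 ^ n * x)) \<longlonglongrightarrow> L"
    by (rule filterlim_compose[OF lim filterlim_power2_mult_at_bot[OF x]])
  then show ?thesis by (simp add: eq LIMSEQ_const_iff)
qed

text \<open>Since 4K <= (1 + K)^2 with equality only for K = 1, a value >= 1 at x forces a value >=
  1 at 2x. It would persist along 2^n x, against the limit 0.\<close>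

lemma kmod_less_1:
  assumes x: "x < 0"
  shows "kmod x < 1"
proof (rule ccontr)
  assume "\<not> kmod x < 1"
  have step: "kmod (2 * y) \<ge> 1" if y: "y < 0" "kmod y \<ge> 1" for y
  proof -
    define K where "K = kmod (2 * y)"
    have K: "K > 0" using kmod_pos[of "2 * y"] y by (simp add: K_def)
    have "1 \<le> kmod y ^ 2" using y by (simp add: one_le_power)
    then have "1 \<le> 4 * K / (1 + K) ^ 2" using kmod_double[OF y(1)] by (simp add: K_def)
    then have "(1 + K)\<^sup>2 \<le> 4 * K" using K by (simp add: le_divide_eq)
    then have "(1 - K)\<^sup>2 \<le> 0" by (simp add: algebra_simps power2_eq_square)
    then show ?thesis by (simp add: K_def)
  qed
  have "kmod (2 ^ n * x) \<ge> 1" for n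
  proof (induction n)
    case (Suc n)
    then show ?case using step[of "2 ^ n * x"] x by (simp add: mult.assoc mult_pos_neg)
  qed (use \<open>\<not> kmod x < 1\<close> in simp)
  moreover have "(\<lambda>n. kmod (2 ^ n * x)) \<longlonglongrightarrow> 0"
    by (rule filterlim_compose[OF tendsto_kmod filterlim_power2_mult_at_bot[OF x]])
  ultimately have "1 \<le> (0::real)"
    by (intro LIMSEQ_le_const) auto
  then show False by simp
qed

text \<open>Differentiates functional equations that hold on the negative axis; both the duplication
  formulas and the inversion formula pass through it.\<close>

lemma DERIV_unique_neg:
  fixes f g :: "real \<Rightarrow> real"
  assumes "(f has_field_derivative a) (at x)" "(g has_field_derivative b) (at x)"
    and eq: "\<And>x. x < 0 \<Longrightarrow> f x = g x" and x: "x < 0"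
  shows "a = b"
proof -
  have "(g has_field_derivative a) (at x)"
    by (rule has_field_derivative_transform_within_open[OF assms(1), of "{..<0}"]) (use eq x in auto)
  then show ?thesis using assms(2) by (rule DERIV_unique)
qed

lemma DERIV_mult2:
  assumes "(f has_field_derivative D) (at (2 * x))"
  shows "((\<lambda>x. f (2 * x)) has_field_derivative 2 * D) (at (x::real))"
  by (rule DERIV_cong[OF DERIV_chain2[where g = "\<lambda>x. 2 * x", OF assms]]) (auto intro!: derivative_eq_intros)

text \<open>The map K -> 4K / (1 + K)^2 occurs twice: it takes \<open>kmod (2 * x)\<close> to
  \<open>kmod x ^ 2\<close>, and \<open>lam\<close> to \<open>alpha\<close>.\<close>

lemma DERIV_Landen:
  fixes f :: "real \<Rightarrow> real"
  assumes "(f has_field_derivative D) (at x)" "1 + f x \<noteq> 0"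
  shows "((\<lambda>x. 4 * f x / (1 + f x) ^ 2) has_field_derivative 4 * D * (1 - f x) / (1 + f x) ^ 3) (at x)"
  using assms(2) by (auto intro!: derivative_eq_intros assms(1) simp: divide_simps) algebra

lemma kmod_log_deriv_double:
  assumes x: "x < 0"
  shows "kmod_log_deriv x = kmod_log_deriv (2 * x) * (1 - kmod (2 * x)) / (1 + kmod (2 * x))"
proof -
  define K where "K = kmod (2 * x)"
  define M where "M = kmod_log_deriv (2 * x)"
  have K: "K > 0" using kmod_pos[of "2 * x"] x by (simp add: K_def)
  have D2: "((\<lambda>x. kmod (2 * x)) has_field_derivative 2 * (K * M)) (at x)"
    using DERIV_mult2[OF DERIV_kmod_log[of "2 * x"]] x by (simp add: K_def M_def)
  have "((\<lambda>x. kmod x ^ 2) has_field_derivative 2 * kmod x ^ 2 * kmod_log_deriv x) (at x)"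
    by (rule derivative_eq_intros refl DERIV_kmod_log[OF x] | simp add: power2_eq_square)+
  moreover have "((\<lambda>x. 4 * kmod (2 * x) / (1 + kmod (2 * x)) ^ 2) has_field_derivative
      8 * K * M * (1 - K) / (1 + K) ^ 3) (at x)"
    using DERIV_Landen[OF D2] K by (simp add: K_def mult_ac)
  ultimately have "2 * kmod x ^ 2 * kmod_log_deriv x = 8 * K * M * (1 - K) / (1 + K) ^ 3"
    by (rule DERIV_unique_neg[OF _ _ kmod_double x])
  then have "2 * (4 * K / (1 + K) ^ 2) * kmod_log_deriv x = 8 * K * M * (1 - K) / (1 + K) ^ 3"
    using kmod_double[OF x] by (simp add: K_def)
  then have "kmod_log_deriv x = M * (1 - K) / (1 + K)"
    using K by (simp add: divide_simps power2_eq_square power3_eq_cube split: if_splits)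
  then show ?thesis by (simp add: K_def M_def)
qed

text \<open>The quotient of the two sides is invariant under \<open>x \<mapsto> 2x\<close>, hence equal to its limit at \<open>-\<infinity>\<close>.\<close>

lemma kmod_log_deriv_eq:
  assumes x: "x < 0"
  shows "kmod_log_deriv x = 1 / 2 * (1 - kmod x ^ 2) * theta 0 x ^ 4"
proof -
  define f where "f = (\<lambda>x. kmod_log_deriv x / ((1 - kmod x ^ 2) * theta 0 x ^ 4))"
  have "f x = 1 / 2"
  proof (rule eq_limit_of_doubling_invariant[OF _ _ x])
    fix x :: real assume x: "x < 0"
    define K where "K = kmod (2 * x)"
    define U where "U = theta 0 (2 * x)"
    have K: "0 < K" "K < 1" using kmod_pos[of "2 * x"] kmod_less_1[of "2 * x"] x by (auto simp: K_def)
    have U: "U > 0" using theta_pos[of "2 * x"] x by (simp add: U_def)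
    have t4: "theta 0 x ^ 4 = (U\<^sup>2 * (1 + K))\<^sup>2"
      using theta_double[OF x] by (simp add: U_def K_def flip: power_mult)
         (metis (no_types) mult_2 numeral_Bit0 power_mult power2_eq_square power_add)
    have k2: "1 - kmod x ^ 2 = (1 - K)\<^sup>2 / (1 + K)\<^sup>2"
      unfolding kmod_double[OF x] K_def[symmetric] using K by (simp add: divide_simps) algebra
    have "f x = kmod_log_deriv (2 * x) * (1 - K) / (1 + K) / ((1 - K)\<^sup>2 / (1 + K)\<^sup>2 * (U\<^sup>2 * (1 + K))\<^sup>2)"
      unfolding f_def kmod_log_deriv_double[OF x] t4 k2 by (simp add: K_def)
    also have "\<dots> = kmod_log_deriv (2 * x) / ((1 - K) * (1 + K) * U ^ 4)"
      using K U by (simp add: divide_simps) algebra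
    also have "(1 - K) * (1 + K) = 1 - K\<^sup>2"
      by algebra
    finally show "f (2 * x) = f x" by (simp add: f_def K_def U_def)
  next
    \<comment> \<open>The limit 1/2 is the exponent of the factor \<open>exp (x / 2)\<close> in
      \<open>kmod\<close>; the logarithmic derivatives of psi and theta die out.\<close>
    have "((\<lambda>x. (1 / 2 + 2 * psum psi_coeff 1 (exp x) / psi (exp x) - 2 * theta 1 x / theta 0 x) /
        ((1 - kmod x ^ 2) * theta 0 x ^ 4)) \<longlongrightarrow> (1 / 2 + 2 * 0 / 1 - 2 * 0 / 1) / ((1 - 0 ^ 2) * 1 ^ 4)) at_bot"
      using tendsto_theta_Suc(2)[of 0] tendsto_at_bot_of_square[OF tendsto_square_psum_exp[OF Bseq_psi_coeff, of 0]]
      by (intro tendsto_intros tendsto_theta_0 tendsto_psi_exp tendsto_kmod) auto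
    then show "(f \<longlongrightarrow> 1 / 2) at_bot"
      by (simp add: f_def kmod_log_deriv_def)
  qed
  moreover have "1 - kmod x ^ 2 > 0"
    using kmod_pos[OF x] kmod_less_1[OF x] by (simp add: power_less_one_iff)
  ultimately show ?thesis
    using theta_pos[OF x] by (simp add: f_def field_simps)
qed

lemma DERIV_kmod:
  assumes x: "x < 0"
  shows "(kmod has_field_derivative kmod x * (1 - kmod x ^ 2) * theta 0 x ^ 4 / 2) (at x)"
  using DERIV_kmod_log[OF x] kmod_log_deriv_eq[OF x] by (simp add: mult_ac)


section \<open>The second-order equation for theta_3^(-2)\<close>

definition vfun :: "real \<Rightarrow> real" where "vfun x = 1 / theta 0 x ^ 2"
definition vfun' :: "real \<Rightarrow> real" where "vfun' x = - 2 * theta 1 x / theta 0 x ^ 3"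
definition vfun'' :: "real \<Rightarrow> real" where
  "vfun'' x = - 2 * theta 2 x / theta 0 x ^ 3 + 6 * theta 1 x ^ 2 / theta 0 x ^ 4"

lemma vfun_pos: "x < 0 \<Longrightarrow> vfun x > 0"
  using theta_pos[of x] by (simp add: vfun_def)

lemma DERIV_vfun: "x < 0 \<Longrightarrow> (vfun has_field_derivative vfun' x) (at x)"
  unfolding vfun_def[abs_def] vfun'_def using theta_pos[of x]
  by (auto intro!: derivative_eq_intros DERIV_theta simp: divide_simps eval_nat_numeral)

lemma DERIV_vfun': "x < 0 \<Longrightarrow> (vfun' has_field_derivative vfun'' x) (at x)"
  unfolding vfun'_def[abs_def] vfun''_def using theta_pos[of x]
  by (auto intro!: derivative_eq_intros DERIV_theta simp: divide_simps eval_nat_numeral) algebra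

lemma tendsto_vfun: "(vfun \<longlongrightarrow> 1) at_bot"
proof -
  have "((\<lambda>x. 1 / theta 0 x ^ 2) \<longlongrightarrow> 1 / 1 ^ 2) at_bot"
    by (intro tendsto_intros tendsto_theta_0) auto
  then show ?thesis by (simp add: vfun_def[abs_def])
qed

lemma theta_power4: "theta 0 x ^ 4 = 1 / vfun x ^ 2"
  by (simp add: vfun_def field_simps flip: power_mult)

lemma DERIV_kmod':
  assumes x: "x < 0"
  shows "(kmod has_field_derivative kmod x * (1 - kmod x ^ 2) / (2 * vfun x ^ 2)) (at x)"
  using DERIV_kmod[OF x] by (simp add: theta_power4 mult_ac)

lemma vfun_double: "x < 0 \<Longrightarrow> vfun x = vfun (2 * x) / (1 + kmod (2 * x))"
  using theta_double[of x] by (simp add: vfun_def)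

lemma DERIV_kmod_mult2:
  assumes x: "x < 0"
  shows "((\<lambda>x. kmod (2 * x)) has_field_derivative
           kmod (2 * x) * (1 - kmod (2 * x) ^ 2) / vfun (2 * x) ^ 2) (at x)"
  using DERIV_mult2[OF DERIV_kmod'[of "2 * x"]] x by simp

lemma vfun'_double:
  assumes x: "x < 0"
  shows "vfun' x = 2 * vfun' (2 * x) / (1 + kmod (2 * x)) -
           kmod (2 * x) * (1 - kmod (2 * x)) / ((1 + kmod (2 * x)) * vfun (2 * x))"
proof (rule DERIV_unique_neg[OF DERIV_vfun[OF x] _ vfun_double x])
  have V: "vfun (2 * x) > 0" "1 + kmod (2 * x) > 0"
    using vfun_pos[of "2 * x"] kmod_pos[of "2 * x"] x by auto
  have DV: "((\<lambda>x. vfun (2 * x)) has_field_derivative 2 * vfun' (2 * x)) (at x)"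
    using DERIV_mult2[OF DERIV_vfun[of "2 * x"]] x by simp
  show "((\<lambda>x. vfun (2 * x) / (1 + kmod (2 * x))) has_field_derivative
     2 * vfun' (2 * x) / (1 + kmod (2 * x)) -
     kmod (2 * x) * (1 - kmod (2 * x)) / ((1 + kmod (2 * x)) * vfun (2 * x))) (at x)"
    using V by (auto intro!: derivative_eq_intros DV DERIV_kmod_mult2[OF x] simp: divide_simps) algebra
qed

text \<open>V, W and G stand for \<open>vfun\<close>, \<open>vfun'\<close> and \<open>kmod\<close>
  at 2x, hence the factors 2. Abstract functions leave a rational identity in a few atoms.\<close>

lemma DERIV_vfun'_double_aux:
  fixes V W G :: "real \<Rightarrow> real"
  assumes V: "(V has_field_derivative 2 * W x) (at x)" and W: "(W has_field_derivative 2 * W') (at x)"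
    and G: "(G has_field_derivative G x * (1 - G x ^ 2) / V x ^ 2) (at x)"
    and nz: "V x \<noteq> 0" "1 + G x \<noteq> 0"
  shows "((\<lambda>x. 2 * W x / (1 + G x) - G x * (1 - G x) / ((1 + G x) * V x)) has_field_derivative
     4 * W' / (1 + G x) - (1 - 2 * G x - G x ^ 2) * G x * (1 - G x) / ((1 + G x) * V x ^ 3)) (at x)"
  by (rule derivative_eq_intros V W G refl | use nz in force)+ (use nz in \<open>simp add: divide_simps\<close>, algebra)

lemma vfun''_double:
  assumes x: "x < 0"
  shows "vfun'' x = 4 * vfun'' (2 * x) / (1 + kmod (2 * x)) -
    (1 - 2 * kmod (2 * x) - kmod (2 * x) ^ 2) * kmod (2 * x) * (1 - kmod (2 * x)) /
      ((1 + kmod (2 * x)) * vfun (2 * x) ^ 3)"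
proof (rule DERIV_unique_neg[OF DERIV_vfun'[OF x] _ vfun'_double x])
  have "vfun (2 * x) > 0" "1 + kmod (2 * x) > 0"
    using vfun_pos[of "2 * x"] kmod_pos[of "2 * x"] x by auto
  then show "((\<lambda>x. 2 * vfun' (2 * x) / (1 + kmod (2 * x)) - kmod (2 * x) * (1 - kmod (2 * x)) /
      ((1 + kmod (2 * x)) * vfun (2 * x))) has_field_derivative
     4 * vfun'' (2 * x) / (1 + kmod (2 * x)) -
    (1 - 2 * kmod (2 * x) - kmod (2 * x) ^ 2) * kmod (2 * x) * (1 - kmod (2 * x)) /
      ((1 + kmod (2 * x)) * vfun (2 * x) ^ 3)) (at x)"
    using DERIV_mult2[OF DERIV_vfun[of "2 * x"]] DERIV_mult2[OF DERIV_vfun'[of "2 * x"]] x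
    by (intro DERIV_vfun'_double_aux DERIV_kmod_mult2) auto
qed

definition lam :: "real \<Rightarrow> real" where "lam x = kmod x ^ 2"

lemma lam_pos: "x < 0 \<Longrightarrow> lam x > 0"
  and lam_less_1: "x < 0 \<Longrightarrow> lam x < 1"
  using kmod_pos[of x] kmod_less_1[of x] by (simp_all add: lam_def power_less_one_iff)

lemma DERIV_lam:
  assumes x: "x < 0"
  shows "(lam has_field_derivative lam x * (1 - lam x) / vfun x ^ 2) (at x)"
  unfolding lam_def[abs_def] using vfun_pos[OF x]
  by (auto intro!: derivative_eq_intros DERIV_kmod'[OF x] simp: divide_simps power2_eq_square)

lemma lam_double: "x < 0 \<Longrightarrow> lam x = 4 * kmod (2 * x) / (1 + kmod (2 * x)) ^ 2"
  by (simp add: lam_def kmod_double)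

text \<open>The algebra behind S(x) = 4 S(2x): V, W and K are \<open>vfun\<close>,
  \<open>vfun''\<close> and \<open>kmod\<close> at 2x, and the left side is the residual at x after
  inserting the duplication formulas.\<close>

lemma residual_double_aux:
  fixes V W K :: real
  assumes "V \<noteq> 0" "1 + K \<noteq> 0"
  shows "(4 * W / (1 + K) - (1 - 2 * K - K ^ 2) * K * (1 - K) / ((1 + K) * V ^ 3)) / (V / (1 + K)) +
     (4 * K / (1 + K) ^ 2) * (1 - 4 * K / (1 + K) ^ 2) / (4 * (V / (1 + K)) ^ 4) =
     4 * (W / V + K ^ 2 * (1 - K ^ 2) / (4 * V ^ 4))"
proof -
  define T where "T = 1 + K"
  have K: "K = T - 1" "T \<noteq> 0" using assms by (auto simp: T_def)
  have 1: "(4 * W / T - (1 - 2 * K - K ^ 2) * K * (1 - K) / (T * V ^ 3)) / (V / T) =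
      4 * W / V - (1 - 2 * K - K ^ 2) * K * (1 - K) / V ^ 4"
    using assms K(2) by (simp add: divide_simps eval_nat_numeral)
  have 2: "1 - 4 * K / T ^ 2 = (1 - K) ^ 2 / T ^ 2"
    using K(2) unfolding K(1) by (simp add: divide_simps) algebra
  have 3: "(4 * K / T ^ 2) * ((1 - K) ^ 2 / T ^ 2) / (4 * (V / T) ^ 4) = K * (1 - K) ^ 2 / V ^ 4"
    using assms K(2) by (simp add: divide_simps eval_nat_numeral)
  show ?thesis
    unfolding T_def[symmetric] 2 1 3 using assms(1) by (simp add: divide_simps) algebra
qed

text \<open>
  The residual \<open>S\<close> of this differential equation satisfies \<open>S(x) = 4 S(2x)\<close>, so \<open>x\<^sup>2 S(x)\<close> is invariant
  under doubling and vanishes like its limit at \<open>-\<infinity>\<close>.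
\<close>

lemma vfun''_eq:
  assumes x: "x < 0"
  shows "vfun'' x = - (lam x * (1 - lam x) / (4 * vfun x ^ 3))"
proof -
  define S where "S = (\<lambda>x. vfun'' x / vfun x + lam x * (1 - lam x) / (4 * vfun x ^ 4))"
  have "x\<^sup>2 * S x = 0"
  proof (rule eq_limit_of_doubling_invariant[OF _ _ x])
    fix x :: real assume x: "x < 0"
    have V: "vfun (2 * x) > 0" "1 + kmod (2 * x) > 0"
      using vfun_pos[of "2 * x"] kmod_pos[of "2 * x"] x by auto
    have "S x = 4 * S (2 * x)"
      unfolding S_def vfun''_double[OF x] vfun_double[OF x] lam_double[OF x]
      using residual_double_aux[of "vfun (2 * x)" "kmod (2 * x)" "vfun'' (2 * x)"] V
      by (simp add: lam_def)
    then show "(2 * x)\<^sup>2 * S (2 * x) = x\<^sup>2 * S x" by simp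
  next
    have t: "((\<lambda>x. x\<^sup>2 * theta 1 x) \<longlongrightarrow> 0) at_bot" "(theta 1 \<longlongrightarrow> 0) at_bot" "((\<lambda>x. x\<^sup>2 * theta 2 x) \<longlongrightarrow> 0) at_bot"
      using tendsto_theta_Suc[of 0] tendsto_theta_Suc[of 1] by (simp_all add: numeral_2_eq_2)
    have "((\<lambda>x. (- 2 * (x\<^sup>2 * theta 2 x) / theta 0 x ^ 3 + 6 * (x\<^sup>2 * theta 1 x) * theta 1 x / theta 0 x ^ 4) / vfun x +
        (x\<^sup>2 * kmod x) * kmod x * (1 - kmod x ^ 2) / (4 * vfun x ^ 4)) \<longlongrightarrow>
        (- 2 * 0 / 1 ^ 3 + 6 * 0 * 0 / 1 ^ 4) / 1 + 0 * 0 * (1 - 0 ^ 2) / (4 * 1 ^ 4)) at_bot"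
      by (intro tendsto_intros tendsto_theta_0 tendsto_vfun t tendsto_kmod tendsto_square_kmod) auto
    then show "((\<lambda>x. x\<^sup>2 * S x) \<longlongrightarrow> 0) at_bot"
      by (simp add: S_def vfun''_def lam_def power2_eq_square algebra_simps add_divide_distrib)
  qed
  then have "S x = 0" using x by simp
  then show ?thesis
    using vfun_pos[OF x] by (simp add: S_def eval_nat_numeral field_simps)
qed

section \<open>The inversion formula\<close>

definition hyp_coeff :: "nat \<Rightarrow> real" where
  "hyp_coeff n = (pochhammer (1/2) n / fact n) ^ 2"

lemma hyp_coeff_0 [simp]: "hyp_coeff 0 = 1"
  by (simp add: hyp_coeff_def)

lemma hyp_coeff_Suc: "real (Suc n) ^ 2 * hyp_coeff (Suc n) = (real n + 1 / 2) ^ 2 * hyp_coeff n"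
proof -
  have "real (Suc n) * (pochhammer (1/2) (Suc n) / fact (Suc n)) = (real n + 1 / 2) * (pochhammer (1/2) n / fact n :: real)"
    by (simp add: pochhammer_Suc field_simps del: of_nat_Suc)
  then show ?thesis
    unfolding hyp_coeff_def by (metis power_mult_distrib)
qed

lemma hyp_coeff_nonneg: "hyp_coeff n \<ge> 0"
  by (simp add: hyp_coeff_def)

lemma hyp_coeff_le_1: "hyp_coeff n \<le> 1"
proof (induction n)
  case (Suc n)
  have "real (Suc n) ^ 2 * hyp_coeff (Suc n) \<le> real (Suc n) ^ 2 * 1"
    unfolding hyp_coeff_Suc using Suc hyp_coeff_nonneg[of n] by (intro mult_mono power_mono) auto
  then show ?case by (simp del: of_nat_Suc)
qed simp

lemma Bseq_hyp_coeff: "Bseq hyp_coeff"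
  using hyp_coeff_nonneg hyp_coeff_le_1 by (intro BseqI'[of _ 1]) auto

text \<open>With D = z d/dz this is D^2 F = z (D + 1/2)^2 F, the coefficient recurrence read
  termwise.\<close>

lemma hyp_ODE:
  assumes z: "\<bar>z::real\<bar> < 1"
  shows "psum hyp_coeff 2 z = z * (psum hyp_coeff 2 z + psum hyp_coeff 1 z + psum hyp_coeff 0 z / 4)"
proof -
  have s: "(\<lambda>m. real m ^ j * hyp_coeff m * z ^ m) sums psum hyp_coeff j z" for j
    using psum_sums[OF Bseq_hyp_coeff, of z j] z by simp
  have "(\<lambda>m. z * (real m ^ 2 * hyp_coeff m * z ^ m + real m ^ 1 * hyp_coeff m * z ^ m + real m ^ 0 * hyp_coeff m * z ^ m / 4))
      sums (z * (psum hyp_coeff 2 z + psum hyp_coeff 1 z + psum hyp_coeff 0 z / 4))"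
    by (intro sums_mult sums_add sums_divide s)
  also have "(\<lambda>m. z * (real m ^ 2 * hyp_coeff m * z ^ m + real m ^ 1 * hyp_coeff m * z ^ m + real m ^ 0 * hyp_coeff m * z ^ m / 4)) =
     (\<lambda>m. real (Suc m) ^ 2 * hyp_coeff (Suc m) * z ^ Suc m)"
    unfolding hyp_coeff_Suc by (auto simp: fun_eq_iff power2_eq_square algebra_simps)
  finally show ?thesis
    \<comment> \<open>The index shift loses nothing, since the coefficient of index 0 carries the
      factor 0^2.\<close>
    using s[of 2] by (subst (asm) sums_Suc_iff) (auto simp: sums_iff)
qed

text \<open>Wallis' product in disguise: the left side is the squared reciprocal of the limit
  formula for Gamma at 1/2, and Gamma(1/2)^2 = pi. This is the source of pi in the inversion
  formula.\<close>

lemma tendsto_n_hyp_coeff: "(\<lambda>n. real n * hyp_coeff n) \<longlonglongrightarrow> 1 / pi"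
proof -
  have "(\<lambda>n. inverse (Gamma_series' (1/2) n) ^ 2) \<longlonglongrightarrow> inverse (Gamma (1/2 :: real)) ^ 2"
    by (intro tendsto_intros Gamma_series'_LIMSEQ) (simp add: Gamma_one_half_real)
  also have "inverse (Gamma (1/2 :: real)) ^ 2 = 1 / pi"
    by (simp add: Gamma_one_half_real power_inverse power_divide inverse_eq_divide)
  finally have lim: "(\<lambda>n. inverse (Gamma_series' (1/2 :: real) n) ^ 2) \<longlonglongrightarrow> 1 / pi" .
  show ?thesis
  proof (rule Lim_transform_eventually[OF lim])
    show "\<forall>\<^sub>F n in sequentially. inverse (Gamma_series' (1/2) n) ^ 2 = real n * hyp_coeff n"
      using eventually_gt_at_top[of 0]
    proof eventually_elim
      case (elim n)
      have e: "exp (ln (real n) / 2) ^ 2 = real n"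
        using elim by (simp flip: exp_double)
      have f: "fact n = real n * fact (n - 1)"
        using elim by (simp add: fact_reduce)
      have "inverse (Gamma_series' (1/2) n) ^ 2 = (pochhammer (1/2) n / fact (n - 1)) ^ 2 / exp (ln (real n) / 2) ^ 2"
        by (simp add: Gamma_series'_def field_simps power_mult_distrib)
      also have "\<dots> = real n * hyp_coeff n"
        unfolding e hyp_coeff_def f using elim by (simp add: field_simps power2_eq_square)
      finally show ?case .
    qed
  qed
qed

lemma tendsto_hyp_coeff: "hyp_coeff \<longlonglongrightarrow> 0"
proof -
  have "(\<lambda>n. (real n * hyp_coeff n) * inverse (real n)) \<longlonglongrightarrow> 1 / pi * 0"
    by (intro tendsto_mult tendsto_n_hyp_coeff lim_inverse_n)
  then have lim: "(\<lambda>n. (real n * hyp_coeff n) * inverse (real n)) \<longlonglongrightarrow> 0" by simp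
  show ?thesis
    by (rule Lim_transform_eventually[OF lim])
       (use eventually_gt_at_top[of 0] in eventually_elim, simp)
qed

abbreviation Hyp :: "real \<Rightarrow> real" where "Hyp \<equiv> psum hyp_coeff 0"

lemma Hyp_ge_1:
  assumes "0 \<le> z" "z < 1"
  shows "Hyp z \<ge> 1"
  using psum_sums[OF Bseq_hyp_coeff, of z 0] assms hyp_coeff_nonneg
    sum_le_suminf[of "\<lambda>m. hyp_coeff m * z ^ m" "{..<1}"]
  by (auto simp: sums_iff)

text \<open>Crude, but it will be applied to z = 1 - lam x with x near 0, where lam x is bounded
  away from 0.\<close>

lemma Hyp_le:
  assumes "0 \<le> z" "z < 1"
  shows "Hyp z \<le> 1 / (1 - z)"
proof (rule sums_le)
  show "(\<lambda>m. of_real (real m ^ 0 * hyp_coeff m) * z ^ m) sums Hyp z"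
    by (rule psum_sums[OF Bseq_hyp_coeff]) (use assms in auto)
  show "(\<lambda>m. z ^ m) sums (1 / (1 - z))"
    by (rule geometric_sums) (use assms in auto)
  show "of_real (real m ^ 0 * hyp_coeff m) * z ^ m \<le> z ^ m" for m
    using assms hyp_coeff_le_1[of m] hyp_coeff_nonneg[of m] by (simp add: mult_left_le_one_le)
qed

lemma Hyp_less:
  assumes "0 < z" "z < y" "y < 1"
  shows "Hyp z < Hyp y"
proof (rule DERIV_pos_imp_increasing[OF assms(2)])
  fix w assume w: "z \<le> w" "w \<le> y"
  then have w': "0 < w" "w < 1" using assms by auto
  have c1: "hyp_coeff 1 = 1 / 4"
    by (simp add: hyp_coeff_def power2_eq_square)
  have "hyp_coeff 1 * w \<le> psum hyp_coeff 1 w"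
    using psum_sums[OF Bseq_hyp_coeff, of w 1] w' hyp_coeff_nonneg
      sum_le_suminf[of "\<lambda>m. real m * hyp_coeff m * w ^ m" "{..<2}"]
    by (simp add: sums_iff numeral_2_eq_2)
  then have "w / 4 \<le> psum hyp_coeff 1 w" unfolding c1 by simp
  then have "psum hyp_coeff (Suc 0) w / w > 0" using w' by simp
  moreover have "(Hyp has_real_derivative psum hyp_coeff (Suc 0) w / w) (at w)"
    using w' by (intro DERIV_psum[OF Bseq_hyp_coeff]) auto
  ultimately show "\<exists>D. (Hyp has_real_derivative D) (at w) \<and> D > 0" by blast
qed

text \<open>Because lam' = lam (1 - lam) / v^2 and v satisfies \<open>vfun''_eq\<close>, multiplying
  a solution f by v straightens the hypergeometric equation to y'' = 0. The equation is assumed in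
  self-adjoint form, which is symmetric under z -> 1 - z, so it serves both solutions.\<close>

lemma
  fixes f f' :: "real \<Rightarrow> real"
  assumes f: "\<And>z. 0 < z \<Longrightarrow> z < 1 \<Longrightarrow> (f has_field_derivative f' z) (at z)"
    and f': "\<And>z. 0 < z \<Longrightarrow> z < 1 \<Longrightarrow> ((\<lambda>z. z * (1 - z) * f' z) has_field_derivative f z / 4) (at z)"
    and x: "x < 0"
  shows DERIV_ratio: "((\<lambda>x. f (lam x) * vfun x) has_field_derivative
            lam x * (1 - lam x) * f' (lam x) / vfun x + f (lam x) * vfun' x) (at x)"
    and DERIV_ratio': "((\<lambda>x. lam x * (1 - lam x) * f' (lam x) / vfun x + f (lam x) * vfun' x)
            has_field_derivative 0) (at x)"
proof -
  have l: "0 < lam x" "lam x < 1" and v: "vfun x > 0"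
    using lam_pos lam_less_1 vfun_pos x by auto
  have D1: "((\<lambda>x. f (lam x)) has_field_derivative f' (lam x) * (lam x * (1 - lam x) / vfun x ^ 2)) (at x)"
    by (rule DERIV_chain2[OF f DERIV_lam]) (use l x in auto)
  have D2: "((\<lambda>x. lam x * (1 - lam x) * f' (lam x)) has_field_derivative
      f (lam x) / 4 * (lam x * (1 - lam x) / vfun x ^ 2)) (at x)"
    by (rule DERIV_chain2[OF f' DERIV_lam]) (use l x in auto)
  show "((\<lambda>x. f (lam x) * vfun x) has_field_derivative
            lam x * (1 - lam x) * f' (lam x) / vfun x + f (lam x) * vfun' x) (at x)"
    by (rule DERIV_cong[OF DERIV_mult[OF D1 DERIV_vfun[OF x]]])
       (use v in \<open>simp add: field_simps power2_eq_square\<close>)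
  have "((\<lambda>x. lam x * (1 - lam x) * f' (lam x) / vfun x + f (lam x) * vfun' x) has_field_derivative
     (f (lam x) / 4 * (lam x * (1 - lam x) / vfun x ^ 2) * vfun x - lam x * (1 - lam x) * f' (lam x) * vfun' x) /
        (vfun x * vfun x) +
     (f' (lam x) * (lam x * (1 - lam x) / vfun x ^ 2) * vfun' x + vfun'' x * f (lam x))) (at x)"
    by (intro DERIV_add DERIV_divide DERIV_mult D1 D2 DERIV_vfun DERIV_vfun' x) (use v in auto)
  then show "((\<lambda>x. lam x * (1 - lam x) * f' (lam x) / vfun x + f (lam x) * vfun' x) has_field_derivative 0) (at x)"
  proof (rule DERIV_cong)
    show "(f (lam x) / 4 * (lam x * (1 - lam x) / vfun x ^ 2) * vfun x - lam x * (1 - lam x) * f' (lam x) * vfun' x) /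
        (vfun x * vfun x) +
     (f' (lam x) * (lam x * (1 - lam x) / vfun x ^ 2) * vfun' x + vfun'' x * f (lam x)) = 0"
      unfolding vfun''_eq[OF x] using v by (simp add: divide_simps) algebra
  qed
qed

lemma tendsto_lam: "(lam \<longlongrightarrow> 0) at_bot"
  using tendsto_power[OF tendsto_kmod, of 2] by (simp add: lam_def[abs_def])

lemma DERIV_Hyp:
  assumes "0 < z" "z < 1"
  shows "(Hyp has_field_derivative psum hyp_coeff 1 z / z) (at z)"
  using DERIV_psum[OF Bseq_hyp_coeff, of z 0] assms by simp

lemma DERIV_Hyp_ODE:
  assumes z: "0 < z" "z < 1"
  shows "((\<lambda>z. (1 - z) * psum hyp_coeff 1 z) has_field_derivative Hyp z / 4) (at z)"
proof -
  have "((\<lambda>z. (1 - z) * psum hyp_coeff 1 z) has_field_derivative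
      (0 - 1) * psum hyp_coeff 1 z + psum hyp_coeff (Suc 1) z / z * (1 - z)) (at z)"
    by (intro DERIV_mult DERIV_diff DERIV_const DERIV_ident DERIV_psum[OF Bseq_hyp_coeff]) (use z in auto)
  then show ?thesis
  proof (rule DERIV_cong)
    have "psum hyp_coeff 2 z * (1 - z) = z * (psum hyp_coeff 1 z + Hyp z / 4)"
      using hyp_ODE[of z] z by (simp add: algebra_simps)
    then show "(0 - 1) * psum hyp_coeff 1 z + psum hyp_coeff (Suc 1) z / z * (1 - z) = Hyp z / 4"
      using z by (simp add: field_simps numeral_2_eq_2)
  qed
qed

lemma DERIV_one_minus:
  fixes f :: "real \<Rightarrow> real"
  assumes "(f has_field_derivative D) (at (1 - z))"
  shows "((\<lambda>z. f (1 - z)) has_field_derivative - D) (at z)"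
  by (rule DERIV_cong[OF DERIV_chain2[where g = "\<lambda>z. 1 - z", OF assms]]) (auto intro!: derivative_eq_intros)

text \<open>The classical 2K/pi = theta_3^2: \<open>Hyp\<close> is regular at 0, so the affine
  function has a finite limit and is constant.\<close>

lemma Hyp_lam:
  assumes x: "x < 0"
  shows "Hyp (lam x) = theta 0 x ^ 2"
proof -
  have f': "((\<lambda>z. z * (1 - z) * (psum hyp_coeff 1 z / z)) has_field_derivative Hyp z / 4) (at z)"
    if "0 < z" "z < 1" for z
    by (rule has_field_derivative_transform_within_open[OF DERIV_Hyp_ODE, of _ "{0<..<1}"]) (use that in auto)
  have "Hyp (lam x) * vfun x = 1"
  proof (rule eq_limit_of_second_deriv_zero[OF DERIV_ratio DERIV_ratio' _ x])
    have "((\<lambda>x. Hyp (lam x) * vfun x) \<longlongrightarrow> Hyp 0 * 1) at_bot"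
      by (intro tendsto_mult tendsto_vfun isCont_tendsto_compose[OF isCont_psum[OF Bseq_hyp_coeff] tendsto_lam]) auto
    then show "((\<lambda>x. Hyp (lam x) * vfun x) \<longlongrightarrow> 1) at_bot" by simp
  qed (use DERIV_Hyp f' in auto)
  then show ?thesis using theta_pos[OF x] by (simp add: vfun_def)
qed

lemma lam_eq: "lam x = 16 * exp x * psi (exp x) ^ 4 / theta 0 x ^ 4"
proof -
  have "exp (x / 2) ^ 2 = exp x" by (simp flip: exp_double)
  then show ?thesis
    by (simp add: lam_def kmod_def power_mult_distrib power_divide flip: power_mult)
qed

lemma lam_mono:
  assumes "x < y" "y < 0"
  shows "lam x < lam y"
proof (rule DERIV_pos_imp_increasing[OF assms(1)])
  fix w assume "x \<le> w" "w \<le> y"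
  then have w: "w < 0" using assms by simp
  show "\<exists>D. (lam has_real_derivative D) (at w) \<and> D > 0"
    by (intro exI conjI, rule DERIV_lam[OF w]) (use lam_pos[OF w] lam_less_1[OF w] vfun_pos[OF w] in auto)
qed

text \<open>
  \<open>Hyp (1 - lam x) * vfun x\<close> is affine in \<open>x\<close>. The slope \<open>-1/\<pi>\<close> comes from \<open>n * hyp_coeff n \<longlonglongrightarrow> 1/\<pi>\<close>,
  and the constant term vanishes because \<open>vfun x\<close> tends to 0 as \<open>x\<close> increases to 0.
\<close>

lemma Hyp_one_minus_lam:
  assumes x: "x < 0"
  shows "Hyp (1 - lam x) = - (x / pi) * theta 0 x ^ 2"
proof -
  define f' :: "real \<Rightarrow> real" where "f' = (\<lambda>z. - (psum hyp_coeff 1 (1 - z) / (1 - z)))"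
  have f: "((\<lambda>z. Hyp (1 - z)) has_field_derivative f' z) (at z)" if "0 < z" "z < 1" for z
    unfolding f'_def by (rule DERIV_one_minus[OF DERIV_Hyp]) (use that in auto)
  have f': "((\<lambda>z. z * (1 - z) * f' z) has_field_derivative Hyp (1 - z) / 4) (at z)" if z: "0 < z" "z < 1" for z
  proof (rule has_field_derivative_transform_within_open[of _ _ _ "{0<..<1}"])
    show "((\<lambda>z. - ((1 - (1 - z)) * psum hyp_coeff 1 (1 - z))) has_field_derivative Hyp (1 - z) / 4) (at z)"
      using DERIV_minus[OF DERIV_one_minus[OF DERIV_Hyp_ODE[of "1 - z"]]] z by simp
  qed (use z in \<open>auto simp: f'_def field_simps\<close>)
  let ?r' = "\<lambda>x. lam x * (1 - lam x) * f' (lam x) / vfun x + Hyp (1 - lam x) * vfun' x"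
  obtain a b where ab: "\<And>x. x < 0 \<Longrightarrow> Hyp (1 - lam x) * vfun x = a * x + b" "\<And>x. x < 0 \<Longrightarrow> ?r' x = a"
    by (rule affine_of_second_deriv_zero[where c = 0, OF DERIV_ratio[OF f f'] DERIV_ratio'[OF f f']]) auto
  have lam_left: "filterlim (\<lambda>x. 1 - lam x) (at_left 1) at_bot"
    unfolding filterlim_at
  proof
    show "((\<lambda>x. 1 - lam x) \<longlongrightarrow> 1) at_bot"
      using tendsto_diff[OF tendsto_const tendsto_lam, of 1] by simp
    show "\<forall>\<^sub>F x in at_bot. 1 - lam x \<in> {..<1} \<and> 1 - lam x \<noteq> 1"
      using eventually_gt_at_bot[of 0] by eventually_elim (use lam_pos in force)
  qed
  have L1: "((\<lambda>x. lam x * psum hyp_coeff 1 (1 - lam x)) \<longlongrightarrow> 1 / pi) at_bot"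
  proof -
    have "psum (\<lambda>n. real n * hyp_coeff n) 0 = (psum hyp_coeff 1 :: real \<Rightarrow> real)"
      by (simp add: psum_def fun_eq_iff)
    then show ?thesis
      using filterlim_compose[OF Abel_averaging[OF tendsto_n_hyp_coeff] lam_left] by simp
  qed
  have L2: "((\<lambda>x. lam x * Hyp (1 - lam x)) \<longlongrightarrow> 0) at_bot"
    using filterlim_compose[OF Abel_averaging[OF tendsto_hyp_coeff] lam_left] by simp
  have "((\<lambda>x. ?r' x) \<longlongrightarrow> - (1 / pi)) at_bot"
  proof -
    obtain L where L: "((\<lambda>x. theta 1 x / exp x) \<longlongrightarrow> L) at_bot"
      using tendsto_psum_exp_divide[OF Bseq_phi_coeff, of 0] by (auto simp: theta_def)
    have "((\<lambda>x. - (lam x * psum hyp_coeff 1 (1 - lam x)) / vfun x +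
       (lam x * Hyp (1 - lam x)) * (- 2 * (theta 1 x / exp x) * theta 0 x / (16 * psi (exp x) ^ 4))) \<longlongrightarrow>
       - (1 / pi) / 1 + 0 * (- 2 * L * 1 / (16 * 1 ^ 4))) at_bot"
      by (intro tendsto_intros L L1 L2 tendsto_vfun tendsto_theta_0 tendsto_psi_exp) auto
    then have lim: "((\<lambda>x. - (lam x * psum hyp_coeff 1 (1 - lam x)) / vfun x +
       (lam x * Hyp (1 - lam x)) * (- 2 * (theta 1 x / exp x) * theta 0 x / (16 * psi (exp x) ^ 4))) \<longlongrightarrow> - (1 / pi)) at_bot"
      by simp
    show ?thesis
    proof (rule Lim_transform_eventually[OF lim])
      show "\<forall>\<^sub>F x in at_bot. - (lam x * psum hyp_coeff 1 (1 - lam x)) / vfun x +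
       (lam x * Hyp (1 - lam x)) * (- 2 * (theta 1 x / exp x) * theta 0 x / (16 * psi (exp x) ^ 4)) = ?r' x"
        using eventually_gt_at_bot[of 0]
      proof eventually_elim
        case (elim x)
        have p: "psi (exp x) > 0" "theta 0 x > 0" "lam x < 1"
          using psi_pos[of "exp x"] theta_pos lam_less_1 elim by auto
        have "lam x * (- 2 * (theta 1 x / exp x) * theta 0 x / (16 * psi (exp x) ^ 4)) = vfun' x"
          unfolding lam_eq vfun'_def using p by (simp add: divide_simps eval_nat_numeral)
        then have "(lam x * Hyp (1 - lam x)) * (- 2 * (theta 1 x / exp x) * theta 0 x / (16 * psi (exp x) ^ 4)) =
           Hyp (1 - lam x) * vfun' x"
          by (metis mult.assoc mult.commute)
        moreover have "lam x * (1 - lam x) * f' (lam x) = - (lam x * psum hyp_coeff 1 (1 - lam x))"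
          using p by (simp add: f'_def)
        ultimately show ?case by simp
      qed
    qed
  qed
  moreover have "((\<lambda>x. ?r' x) \<longlongrightarrow> a) at_bot"
    by (rule Lim_transform_eventually[OF tendsto_const])
       (use eventually_gt_at_bot[of 0] in eventually_elim, simp add: ab(2))
  ultimately have a: "a = - (1 / pi)"
    by (intro tendsto_unique[OF trivial_limit_at_bot_linorder])
  have r: "Hyp (1 - lam x) * vfun x = - x / pi + b" if "x < 0" for x
    using ab(1)[OF that] by (simp add: a)
  have b0: "b \<ge> 0"
  proof (rule tendsto_lowerbound)
    show "((\<lambda>x. - x / pi + b) \<longlongrightarrow> b) (at_left 0)"
      by (auto intro!: tendsto_eq_intros)
    show "\<forall>\<^sub>F x in at_left 0. 0 \<le> - x / pi + b"
      unfolding eventually_at_filter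
    proof (intro always_eventually allI impI)
      fix x :: real assume "x \<noteq> 0" "x \<in> {..<0}"
      then have x: "x < 0" by simp
      have "0 \<le> Hyp (1 - lam x) * vfun x"
        using Hyp_ge_1[of "1 - lam x"] lam_pos[OF x] lam_less_1[OF x] vfun_pos[OF x] by auto
      then show "0 \<le> - x / pi + b" using r[OF x] by simp
    qed
  qed simp
  \<comment> \<open>The partial sum s of theta equals 2n + 1 at x = 0 and bounds theta from below,
    so v is at most 1 / s^2. The point -1 only serves to keep lam away from 0 on an interval ending
    at 0. Letting n grow gives b <= 0.\<close>
  have bn: "b \<le> 1 / lam (- 1) * (1 / (2 * real n + 1) ^ 2)" for n
  proof -
    define s where "s = (\<lambda>x::real. \<Sum>r<Suc n. (if r = 0 then 1 else 2) * exp x ^ (r\<^sup>2))"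
    have s0: "s 0 = 2 * real n + 1"
      unfolding s_def by (subst sum.lessThan_Suc_shift) simp
    have sc: "isCont s 0"
      unfolding s_def by (intro continuous_intros)
    have s_pos: "s x > 0" for x
    proof -
      have "s x \<ge> 1" unfolding s_def by (subst sum.lessThan_Suc_shift) (auto intro!: sum_nonneg)
      then show ?thesis by simp
    qed
    have le: "- x / pi + b \<le> 1 / lam (- 1) * (1 / s x ^ 2)" if x: "-1 < x" "x < 0" for x
    proof -
      have "- x / pi + b = Hyp (1 - lam x) * vfun x" using r x by simp
      also have "\<dots> \<le> 1 / lam x * vfun x"
        using Hyp_le[of "1 - lam x"] lam_pos lam_less_1 vfun_pos[of x] x
        by (intro mult_right_mono) (auto simp: less_imp_le)
      also have "\<dots> \<le> 1 / lam (- 1) * (1 / s x ^ 2)"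
      proof (rule mult_mono)
        show "1 / lam x \<le> 1 / lam (- 1)"
          using lam_mono[of "- 1" x] x lam_pos by (intro divide_left_mono) auto
        have "s x \<le> theta 0 x"
          using sum_le_phi[of "exp x" "Suc n"] x by (simp only: s_def theta_def) simp
        then show "vfun x \<le> 1 / s x ^ 2"
          unfolding vfun_def using s_pos[of x] by (intro divide_left_mono power_mono mult_pos_pos) auto
      qed (use x vfun_pos[of x] lam_pos[of "- 1"] in auto)
      finally show ?thesis .
    qed
    show ?thesis
    proof (rule tendsto_le)
      show "((\<lambda>x. - x / pi + b) \<longlongrightarrow> b) (at_left 0)"
        by (auto intro!: tendsto_eq_intros)
      have "((\<lambda>x. 1 / lam (- 1) * (1 / s x ^ 2)) \<longlongrightarrow> 1 / lam (- 1) * (1 / s 0 ^ 2)) (at_left 0)"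
        by (intro tendsto_intros isCont_tendsto_compose[OF sc]) (use s_pos[of 0] in auto)
      then show "((\<lambda>x. 1 / lam (- 1) * (1 / s x ^ 2)) \<longlongrightarrow> 1 / lam (- 1) * (1 / (2 * real n + 1) ^ 2)) (at_left 0)"
        by (simp only: s0)
      have "\<forall>\<^sub>F x in at_left (0::real). - 1 < x"
        by (rule order_tendstoD[OF tendsto_ident_at]) auto
      moreover have "\<forall>\<^sub>F x in at_left (0::real). x < 0"
        by (simp add: eventually_at_filter)
      ultimately show "\<forall>\<^sub>F x in at_left 0. - x / pi + b \<le> 1 / lam (- 1) * (1 / s x ^ 2)"
        by eventually_elim (rule le)
    qed simp
  qed
  have "b \<le> 0"
  proof (rule tendsto_lowerbound)
    have "((\<lambda>n. 1 / (2 * real n + 1) ^ 2) \<longlongrightarrow> 0) sequentially"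
      by real_asymp
    from tendsto_mult_left[OF this, of "1 / lam (- 1)"]
    show "(\<lambda>n. 1 / lam (- 1) * (1 / (2 * real n + 1) ^ 2)) \<longlonglongrightarrow> 0" by simp
  qed (use bn in auto)
  with b0 have "Hyp (1 - lam x) * vfun x = - x / pi"
    using r[OF x] by simp
  then show ?thesis using theta_pos[OF x] by (simp add: vfun_def field_simps)
qed

text \<open>Multiplying the affine relations at x and at y = pi^2 / x gives Hyp(1 - lam x) Hyp(1 -
  lam y) = Hyp(lam x) Hyp(lam y), as (x / pi) (y / pi) = 1. \<open>Hyp\<close> is strictly
  increasing, so either strict inequality between lam y and 1 - lam x would unbalance the two
  products.\<close>

lemma
  assumes x: "x < 0"
  shows lam_inversion: "lam (pi\<^sup>2 / x) = 1 - lam x"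
    and theta_inversion: "theta 0 (pi\<^sup>2 / x) ^ 2 = - (x / pi) * theta 0 x ^ 2"
proof -
  define y where "y = pi\<^sup>2 / x"
  have y: "y < 0" using x by (simp add: y_def divide_pos_neg)
  have l: "0 < lam x" "lam x < 1" "0 < lam y" "lam y < 1"
    using lam_pos lam_less_1 x y by auto
  have h: "Hyp (lam x) > 0" "Hyp (lam y) > 0" "Hyp (1 - lam x) > 0" "Hyp (1 - lam y) > 0"
    using Hyp_ge_1[of "lam x"] Hyp_ge_1[of "lam y"] Hyp_ge_1[of "1 - lam x"] Hyp_ge_1[of "1 - lam y"] l by auto
  have "Hyp (1 - lam x) * Hyp (1 - lam y) = (x / pi * (y / pi)) * (Hyp (lam x) * Hyp (lam y))"
    using Hyp_one_minus_lam[OF x] Hyp_one_minus_lam[OF y] Hyp_lam[OF x] Hyp_lam[OF y] by simp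
  also have "x / pi * (y / pi) = 1" using x by (simp add: y_def power2_eq_square)
  finally have eq: "Hyp (1 - lam x) * Hyp (1 - lam y) = Hyp (lam x) * Hyp (lam y)" by simp
  have "\<not> lam y < 1 - lam x"
  proof
    assume "lam y < 1 - lam x"
    then have "Hyp (lam y) < Hyp (1 - lam x)" "Hyp (lam x) < Hyp (1 - lam y)"
      using l by (auto intro!: Hyp_less)
    then have "Hyp (lam x) * Hyp (lam y) < Hyp (1 - lam y) * Hyp (1 - lam x)"
      using h by (intro mult_strict_mono) auto
    then show False using eq by (simp add: mult.commute)
  qed
  moreover have "\<not> 1 - lam x < lam y"
  proof
    assume "1 - lam x < lam y"
    then have "Hyp (1 - lam x) < Hyp (lam y)" "Hyp (1 - lam y) < Hyp (lam x)"
      using l by (auto intro!: Hyp_less)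
    then have "Hyp (1 - lam x) * Hyp (1 - lam y) < Hyp (lam y) * Hyp (lam x)"
      using h by (intro mult_strict_mono) auto
    then show False using eq by (simp add: mult.commute)
  qed
  ultimately have lam: "lam y = 1 - lam x" by simp
  then show "lam (pi\<^sup>2 / x) = 1 - lam x" by (simp add: y_def)
  show "theta 0 (pi\<^sup>2 / x) ^ 2 = - (x / pi) * theta 0 x ^ 2"
    using Hyp_lam[OF y] Hyp_one_minus_lam[OF x] lam by (simp add: y_def)
qed

section \<open>The level-two function and its hypergeometric series\<close>

definition Afun :: "real \<Rightarrow> real" where "Afun x = (1 + lam x) / vfun x ^ 2"

definition Afun' :: "real \<Rightarrow> real" where
  "Afun' x = lam x * (1 - lam x) / vfun x ^ 4 - 2 * (1 + lam x) * vfun' x / vfun x ^ 3"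

definition alpha :: "real \<Rightarrow> real" where "alpha x = 4 * lam x / (1 + lam x) ^ 2"

lemma Afun_pos: "x < 0 \<Longrightarrow> Afun x > 0"
  using lam_pos[of x] vfun_pos[of x] by (simp add: Afun_def)

lemma one_minus_alpha: "x < 0 \<Longrightarrow> 1 - alpha x = (1 - lam x) ^ 2 / (1 + lam x) ^ 2"
  using lam_pos[of x] by (simp add: alpha_def divide_simps) algebra

lemma alpha_pos: "x < 0 \<Longrightarrow> alpha x > 0"
  using lam_pos[of x] by (simp add: alpha_def)

lemma alpha_less_1: "x < 0 \<Longrightarrow> alpha x < 1"
  using one_minus_alpha[of x] lam_pos[of x] lam_less_1[of x] by (smt (verit) divide_pos_pos zero_less_power)

lemma DERIV_Afun:
  assumes x: "x < 0"
  shows "(Afun has_field_derivative Afun' x) (at x)"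
  unfolding Afun_def[abs_def] Afun'_def
  using vfun_pos[OF x]
  by (auto intro!: derivative_eq_intros DERIV_lam[OF x] DERIV_vfun[OF x] simp: divide_simps) algebra

lemma DERIV_Afun'_aux:
  fixes l v w :: "real \<Rightarrow> real"
  assumes l: "(l has_field_derivative l x * (1 - l x) / v x ^ 2) (at x)"
    and v: "(v has_field_derivative w x) (at x)"
    and w: "(w has_field_derivative - (l x * (1 - l x) / (4 * v x ^ 3))) (at x)"
    and nz: "v x \<noteq> 0"
  shows "((\<lambda>x. l x * (1 - l x) / v x ^ 4 - 2 * (1 + l x) * w x / v x ^ 3) has_field_derivative
     3 / 2 * l x * (1 - l x) ^ 2 / v x ^ 6 - 6 * l x * (1 - l x) * w x / v x ^ 5 + 6 * (1 + l x) * w x ^ 2 / v x ^ 4) (at x)"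
  by (rule derivative_eq_intros l v w refl | use nz in force)+ (use nz in \<open>simp add: divide_simps\<close>, algebra)

text \<open>This is y'' = - 3/16 alpha (1 - alpha) A^2 y for y = A^(-1/2), solved for the second
  derivative of A.\<close>

lemma DERIV_Afun':
  assumes x: "x < 0"
  shows "(Afun' has_field_derivative
           (3 * Afun' x ^ 2 + 3 / 4 * (alpha x * (1 - alpha x)) * Afun x ^ 4) / (2 * Afun x)) (at x)"
proof -
  define l v w where "l = lam x" and "v = vfun x" and "w = vfun' x"
  have l: "1 + l > 0" and v: "v > 0"
    using lam_pos[OF x] vfun_pos[OF x] by (auto simp: l_def v_def)
  have D: "(Afun' has_field_derivative
     3 / 2 * l * (1 - l) ^ 2 / v ^ 6 - 6 * l * (1 - l) * w / v ^ 5 + 6 * (1 + l) * w ^ 2 / v ^ 4) (at x)"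
    unfolding Afun'_def[abs_def] l_def v_def w_def
    by (rule DERIV_Afun'_aux[where l = lam and v = vfun and w = vfun', OF DERIV_lam[OF x] DERIV_vfun[OF x]])
       (use DERIV_vfun'[OF x] vfun''_eq[OF x] vfun_pos[OF x] in auto)
  have c: "alpha x * (1 - alpha x) = 4 * l * (1 - l) ^ 2 / (1 + l) ^ 4"
    unfolding one_minus_alpha[OF x] by (simp add: alpha_def l_def flip: power_add)
  have A4: "alpha x * (1 - alpha x) * Afun x ^ 4 = 4 * l * (1 - l) ^ 2 / v ^ 8"
    unfolding c Afun_def l_def[symmetric] v_def[symmetric] using l v by (simp add: power_divide flip: power_mult)
  have "3 / 2 * l * (1 - l) ^ 2 / v ^ 6 - 6 * l * (1 - l) * w / v ^ 5 + 6 * (1 + l) * w ^ 2 / v ^ 4 =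
     (3 * Afun' x ^ 2 + 3 / 4 * (4 * l * (1 - l) ^ 2 / v ^ 8)) / (2 * Afun x)"
    unfolding Afun'_def Afun_def l_def[symmetric] v_def[symmetric] w_def[symmetric]
    using l v by (simp add: divide_simps) algebra
  with D show ?thesis using A4 by (simp add: mult.assoc)
qed

lemma DERIV_alpha:
  assumes x: "x < 0"
  shows "(alpha has_field_derivative alpha x * (1 - alpha x) * Afun x) (at x)"
proof -
  have l: "1 + lam x > 0" and v: "vfun x > 0"
    using lam_pos[OF x] vfun_pos[OF x] by auto
  have "(alpha has_field_derivative 4 * (lam x * (1 - lam x) / vfun x ^ 2) * (1 - lam x) / (1 + lam x) ^ 3) (at x)"
    unfolding alpha_def[abs_def] by (rule DERIV_Landen[OF DERIV_lam[OF x]]) (use l in auto)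
  then show ?thesis
    by (rule DERIV_cong)
       (unfold one_minus_alpha[OF x], use l v in \<open>simp add: alpha_def Afun_def divide_simps\<close>, algebra)
qed

text \<open>As 2 pi^2 / x = pi^2 / (x / 2), the inversion of theta leads to the point x / 2, with 2
  - lam arising as 1 + (1 - lam). Landen's transformation brings these expressions back to
  x.\<close>

lemma lam_theta_half:
  assumes x: "x < 0"
  defines "l \<equiv> lam (x / 2)" and "t \<equiv> theta 0 (x / 2)"
  shows "t ^ 4 * (2 - l) = 2 * Afun x" "4 * (1 - l) / (2 - l) ^ 2 = 1 - alpha x"
proof -
  define K where "K = kmod x"
  define U where "U = theta 0 x"
  have K: "K > 0" "U > 0" using kmod_pos[OF x] theta_pos[OF x] by (auto simp: K_def U_def)
  have x2: "x / 2 < 0" using x by simp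
  have l: "l = 4 * K / (1 + K) ^ 2"
    using lam_double[OF x2] by (simp add: l_def K_def)
  have t: "t ^ 4 = (U\<^sup>2 * (1 + K)) ^ 2"
    using theta_double[OF x2] by (simp add: t_def U_def K_def flip: power_mult)
       (metis (no_types) mult_2 numeral_Bit0 power_mult power2_eq_square power_add)
  have l2: "2 - l = 2 * (1 + K\<^sup>2) / (1 + K) ^ 2" and l1: "1 - l = (1 - K) ^ 2 / (1 + K) ^ 2"
    unfolding l using K by (simp add: divide_simps, algebra)+
  have A: "Afun x = U ^ 4 * (1 + K\<^sup>2)"
    by (simp add: Afun_def lam_def K_def U_def theta_power4)
  show "t ^ 4 * (2 - l) = 2 * Afun x"
    unfolding t l2 A using K by (simp add: divide_simps)
  have K2: "1 + K\<^sup>2 > 0" by (simp add: add_pos_nonneg)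
  have a: "1 - alpha x = (1 - K\<^sup>2) ^ 2 / (1 + K\<^sup>2) ^ 2"
    unfolding one_minus_alpha[OF x] by (simp add: lam_def K_def)
  have "4 * ((1 - K) ^ 2 / (1 + K) ^ 2) / (2 * (1 + K\<^sup>2) / (1 + K) ^ 2) ^ 2 = ((1 - K) * (1 + K)) ^ 2 / (1 + K\<^sup>2) ^ 2"
    using K K2 by (simp add: power_mult_distrib power_divide) (simp add: divide_simps, algebra)
  also have "(1 - K) * (1 + K) = 1 - K\<^sup>2" by algebra
  finally show "4 * (1 - l) / (2 - l) ^ 2 = 1 - alpha x"
    unfolding l2 l1 a .
qed

lemma
  assumes x: "x < 0"
  shows Afun_Fricke: "Afun (2 * pi\<^sup>2 / x) = x\<^sup>2 / (2 * pi\<^sup>2) * Afun x"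
    and alpha_Fricke: "alpha (2 * pi\<^sup>2 / x) = 1 - alpha x"
proof -
  define y where "y = x / 2"
  have y: "y < 0" using x by (simp add: y_def)
  have e: "2 * pi\<^sup>2 / x = pi\<^sup>2 / y" by (simp add: y_def)
  have "Afun (pi\<^sup>2 / y) = theta 0 (pi\<^sup>2 / y) ^ 4 * (1 + lam (pi\<^sup>2 / y))"
    by (simp add: Afun_def theta_power4)
  also have "theta 0 (pi\<^sup>2 / y) ^ 4 = (theta 0 (pi\<^sup>2 / y) ^ 2) ^ 2"
    by simp
  also have "\<dots> = (y / pi) ^ 2 * theta 0 y ^ 4"
    unfolding theta_inversion[OF y] by (simp add: power_mult_distrib power_divide flip: power_mult)
  also have "1 + lam (pi\<^sup>2 / y) = 2 - lam y"
    unfolding lam_inversion[OF y] by simp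
  finally show "Afun (2 * pi\<^sup>2 / x) = x\<^sup>2 / (2 * pi\<^sup>2) * Afun x"
    using lam_theta_half(1)[OF x] unfolding e by (simp add: y_def power_divide mult.assoc)
  show "alpha (2 * pi\<^sup>2 / x) = 1 - alpha x"
    using lam_theta_half(2)[OF x] unfolding e alpha_def[of "pi\<^sup>2 / y"] lam_inversion[OF y] by (simp add: y_def)
qed

text \<open>At the fixed point -pi sqrt 2 of the inversion, alpha = 1 - alpha = 1/2, and alpha is
  increasing.\<close>

lemma alpha_less_half:
  assumes x: "x < - pi * sqrt 2"
  shows "alpha x < 1 / 2"
proof -
  define c where "c = - pi * sqrt 2"
  have c: "c < 0" by (simp add: c_def)
  have "2 * pi\<^sup>2 / c = c" by (simp add: c_def field_simps power2_eq_square)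
  then have "alpha c = 1 / 2" using alpha_Fricke[OF c] by simp
  moreover have xc: "x < c" using x by (simp add: c_def)
  have "alpha x < alpha c"
  proof (rule DERIV_pos_imp_increasing[OF xc])
    fix w assume "x \<le> w" "w \<le> c"
    then have w: "w < 0" using c by simp
    show "\<exists>D. (alpha has_real_derivative D) (at w) \<and> D > 0"
      by (intro exI conjI, rule DERIV_alpha[OF w])
         (use alpha_pos[OF w] alpha_less_1[OF w] Afun_pos[OF w] in auto)
  qed
  ultimately show ?thesis by simp
qed

lemma Afun'_Fricke:
  assumes x: "x < 0"
  shows "Afun' (2 * pi\<^sup>2 / x) * (2 * pi\<^sup>2 / x\<^sup>2) = - (x / pi\<^sup>2 * Afun x + x\<^sup>2 / (2 * pi\<^sup>2) * Afun' x)"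
proof -
  have y: "2 * pi\<^sup>2 / x < 0" using x by (simp add: divide_pos_neg)
  have D: "((\<lambda>x. 2 * pi\<^sup>2 / x) has_field_derivative - (2 * pi\<^sup>2 / x\<^sup>2)) (at x)"
    using x by (auto intro!: derivative_eq_intros simp: power2_eq_square)
  have "((\<lambda>x. Afun (2 * pi\<^sup>2 / x)) has_field_derivative Afun' (2 * pi\<^sup>2 / x) * - (2 * pi\<^sup>2 / x\<^sup>2)) (at x)"
    by (rule DERIV_chain2[OF DERIV_Afun[OF y] D])
  moreover have "((\<lambda>x. x\<^sup>2 / (2 * pi\<^sup>2) * Afun x) has_field_derivative
      x / pi\<^sup>2 * Afun x + x\<^sup>2 / (2 * pi\<^sup>2) * Afun' x) (at x)"
    by (auto intro!: derivative_eq_intros DERIV_Afun[OF x] simp: field_simps eval_nat_numeral)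
  ultimately have "Afun' (2 * pi\<^sup>2 / x) * - (2 * pi\<^sup>2 / x\<^sup>2) = x / pi\<^sup>2 * Afun x + x\<^sup>2 / (2 * pi\<^sup>2) * Afun' x"
    by (rule DERIV_unique_neg[OF _ _ Afun_Fricke x])
  then show ?thesis by simp
qed

section \<open>The coefficients of 3F2(1/2, 1/4, 3/4; 1, 1)\<close>

definition ram_coeff :: "nat \<Rightarrow> real" where
  "ram_coeff n = pochhammer (1/2) n * pochhammer (1/4) n * pochhammer (3/4) n / fact n ^ 3"

lemma ram_coeff_0 [simp]: "ram_coeff 0 = 1"
  by (simp add: ram_coeff_def)

lemma ram_coeff_nonneg: "ram_coeff n \<ge> 0"
  unfolding ram_coeff_def by (intro divide_nonneg_nonneg mult_nonneg_nonneg pochhammer_nonneg) auto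

lemma ram_coeff_Suc:
  "real (Suc n) ^ 3 * ram_coeff (Suc n) = (real n + 1 / 2) * (real n + 1 / 4) * (real n + 3 / 4) * ram_coeff n"
proof -
  have "fact (Suc n) ^ 3 = real (Suc n) ^ 3 * fact n ^ 3"
    by (simp add: power_mult_distrib)
  then have "real (Suc n) ^ 3 * ram_coeff (Suc n) =
     (pochhammer (1/2) (Suc n) * pochhammer (1/4) (Suc n) * pochhammer (3/4) (Suc n)) / fact n ^ 3"
    unfolding ram_coeff_def by (simp del: of_nat_Suc fact_Suc)
  also have "\<dots> = (real n + 1 / 2) * (real n + 1 / 4) * (real n + 3 / 4) * ram_coeff n"
    unfolding ram_coeff_def pochhammer_Suc by (simp add: mult_ac add.commute)
  finally show ?thesis .
qed

lemma ram_coeff_le_1: "ram_coeff n \<le> 1"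
proof (induction n)
  case (Suc n)
  have "real (Suc n) ^ 3 * ram_coeff (Suc n) \<le> (real (Suc n) * real (Suc n) * real (Suc n)) * 1"
    unfolding ram_coeff_Suc using Suc ram_coeff_nonneg[of n] by (intro mult_mono) auto
  then show ?case by (simp add: power3_eq_cube del: of_nat_Suc)
qed simp

lemma Bseq_ram_coeff: "Bseq ram_coeff"
  using ram_coeff_nonneg ram_coeff_le_1 by (intro BseqI'[of _ 1]) auto

text \<open>The constants come from (m + 1/2) (m + 1/4) (m + 3/4) = m^3 + 3/2 m^2 + 11/16 m +
  3/32.\<close>

lemma ram_ODE:
  assumes z: "\<bar>z::real\<bar> < 1"
  shows "psum ram_coeff 3 z = z * (psum ram_coeff 3 z + 3 / 2 * psum ram_coeff 2 z +
           11 / 16 * psum ram_coeff 1 z + 3 / 32 * psum ram_coeff 0 z)"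
proof -
  have s: "(\<lambda>m. real m ^ j * ram_coeff m * z ^ m) sums psum ram_coeff j z" for j
    using psum_sums[OF Bseq_ram_coeff, of z j] z by simp
  have "(\<lambda>m. z * (real m ^ 3 * ram_coeff m * z ^ m + 3 / 2 * (real m ^ 2 * ram_coeff m * z ^ m) +
       11 / 16 * (real m ^ 1 * ram_coeff m * z ^ m) + 3 / 32 * (real m ^ 0 * ram_coeff m * z ^ m)))
      sums (z * (psum ram_coeff 3 z + 3 / 2 * psum ram_coeff 2 z +
           11 / 16 * psum ram_coeff 1 z + 3 / 32 * psum ram_coeff 0 z))"
    by (intro sums_mult sums_add s)
  also have "(\<lambda>m. z * (real m ^ 3 * ram_coeff m * z ^ m + 3 / 2 * (real m ^ 2 * ram_coeff m * z ^ m) +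
       11 / 16 * (real m ^ 1 * ram_coeff m * z ^ m) + 3 / 32 * (real m ^ 0 * ram_coeff m * z ^ m))) =
     (\<lambda>m. real (Suc m) ^ 3 * ram_coeff (Suc m) * z ^ Suc m)"
    unfolding ram_coeff_Suc by (auto simp: fun_eq_iff power2_eq_square power3_eq_cube field_simps)
  finally show ?thesis
    using s[of 3] by (subst (asm) sums_Suc_iff) (auto simp: sums_iff)
qed

text \<open>
  Since \<open>A^(-1/2)\<close> satisfies \<open>y'' = - 3/16 \<alpha> (1 - \<alpha>) A\<^sup>2 y\<close>, every solution of the third-order
  hypergeometric equation in \<open>X\<close> is \<open>A\<close> times a quadratic polynomial in \<open>x\<close>.
\<close>

lemma third_derivative_vanishes_aux:
  fixes A s b c :: "real \<Rightarrow> real" and g :: "nat \<Rightarrow> real \<Rightarrow> real"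
  assumes A: "(A has_field_derivative s x) (at x)"
    and s: "(s has_field_derivative (3 * s x ^ 2 + 3 / 4 * c x * A x ^ 4) / (2 * A x)) (at x)"
    and b: "(b has_field_derivative - 2 * c x * A x) (at x)"
    and c: "(c has_field_derivative b x * c x * A x) (at x)"
    and g: "\<And>j. (g j has_field_derivative b x * A x * g (Suc j) x) (at x)"
    and ODE: "b x ^ 2 * g 3 x = 4 * c x * (3 / 2 * g 2 x + 11 / 16 * g 1 x + 3 / 32 * g 0 x)"
    and nz: "A x \<noteq> 0"
  shows "((\<lambda>x. g 0 x / A x) has_field_derivative (b x * g 1 x - g 0 x * s x / A x ^ 2)) (at x)"
    "((\<lambda>x. b x * g 1 x - g 0 x * s x / A x ^ 2) has_field_derivative
        (b x ^ 2 * A x * g 2 x - (2 * c x * A x + b x * s x / A x) * g 1 x +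
         (s x ^ 2 / (2 * A x ^ 3) - 3 / 8 * c x * A x) * g 0 x)) (at x)"
    "((\<lambda>x. b x ^ 2 * A x * g 2 x - (2 * c x * A x + b x * s x / A x) * g 1 x +
         (s x ^ 2 / (2 * A x ^ 3) - 3 / 8 * c x * A x) * g 0 x) has_field_derivative 0) (at x)"
proof -
  have g0: "(g 0 has_field_derivative b x * A x * g 1 x) (at x)"
    and g1: "(g 1 has_field_derivative b x * A x * g 2 x) (at x)"
    and g2: "(g 2 has_field_derivative b x * A x * g 3 x) (at x)"
    using g[of 0] g[of 1] g[of 2] by (simp_all add: numeral_2_eq_2 numeral_3_eq_3)
  show "((\<lambda>x. g 0 x / A x) has_field_derivative (b x * g 1 x - g 0 x * s x / A x ^ 2)) (at x)"
    by (rule derivative_eq_intros A s b c g0 g1 g2 refl nz)+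
       (use nz in \<open>simp add: divide_simps power2_eq_square\<close>)
  show "((\<lambda>x. b x * g 1 x - g 0 x * s x / A x ^ 2) has_field_derivative
        (b x ^ 2 * A x * g 2 x - (2 * c x * A x + b x * s x / A x) * g 1 x +
         (s x ^ 2 / (2 * A x ^ 3) - 3 / 8 * c x * A x) * g 0 x)) (at x)"
    by (rule derivative_eq_intros A s b c g0 g1 g2 refl | use nz in force)+
       (use nz in \<open>simp add: divide_simps\<close>, algebra)
  \<comment> \<open>All terms containing s cancel; what remains is b A^2 times the difference of the
    two sides of \<open>ODE\<close>.\<close>
  have "((\<lambda>x. b x ^ 2 * A x * g 2 x - (2 * c x * A x + b x * s x / A x) * g 1 x +
         (s x ^ 2 / (2 * A x ^ 3) - 3 / 8 * c x * A x) * g 0 x) has_field_derivative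
      b x * A x ^ 2 * (b x ^ 2 * g 3 x) - 6 * b x * c x * A x ^ 2 * g 2 x
      - 11 / 4 * b x * c x * A x ^ 2 * g 1 x - 3 / 8 * b x * c x * A x ^ 2 * g 0 x) (at x)"
    by (rule derivative_eq_intros A s b c g0 g1 g2 refl | use nz in force)+
       (use nz in \<open>simp add: divide_simps\<close>, algebra)
  then show "((\<lambda>x. b x ^ 2 * A x * g 2 x - (2 * c x * A x + b x * s x / A x) * g 1 x +
         (s x ^ 2 / (2 * A x ^ 3) - 3 / 8 * c x * A x) * g 0 x) has_field_derivative 0) (at x)"
    unfolding ODE by (rule DERIV_cong) (simp add: algebra_simps)
qed


definition Xfun :: "real \<Rightarrow> real" where "Xfun x = 4 * (alpha x * (1 - alpha x))"

lemma Xfun_bounds: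
  assumes x: "x < - pi * sqrt 2"
  shows "0 < Xfun x" "Xfun x < 1"
proof -
  have x0: "x < 0" using x by (smt (verit) mult_neg_pos pi_gt_zero real_sqrt_gt_zero)
  show "0 < Xfun x" using alpha_pos[OF x0] alpha_less_1[OF x0] by (simp add: Xfun_def)
  have "1 - Xfun x = (1 - 2 * alpha x) ^ 2" by (simp add: Xfun_def power2_eq_square algebra_simps)
  moreover have "(1 - 2 * alpha x) ^ 2 > 0" using alpha_less_half[OF x] by simp
  ultimately show "Xfun x < 1" by linarith
qed

text \<open>For these x one has 0 < X < 1, so the series converges and solves its equation. The
  ratio of the series to A tends to 1 at -infinity, which fixes the quadratic polynomial as the
  constant 1.\<close>

lemma
  assumes x: "x < - pi * sqrt 2"
  shows psum_ram_coeff_Xfun: "psum ram_coeff 0 (Xfun x) = Afun x"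
    and psum_ram_coeff_1_Xfun: "(1 - 2 * alpha x) * psum ram_coeff 1 (Xfun x) = Afun' x / Afun x"
proof -
  let ?c0 = "- pi * sqrt 2"
  define b where "b = (\<lambda>x. 1 - 2 * alpha x)"
  define c where "c = (\<lambda>x. alpha x * (1 - alpha x))"
  define g where "g = (\<lambda>j x. psum ram_coeff j (Xfun x))"
  have neg: "y < 0" if "y < ?c0" for y :: real
    using that by (smt (verit) mult_neg_pos pi_gt_zero real_sqrt_gt_zero)
  have D: "(Afun has_field_derivative Afun' y) (at y)"
    "(Afun' has_field_derivative (3 * Afun' y ^ 2 + 3 / 4 * c y * Afun y ^ 4) / (2 * Afun y)) (at y)"
    "(b has_field_derivative - 2 * c y * Afun y) (at y)"
    "(c has_field_derivative b y * c y * Afun y) (at y)"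
    "\<And>j. (g j has_field_derivative b y * Afun y * g (Suc j) y) (at y)"
    "b y ^ 2 * g 3 y = 4 * c y * (3 / 2 * g 2 y + 11 / 16 * g 1 y + 3 / 32 * g 0 y)"
    "Afun y \<noteq> 0" if y: "y < ?c0" for y
  proof -
    have y0: "y < 0" by (rule neg[OF y])
    show "(Afun has_field_derivative Afun' y) (at y)" by (rule DERIV_Afun[OF y0])
    show "(Afun' has_field_derivative (3 * Afun' y ^ 2 + 3 / 4 * c y * Afun y ^ 4) / (2 * Afun y)) (at y)"
      using DERIV_Afun'[OF y0] by (simp add: c_def)
    show "(b has_field_derivative - 2 * c y * Afun y) (at y)"
      unfolding b_def c_def by (auto intro!: derivative_eq_intros DERIV_alpha[OF y0])
    show Dc: "(c has_field_derivative b y * c y * Afun y) (at y)"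
      unfolding b_def c_def by (auto intro!: derivative_eq_intros DERIV_alpha[OF y0] simp: algebra_simps)
    have "(Xfun has_field_derivative 4 * (b y * c y * Afun y)) (at y)"
      using DERIV_cmult[OF Dc, of 4] by (simp add: Xfun_def[abs_def] c_def)
    then have DX: "(Xfun has_field_derivative b y * Afun y * Xfun y) (at y)"
      by (rule DERIV_cong) (simp add: Xfun_def c_def)
    show "(g j has_field_derivative b y * Afun y * g (Suc j) y) (at y)" for j
    proof -
      have "(g j has_field_derivative psum ram_coeff (Suc j) (Xfun y) / Xfun y * (b y * Afun y * Xfun y)) (at y)"
        unfolding g_def by (rule DERIV_chain2[OF DERIV_psum[OF Bseq_ram_coeff] DX]) (use Xfun_bounds[OF y] in auto)
      then show ?thesis by (rule DERIV_cong) (use Xfun_bounds[OF y] in \<open>simp add: g_def\<close>)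
    qed
    have "b y ^ 2 = 1 - Xfun y" by (simp add: b_def Xfun_def power2_eq_square algebra_simps)
    then have "b y ^ 2 * g 3 y = g 3 y - Xfun y * g 3 y" by (simp only: left_diff_distrib mult_1_left)
    also have "\<dots> = Xfun y * (3 / 2 * g 2 y + 11 / 16 * g 1 y + 3 / 32 * g 0 y)"
      using ram_ODE[of "Xfun y"] Xfun_bounds[OF y] unfolding g_def by (simp add: algebra_simps)
    finally show "b y ^ 2 * g 3 y = 4 * c y * (3 / 2 * g 2 y + 11 / 16 * g 1 y + 3 / 32 * g 0 y)"
      by (simp add: Xfun_def c_def)
    show "Afun y \<noteq> 0" using Afun_pos[OF y0] by simp
  qed
  have eq: "g 0 y = Afun y" if y: "y < ?c0" for y
  proof -
    have "g 0 y / Afun y = 1"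
    proof (rule eq_limit_of_third_deriv_zero[OF third_derivative_vanishes_aux(1)[where c = c, OF D]
          third_derivative_vanishes_aux(2)[where c = c, OF D] third_derivative_vanishes_aux(3)[where c = c, OF D] _ y])
      have A: "(Afun \<longlongrightarrow> 1) at_bot"
      proof -
        have "((\<lambda>x. (1 + lam x) / vfun x ^ 2) \<longlongrightarrow> (1 + 0) / 1 ^ 2) at_bot"
          by (intro tendsto_intros tendsto_lam tendsto_vfun) auto
        then show ?thesis by (simp add: Afun_def[abs_def])
      qed
      have "((\<lambda>x. 4 * lam x / (1 + lam x) ^ 2) \<longlongrightarrow> 4 * 0 / (1 + 0) ^ 2) at_bot"
        by (intro tendsto_intros tendsto_lam) auto
      then have "(alpha \<longlongrightarrow> 0) at_bot" by (simp add: alpha_def[abs_def])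
      then have "((\<lambda>x. 4 * (alpha x * (1 - alpha x))) \<longlongrightarrow> 4 * (0 * (1 - 0))) at_bot"
        by (intro tendsto_intros)
      then have "(Xfun \<longlongrightarrow> 0) at_bot" by (simp add: Xfun_def[abs_def])
      then have "(g 0 \<longlongrightarrow> psum ram_coeff 0 0) at_bot"
        unfolding g_def by (intro isCont_tendsto_compose[OF isCont_psum[OF Bseq_ram_coeff]]) auto
      then show "((\<lambda>x. g 0 x / Afun x) \<longlongrightarrow> 1) at_bot"
        using tendsto_divide[OF _ A] by fastforce
    qed auto
    then show ?thesis using D(7)[OF y] by simp
  qed
  show "psum ram_coeff 0 (Xfun x) = Afun x"
    using eq[OF x] by (simp add: g_def)
  \<comment> \<open>Differentiating A = 3F2(X) with X' = (1 - 2 alpha) A X yields the series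
    weighted by k; the factor 1 - 2 alpha is the b_N of the theorem.\<close>
  have "(Afun has_field_derivative b x * Afun x * g (Suc 0) x) (at x)"
    by (rule has_field_derivative_transform_within_open[OF D(5)[OF x], of "{..<?c0}"]) (use x eq in auto)
  then have "Afun' x = b x * Afun x * g (Suc 0) x"
    by (rule DERIV_unique[OF D(1)[OF x]])
  then show "(1 - 2 * alpha x) * psum ram_coeff 1 (Xfun x) = Afun' x / Afun x"
    using D(7)[OF x] by (simp add: b_def g_def)
qed

section \<open>Eta quotients and the series\<close>

lemma dedekind_eta_eprod:
  "dedekind_eta \<tau> = exp (of_real pi * \<i> * \<tau> / 12) * eprod (exp (2 * of_real pi * \<i> * \<tau>))"
proof -
  have "exp (2 * of_real pi * \<i> * of_nat (Suc k) * \<tau>) = exp (2 * of_real pi * \<i> * \<tau>) ^ Suc k" for k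
    unfolding exp_of_nat_mult[symmetric] by (simp only: mult_ac)
  then show ?thesis by (simp only: dedekind_eta_def eprod_def)
qed

text \<open>Writing e for exp(pi i tau / 12), one has e^24 = z, and the eta quotients become
  quotients of Euler products in which only integral powers of z survive.\<close>

lemma
  assumes z: "norm z < 1" "z \<noteq> 0"
  shows A_fun_eq: "A_fun z = phi z ^ 4 + 16 * z * psi z ^ 4"
    and alpha_perp_eprod: "alpha_perp z = 1 / (1 + 1 / 64 * (eprod z ^ 24 / (z * eprod (z\<^sup>2) ^ 24)))"
proof -
  define \<tau> where "\<tau> = nome_tau z"
  define e where "e = exp (of_real pi * \<i> * \<tau> / 12)"
  have z_exp: "exp (2 * of_real pi * \<i> * \<tau>) = z"
    using z by (simp add: \<tau>_def nome_tau_def)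
  have e0: "e \<noteq> 0" by (simp add: e_def)
  have ez: "e ^ 24 = z"
    unfolding z_exp[symmetric] e_def exp_of_nat_mult[symmetric] by (simp add: mult_ac)
  have eta: "dedekind_eta (of_nat m * \<tau>) = e ^ m * eprod (z ^ m)" for m
  proof -
    have "exp (of_real pi * \<i> * (of_nat m * \<tau>) / 12) = e ^ m"
      unfolding e_def exp_of_nat_mult[symmetric] by (simp add: mult_ac)
    moreover have "exp (2 * of_real pi * \<i> * (of_nat m * \<tau>)) = z ^ m"
      unfolding z_exp[symmetric] exp_of_nat_mult[symmetric] by (simp add: mult_ac)
    ultimately show ?thesis by (simp only: dedekind_eta_eprod)
  qed
  have eta': "dedekind_eta \<tau> = e * eprod z" "dedekind_eta (2 * \<tau>) = e ^ 2 * eprod (z\<^sup>2)"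
    "dedekind_eta (4 * \<tau>) = e ^ 4 * eprod (z ^ 4)"
    using eta[of 1] eta[of 2] eta[of 4] by simp_all
  have n2: "norm (z\<^sup>2) < 1" using norm_power_less_one[OF z(1)] by simp
  have E2: "eprod (z\<^sup>2) \<noteq> 0" by (rule eprod_nonzero[OF n2])
  have p24: "e ^ 48 = z * e ^ 24" "e ^ 32 = z * e ^ 8"
    by (simp_all flip: ez power_add)
  have "A_fun z = (e ^ 8 * eprod z ^ 8 + 32 * (e ^ 32 * eprod (z ^ 4) ^ 8)) / (e ^ 8 * eprod (z\<^sup>2) ^ 4)"
    unfolding A_fun_def Let_def \<tau>_def[symmetric] eta' by (simp add: power_mult_distrib flip: power_mult)
  also have "\<dots> = (eprod z ^ 8 + 32 * (z * eprod (z ^ 4) ^ 8)) / eprod (z\<^sup>2) ^ 4"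
    unfolding p24 using e0 E2 by (simp add: divide_simps) (simp add: algebra_simps)
  also have "\<dots> = (eprod z ^ 2 / eprod (z\<^sup>2)) ^ 4 + 32 * z * (eprod (z ^ 4) ^ 2 / eprod (z\<^sup>2)) ^ 4"
    by (simp add: power_divide add_divide_distrib mult_ac flip: power_mult)
  \<comment> \<open>Here A = theta_4^4 + 2 theta_2^4; Jacobi's identity then exchanges theta_4^4 for
    theta_3^4 - theta_2^4.\<close>
  also have "\<dots> = phi (- z) ^ 4 + 32 * z * psi z ^ 4"
    using phi_eprod[of "- z"] psi_eprod[of z] z by simp
  also have "\<dots> = phi z ^ 4 + 16 * z * psi z ^ 4"
    using jacobi_quartic[OF z] by simp
  finally show "A_fun z = phi z ^ 4 + 16 * z * psi z ^ 4" .
  have "dedekind_eta \<tau> ^ 24 / dedekind_eta (2 * \<tau>) ^ 24 = (e ^ 24 * eprod z ^ 24) / (e ^ 48 * eprod (z\<^sup>2) ^ 24)"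
    unfolding eta' by (simp add: power_mult_distrib flip: power_mult)
  also have "\<dots> = eprod z ^ 24 / (z * eprod (z\<^sup>2) ^ 24)"
    unfolding p24 using e0 z E2 by simp
  finally show "alpha_perp z = 1 / (1 + 1 / 64 * (eprod z ^ 24 / (z * eprod (z\<^sup>2) ^ 24)))"
    unfolding alpha_perp_def Let_def \<tau>_def[symmetric] by simp
qed

text \<open>The eta quotient in \<open>alpha_perp\<close> in terms of theta functions, free of
  denominators. It is the fourth power of a relation between psi phi and phi(-z)^2, obtained by
  eliminating \<open>eprod (- z)\<close>.\<close>

lemma eprod_ratio:
  assumes z: "norm z < 1" "z \<noteq> 0"
  shows "eprod z ^ 24 * (psi z ^ 4 * phi z ^ 4) = eprod (z\<^sup>2) ^ 24 * phi (- z) ^ 8"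
proof -
  have n: "norm (z\<^sup>2) < 1" "norm (z ^ 4) < 1" using norm_power_less_one[OF z(1)] by auto
  have nz: "eprod z \<noteq> 0" "eprod (z\<^sup>2) \<noteq> 0" "eprod (z ^ 4) \<noteq> 0"
    using eprod_nonzero n z by auto
  have m: "eprod (- z) * eprod (z ^ 4) = eprod (z\<^sup>2) ^ 3 / eprod z"
    using eprod_minus[OF z(1)] nz by (simp add: field_simps)
  have "psi z * phi z = (eprod (- z) * eprod (z ^ 4)) ^ 2 / eprod (z\<^sup>2) ^ 2"
    using psi_eprod[OF z] phi_eprod[OF z] by (simp add: power2_eq_square)
  also have "\<dots> = eprod (z\<^sup>2) ^ 4 / eprod z ^ 2"
    unfolding m using nz by (simp add: power_divide divide_simps flip: power_mult power_add)
  finally have "eprod z ^ 6 * (psi z * phi z) = eprod z ^ 6 * (eprod (z\<^sup>2) ^ 4 / eprod z ^ 2)"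
    by simp
  also have "\<dots> = eprod (z\<^sup>2) ^ 6 * (eprod z ^ 2 / eprod (z\<^sup>2)) ^ 2"
    using nz by (simp add: divide_simps) algebra
  also have "eprod z ^ 2 / eprod (z\<^sup>2) = phi (- z)"
    using phi_eprod[of "- z"] z by simp
  finally have "(eprod z ^ 6 * (psi z * phi z)) ^ 4 = (eprod (z\<^sup>2) ^ 6 * phi (- z) ^ 2) ^ 4"
    by simp
  then show ?thesis by (simp add: power_mult_distrib flip: power_mult)
qed

lemma
  assumes x: "x < 0"
  shows phi_of_real_exp: "psum phi_coeff j (complex_of_real (exp x)) = of_real (theta j x)"
    and psi_of_real_exp: "psum psi_coeff j (complex_of_real (exp x)) = of_real (psum psi_coeff j (exp x))"
  using of_real_psum[OF Bseq_phi_coeff, of "exp x" j] of_real_psum[OF Bseq_psi_coeff, of "exp x" j] x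
  by (simp_all add: theta_def)

lemma Afun_eq:
  assumes x: "x < 0"
  shows "Afun x = theta 0 x ^ 4 + 16 * exp x * psi (exp x) ^ 4"
proof -
  have "Afun x = theta 0 x ^ 4 * (1 + lam x)"
    by (simp add: Afun_def theta_power4)
  then show ?thesis
    using theta_pos[OF x] by (simp add: lam_eq distrib_left)
qed

lemma A_fun_of_real_exp:
  assumes x: "x < 0"
  shows "A_fun (of_real (exp x)) = of_real (Afun x)"
  using A_fun_eq[of "of_real (exp x)"] x
  by (simp add: phi_of_real_exp psi_of_real_exp Afun_eq del: of_real_exp)

lemma alpha_perp_of_real_exp:
  assumes x: "x < 0"
  shows "alpha_perp (of_real (exp x)) = of_real (alpha x)"
proof -
  define z where "z = complex_of_real (exp x)"
  \<comment> \<open>S = theta_2^4 and P = theta_3^4, so P - S = theta_4^4, and 1 + (P - S)^2 / (4 S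
    P) is the perfect square (P + S)^2 / (4 S P).\<close>
  define S P where "S = 16 * exp x * psi (exp x) ^ 4" and "P = theta 0 x ^ 4"
  have pos: "S > 0" "P > 0"
    using psi_pos[of "exp x"] theta_pos[OF x] x by (auto simp: S_def P_def)
  have z: "norm z < 1" "z \<noteq> 0" using x by (auto simp: z_def simp del: of_real_exp)
  have E: "eprod z \<noteq> 0" "eprod (z\<^sup>2) \<noteq> 0"
    using eprod_nonzero norm_power_less_one[OF z(1)] z by auto
  have SP: "16 * z * psi z ^ 4 = of_real S" "phi z ^ 4 = of_real P"
    using x by (simp_all add: S_def P_def z_def phi_of_real_exp psi_of_real_exp del: of_real_exp)
  have m: "phi (- z) ^ 4 = of_real (P - S)"
    using jacobi_quartic[OF z] SP by simp
  have "eprod z ^ 24 * (16 * z * psi z ^ 4 * phi z ^ 4) = 16 * (z * eprod (z\<^sup>2) ^ 24) * (phi (- z) ^ 4) ^ 2"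
    using eprod_ratio[OF z] by (simp flip: power_mult)
  then have "eprod z ^ 24 * of_real (S * P) = 16 * (z * eprod (z\<^sup>2) ^ 24) * of_real ((P - S) ^ 2)"
    unfolding SP m by simp
  then have "eprod z ^ 24 / (z * eprod (z\<^sup>2) ^ 24) = of_real (16 * (P - S) ^ 2 / (S * P))"
    using z E pos by (simp add: divide_simps mult_ac)
  then have "alpha_perp z = of_real (1 / (1 + 1 / 64 * (16 * (P - S) ^ 2 / (S * P))))"
    unfolding alpha_perp_eprod[OF z] by simp
  also have "1 / (1 + 1 / 64 * (16 * (P - S) ^ 2 / (S * P))) = 4 * (S / P) / (1 + S / P) ^ 2"
  proof -
    have "1 + 1 / 64 * (16 * (P - S) ^ 2 / (S * P)) = (P + S) ^ 2 / (4 * S * P)"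
      using pos by (simp add: field_simps power2_eq_square)
    moreover have "1 + S / P = (P + S) / P"
      using pos by (simp add: field_simps)
    ultimately show ?thesis using pos by (simp add: divide_simps power2_eq_square)
  qed
  also have "\<dots> = alpha x"
    by (simp add: alpha_def lam_eq S_def P_def)
  finally show ?thesis by (simp only: z_def)
qed

text \<open>\<open>D_perp\<close> uses complex derivatives, which agreement with \<open>Afun\<close>
  on the real ray cannot supply. The theta expression is differentiated in the complex variable, and
  its value is matched with \<open>Afun'\<close> through the same formula on the real side.\<close>

lemma DERIV_A_fun:
  assumes x: "x < 0"
  shows "(A_fun has_field_derivative of_real (Afun' x) / of_real (exp x)) (at (of_real (exp x)))"
proof -
  define z where "z = complex_of_real (exp x)"
  have z: "norm z < 1" "z \<noteq> 0" using x by (auto simp: z_def simp del: of_real_exp)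
  let ?D = "4 * theta 0 x ^ 3 * theta 1 x + 16 * exp x * psi (exp x) ^ 4 +
      64 * exp x * psi (exp x) ^ 3 * psum psi_coeff 1 (exp x)"
  have "((\<lambda>x. theta 0 x ^ 4 + 16 * exp x * psi (exp x) ^ 4) has_field_derivative ?D) (at x)"
    by (rule derivative_eq_intros refl DERIV_theta[OF x] DERIV_psum_exp[OF Bseq_psi_coeff x])+ simp
  then have D: "Afun' x = ?D"
    by (rule DERIV_unique_neg[OF DERIV_Afun[OF x] _ Afun_eq x])
  have "((\<lambda>z. phi z ^ 4 + 16 * z * psi z ^ 4) has_field_derivative
      4 * phi z ^ 3 * (psum phi_coeff 1 z / z) + (16 * psi z ^ 4 + 16 * z * (4 * psi z ^ 3 * (psum psi_coeff 1 z / z)))) (at z)"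
    using DERIV_psum[OF Bseq_phi_coeff z, of 0] DERIV_psum[OF Bseq_psi_coeff z, of 0]
    by (auto intro!: derivative_eq_intros)
  then have "((\<lambda>z. phi z ^ 4 + 16 * z * psi z ^ 4) has_field_derivative of_real (Afun' x) / z) (at z)"
  proof (rule DERIV_cong)
    have "of_real (Afun' x) = 4 * phi z ^ 3 * psum phi_coeff 1 z + 16 * z * psi z ^ 4 + 64 * z * psi z ^ 3 * psum psi_coeff 1 z"
      unfolding D z_def phi_of_real_exp[OF x] psi_of_real_exp[OF x] by simp
    then show "4 * phi z ^ 3 * (psum phi_coeff 1 z / z) + (16 * psi z ^ 4 + 16 * z * (4 * psi z ^ 3 * (psum psi_coeff 1 z / z))) =
       of_real (Afun' x) / z"
      using z by (simp add: field_simps)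
  qed
  \<comment> \<open>The theta expression represents \<open>A_fun\<close> on the punctured unit disc,
    an open neighbourhood of z.\<close>
  then show ?thesis unfolding z_def[symmetric]
  proof (rule has_field_derivative_transform_within_open)
    show "open (ball 0 1 - {0::complex})" by (intro open_Diff) auto
  qed (use z A_fun_eq in auto)
qed

lemma D_perp_of_real_exp:
  assumes x: "x < 0" and N: "N > 0"
  defines "A1 \<equiv> Afun x" and "A2 \<equiv> Afun (real N * x)"
  shows "D_perp N (of_real (exp x)) =
    of_real (1 / sqrt (A1 ^ 3 * A2 ^ 3) * (A1 * (real N * Afun' (real N * x)) - A2 * Afun' x))"
proof -
  define q where "q = complex_of_real (exp x)"
  have q0: "q \<noteq> 0" by (simp add: q_def)
  have Nx: "real N * x < 0" using x N by (simp add: mult_pos_neg)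
  have qN: "q ^ N = of_real (exp (real N * x))"
    by (simp add: q_def exp_of_nat_mult del: of_real_exp)
  have A: "A_fun q = of_real A1" "A_fun (q ^ N) = of_real A2"
    using A_fun_of_real_exp[OF x] A_fun_of_real_exp[OF Nx] by (simp_all only: q_def[symmetric] qN A1_def A2_def)
  have pos: "A1 > 0" "A2 > 0" using Afun_pos[OF x] Afun_pos[OF Nx] by (simp_all add: A1_def A2_def)
  have d1: "q * deriv A_fun q = of_real (Afun' x)"
    using DERIV_imp_deriv[OF DERIV_A_fun[OF x]] q0 by (simp add: q_def[symmetric])
  have "(A_fun has_field_derivative of_real (Afun' (real N * x)) / q ^ N) (at (q ^ N))"
    using DERIV_A_fun[OF Nx] by (simp only: qN)
  then have "((\<lambda>z. A_fun (z ^ N)) has_field_derivative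
      of_real (Afun' (real N * x)) / q ^ N * (of_nat N * q ^ (N - Suc 0))) (at q)"
    by (rule DERIV_chain2) (auto intro!: derivative_eq_intros)
  then have "q * deriv (\<lambda>z. A_fun (z ^ N)) q =
      of_real (Afun' (real N * x)) / q ^ N * (of_nat N * (q * q ^ (N - Suc 0)))"
    using DERIV_imp_deriv by fastforce
  also have "q * q ^ (N - Suc 0) = q ^ N" using N by (cases N) auto
  finally have d2: "q * deriv (\<lambda>z. A_fun (z ^ N)) q = of_real (real N * Afun' (real N * x))"
    using q0 by simp
  \<comment> \<open>Both values of A are positive, so the principal root is the ordinary real
    one.\<close>
  have "csqrt (A_fun q ^ 3 * A_fun (q ^ N) ^ 3) = of_real (sqrt (A1 ^ 3 * A2 ^ 3))"
    unfolding A using pos by (simp add: csqrt_of_real_nonneg del: of_real_mult of_real_power flip: of_real_mult of_real_power)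
  then show ?thesis
    unfolding D_perp_def q_def[symmetric] det_2 vector_2 d1 d2 A by simp
qed

theorem theorem6p1:
  fixes N :: nat and \<alpha> a b X :: complex
  assumes N: "N > 1"
    and \<alpha>: "\<alpha> = alpha_perp (of_real (exp (- pi * sqrt (2 * real N))))"
    and b: "b = 1 - 2 * \<alpha>"
    and a: "a = - (1 / (2 * of_real (sqrt (real N)))) *
                D_perp N (of_real (exp (- 2 * pi / sqrt (2 * real N))))"
    and X: "X = 4 * \<alpha> * (1 - \<alpha>)"
  shows "(\<lambda>k. pochhammer (1/2) k * pochhammer (1/4) k * pochhammer (3/4) k / (fact k) ^ 3
              * (b * of_nat k + a) * X ^ k)
         sums of_real (sqrt (2 / real N) * (1 / (2 * pi)))"
proof -
  define n where "n = real N"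
  define x0 where "x0 = - pi * sqrt (2 * n)"
  define x1 where "x1 = - 2 * pi / sqrt (2 * n)"
  have n: "n > 1" using N by (simp add: n_def)
  have neg: "x0 < 0" "x1 < 0" using n by (auto simp: x0_def x1_def)
  have x0: "x0 < - pi * sqrt 2" using n by (simp add: x0_def)
  have s: "sqrt (2 * n) * sqrt (2 * n) = 2 * n" using n by simp
  \<comment> \<open>x0 is the logarithm of q^N and x1 that of q; x1 is also the image of x0 under
    the inversion. Hence A and A' at x1 are determined by their values at x0.\<close>
  have x01: "n * x1 = x0" "2 * pi\<^sup>2 / x0 = x1" and x0sq: "x0\<^sup>2 = 2 * n * pi\<^sup>2"
    using n s by (auto simp: x0_def x1_def field_simps power2_eq_square)
  define A D where "A = Afun x0" and "D = Afun' x0"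
  have A: "A > 0" using Afun_pos[OF neg(1)] by (simp add: A_def)
  have A1: "Afun x1 = n * A"
    using Afun_Fricke[OF neg(1)] unfolding x01 x0sq by (simp add: A_def)
  have D1: "Afun' x1 = - n * (x0 / pi\<^sup>2 * A + n * D)"
    using Afun'_Fricke[OF neg(1)] n unfolding x01 x0sq A_def D_def by (simp add: field_simps)
  \<comment> \<open>The determinant becomes 2 n^2 A D + n x0 A^2 / pi^2; dividing by n sqrt n A^3
    and multiplying by -1 / (2 sqrt n) gives this value of a.\<close>
  define ar where "ar = - D / A\<^sup>2 - x0 / (2 * n * pi\<^sup>2 * A)"
  have sq: "sqrt ((n * A) ^ 3 * A ^ 3) = n * sqrt n * A ^ 3"
  proof -
    have "(n * A) ^ 3 * A ^ 3 = (n * sqrt n * A ^ 3)\<^sup>2"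
      using n by (simp add: power_mult_distrib eval_nat_numeral)
    then show ?thesis using n A by simp
  qed
  have Dp: "D_perp N (of_real (exp x1)) =
      of_real (1 / (n * sqrt n * A ^ 3) * (n * A * (n * D) - A * (- n * (x0 / pi\<^sup>2 * A + n * D))))"
    using D_perp_of_real_exp[OF neg(2), of N] N
    unfolding n_def[symmetric] x01 A1 D1 A_def[symmetric] D_def[symmetric] sq by simp
  have "a = of_real (- (1 / (2 * sqrt n)) *
      (1 / (n * sqrt n * A ^ 3) * (n * A * (n * D) - A * (- n * (x0 / pi\<^sup>2 * A + n * D)))))"
    using Dp unfolding a n_def[symmetric] x1_def by simp
  also have "- (1 / (2 * sqrt n)) *
      (1 / (n * sqrt n * A ^ 3) * (n * A * (n * D) - A * (- n * (x0 / pi\<^sup>2 * A + n * D)))) =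
      - (1 / (2 * (sqrt n * sqrt n) * n * A ^ 3)) * (n * A * (n * D) - A * (- n * (x0 / pi\<^sup>2 * A + n * D)))"
    by simp
  also have "\<dots> = ar"
    unfolding ar_def using n A by (simp add: field_simps eval_nat_numeral)
  finally have ar: "a = of_real ar" .
  have al: "\<alpha> = of_real (alpha x0)"
    using alpha_perp_of_real_exp[OF neg(1)] unfolding \<alpha> by (simp only: x0_def n_def)
  have br: "b = of_real (1 - 2 * alpha x0)" and Xr: "X = of_real (Xfun x0)"
    unfolding b X al by (simp_all add: Xfun_def)
  have s: "(\<lambda>k. real k ^ j * ram_coeff k * Xfun x0 ^ k) sums psum ram_coeff j (Xfun x0)" for j
    using psum_sums[OF Bseq_ram_coeff, of "Xfun x0" j] Xfun_bounds[OF x0] by simp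
  have "(\<lambda>k. (1 - 2 * alpha x0) * (real k ^ 1 * ram_coeff k * Xfun x0 ^ k) + ar * (real k ^ 0 * ram_coeff k * Xfun x0 ^ k))
      sums ((1 - 2 * alpha x0) * psum ram_coeff 1 (Xfun x0) + ar * psum ram_coeff 0 (Xfun x0))"
    by (intro sums_add sums_mult s)
  also have "(1 - 2 * alpha x0) * psum ram_coeff 1 (Xfun x0) + ar * psum ram_coeff 0 (Xfun x0) = D / A + ar * A"
    unfolding psum_ram_coeff_Xfun[OF x0] psum_ram_coeff_1_Xfun[OF x0] by (simp add: A_def D_def)
  \<comment> \<open>The derivative D drops out: only the term from differentiating the factor x^2 in
    the inversion formula survives.\<close>
  also have "D / A + ar * A = - x0 / (2 * n * pi\<^sup>2)"
    unfolding ar_def using n A by (simp add: field_simps power2_eq_square)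
  also have "\<dots> = sqrt (2 / n) * (1 / (2 * pi))"
  proof -
    have "sqrt (2 * n) / n = sqrt (2 / n)"
      using n by (simp add: real_sqrt_mult real_sqrt_divide field_simps)
    then show ?thesis
      unfolding x0_def by (simp add: power2_eq_square field_simps)
  qed
  finally have "(\<lambda>k. complex_of_real ((1 - 2 * alpha x0) * (real k ^ 1 * ram_coeff k * Xfun x0 ^ k) +
      ar * (real k ^ 0 * ram_coeff k * Xfun x0 ^ k))) sums of_real (sqrt (2 / n) * (1 / (2 * pi)))"
    by (rule sums_of_real)
  also have "(\<lambda>k. complex_of_real ((1 - 2 * alpha x0) * (real k ^ 1 * ram_coeff k * Xfun x0 ^ k) +
      ar * (real k ^ 0 * ram_coeff k * Xfun x0 ^ k))) =
     (\<lambda>k. pochhammer (1/2) k * pochhammer (1/4) k * pochhammer (3/4) k / (fact k) ^ 3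
              * (b * of_nat k + a) * X ^ k)"
  proof
    fix k
    have r: "complex_of_real (ram_coeff k) = pochhammer (1/2) k * pochhammer (1/4) k * pochhammer (3/4) k / (fact k) ^ 3"
      using pochhammer_of_real[of "1/2 :: real" k, where 'a = complex]
        pochhammer_of_real[of "1/4 :: real" k, where 'a = complex]
        pochhammer_of_real[of "3/4 :: real" k, where 'a = complex]
      by (simp add: ram_coeff_def)
    show "complex_of_real ((1 - 2 * alpha x0) * (real k ^ 1 * ram_coeff k * Xfun x0 ^ k) +
      ar * (real k ^ 0 * ram_coeff k * Xfun x0 ^ k)) = pochhammer (1/2) k * pochhammer (1/4) k * pochhammer (3/4) k / (fact k) ^ 3
              * (b * of_nat k + a) * X ^ k"
      unfolding br ar Xr r[symmetric] by (simp add: algebra_simps)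
  qed
  finally show ?thesis by (simp only: n_def)
qed

end
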